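(* Let $c\in\mathbb{C}$ and let $V,V'$ be objects of $\mathcal{C}_B$. Then for all but finitely many values of $x$ modulo $\mathbb{Z}+\mathbb{Z}\tau$, the map $$\mathcal{H}^c_x:\ \mathrm{Hom}_{\mathcal{C}_B}(V,V')\to\mathrm{Hom}_{\mathcal{D}_B}(\mathcal{H}^c_x(V),\mathcal{H}^c_x(V'))$$ is an isomorphism.
   Context: Notation. Fix $\tau\in\mathbb{C}$ with $\mathrm{Im}(\tau)>0$, $\gamma\in\mathbb{R}\setminus\mathbb{Q}$ and an integer $n\ge 2$. Let $(v_i)_{i=1}^n$ be the canonical basis of $\mathbb{C}^n$. Let $\mathfrak{h}$ be the space of diagonal traceless $n\times n$ matrices, with $\mathfrak{h}^*$ identified with $\{\lambda=\sum_i\lambda_iE_{ii}^*\mid\sum_i\lambda_i=0\}$; the weight of $v_i$ is $\omega_i=E_{ii}^*-\frac1n\sum_kE_{kk}^*$. Put $\theta_{\kappa,\kappa'}(t;\tau)=\sum_{m\in\mathbb{Z}}e^{i\pi(m+\kappa)((m+\kappa)\tau+2(t+\kappa'))}$. Let $\xi=e^{2i\pi/n}$ and let $A,B$ be the matrices with $Av_k=\xi^{k-1}v_k$, $Bv_k=v_{k-1}$ for $k\ge2$, $Bv_1=v_n$. Lower indices on operators indicate the tensor factors on which they act. Belavin's R-matrix. $R^B(z)\in\mathrm{End}(\mathbb{C}^n)\otimes\mathrm{End}(\mathbb{C}^n)$ is uniquely determined by: (1) $R^B(z)R^B_{21}(-z)=1$; (2) $R^B$ is meromorphic with simple poles at $z\in\gamma+\mathbb{Z}+\tau\mathbb{Z}$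 (and no other poles); (3) $R^B(0)=P$, the permutation $x\otimes y\mapsto y\otimes x$; (4) $R^B(z+1)=A_1R^B(z)A_1^{-1}=A_2^{-1}R^B(z)A_2$ and $R^B(z+\tau)=e^{-2i\pi\frac{n-1}{n}\gamma}B_1R^B(z)B_1^{-1}=e^{-2i\pi\frac{n-1}{n}\gamma}B_2^{-1}R^B(z)B_2$. Category $\mathcal{C}_B$. Objects: pairs $(V,L(z))$ with $V$ a finite-dimensional vector space and $L(z)\in\mathrm{End}(\mathbb{C}^n)\otimes\mathrm{End}(V)$ an invertible meromorphic function with $L(z+n)=L(z)=L(z+n\tau)$ and (RLL) $R^B_{12}(z-w)L_{13}(z)L_{23}(w)=L_{23}(w)L_{13}(z)R^B_{12}(z-w)$ in $\mathrm{End}(\mathbb{C}^n)\otimes\mathrm{End}(\mathbb{C}^n)\otimes\mathrm{End}(V)$. Morphisms $(V,L)\to(V',L')$: linear maps $\varphi:V\to V'$ with $(1\otimes\varphi)L(z)=L'(z)(1\otimes\varphi)$. Category $\mathcal{D}_B$. Let $M_{\mathfrak{h}^*}$ be the field of meromorphic functions on $\mathfrak{h}^*$ that are $(n\omega_i)$-periodic for all $i$, $D_{\mathfrak{h}^*}$ the $\mathbb{C}$-algebra generated by $M_{\mathfrak{h}^*}$ and the shifts $T_\mu:f(\lambda)\mapsto f(\lambda+\mu)$, $\mu\in\mathfrak{h}^*$; $V_{\mathfrak{h}^*}=M_{\mathfrak{h}^*}\otimes V$ and $D(V)=D_{\mathfrak{h}^*}\otimes\mathrm{End}(V)$. Objects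 of $\mathcal{D}_B$: pairs $(V,L(z))$ with $V$ a finite-dimensional vector space and $L(z)\in\mathrm{End}(\mathbb{C}^n)\otimes D(V)$ an invertible operator with coefficients meromorphic in $z$, satisfying (RLL) in $\mathrm{End}(\mathbb{C}^n)\otimes\mathrm{End}(\mathbb{C}^n)\otimes D(V)$. Morphisms $(V,L)\to(V',L')$: $(n\omega_i)$-periodic meromorphic functions $\varphi:\mathfrak{h}^*\to\mathrm{Hom}(V,V')$ with $(1\otimes\varphi)L(z)=L'(z)(1\otimes\varphi)$ as operators $\mathbb{C}^n\otimes V_{\mathfrak{h}^*}\to\mathbb{C}^n\otimes V'_{\mathfrak{h}^*}$. The matrix $S$. Let $\Phi:\mathbb{C}\to\mathbb{C}^n$ be the nonzero holomorphic function (unique up to a scalar) with $\Phi(u+1)=A\Phi(u)$ and $\Phi(u+\tau)=e^{-i\pi\tau/n-2i\pi u/n}B\Phi(u)$; explicitly one may take the $l$-th component to be $\theta_{(l-1)/n,0}(u;n\tau)$, $l=1,\dots,n$. Let $S(z,\lambda)$ be the $n\times n$ matrix whose $j$-th column is $\Phi(z-n\lambda_j)$; it is invertible for generic $(z,\lambda)$. The functor $\mathcal{H}^c_x$. Let $e^{-\gamma D_1}$ be the shift operator sending $f(\lambda)v_i\otimes y$ to $f(\lambda-\gamma\omega_i)v_i\otimes y$. Let $I^c_x=(\mathbb{C},S(z-x,\lambda)e^{-\gamma D_1}S(z-x-c,\lambda)^{-1})$, an object of $\mathcal{D}_B$. The functor $\mathcal{H}^c_x:\mathcal{C}_B\to\mathcal{D}_B$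 sends $(V,L(z))$ to $I^c_x\otimes V=(V,\ S_1(z-x,\lambda)e^{-\gamma D_1}S_1(z-x-c,\lambda)^{-1}L_{12}(z))$ and sends a morphism $\varphi$ to itself, viewed as a constant function of $\lambda$. *)

theory Defs
  imports "HOL-Complex_Analysis.Complex_Analysis"
begin

text \<open>
  Indices of $\mathbb{C}^n$ run through \<open>{1..n}\<close>. A matrix \<open>M\<close> over a finite index set \<open>I\<close> is a function
  with \<open>M v\<^sub>b = (\<Sum>a\<in>I. M a b *\<^sub>C v\<^sub>a)\<close>; values off \<open>I\<close> are irrelevant. Elements of
  $\mathrm{End}(\mathbb{C}^n)\otimes\mathrm{End}(\mathbb{C}^n)$ are matrices over \<open>{1..n} \<times> {1..n}\<close>.
\<close>

type_synonym 'i cmat = "'i \<Rightarrow> 'i \<Rightarrow> complex"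

definition mat_mul :: "'i set \<Rightarrow> 'i cmat \<Rightarrow> 'i cmat \<Rightarrow> 'i cmat" where
  "mat_mul I M N = (\<lambda>a c. \<Sum>b\<in>I. M a b * N b c)"

definition mat_one :: "'i cmat" where
  "mat_one = (\<lambda>a b. if a = b then 1 else 0)"

definition mat_scale :: "complex \<Rightarrow> 'i cmat \<Rightarrow> 'i cmat" where
  "mat_scale r M = (\<lambda>a b. r * M a b)"

definition mat_eq :: "'i set \<Rightarrow> 'i cmat \<Rightarrow> 'i cmat \<Rightarrow> bool" where
  "mat_eq I M N \<longleftrightarrow> (\<forall>a\<in>I. \<forall>b\<in>I. M a b = N a b)"

text \<open>The inverse; an arbitrary matrix if \<open>M\<close> is singular.\<close>

definition mat_inv :: "'i set \<Rightarrow> 'i cmat \<Rightarrow> 'i cmat" where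
  "mat_inv I M =
     (SOME N. mat_eq I (mat_mul I M N) mat_one \<and> mat_eq I (mat_mul I N M) mat_one)"

definition leg1 :: "nat cmat \<Rightarrow> (nat \<times> nat) cmat" where
  "leg1 M = (\<lambda>(i, j) (k, l). M i k * mat_one j l)"

definition leg2 :: "nat cmat \<Rightarrow> (nat \<times> nat) cmat" where
  "leg2 M = (\<lambda>(i, j) (k, l). mat_one i k * M j l)"

definition flip21 :: "(nat \<times> nat) cmat \<Rightarrow> (nat \<times> nat) cmat" where
  "flip21 M = (\<lambda>(i, j) (k, l). M (j, i) (l, k))"

definition perm_mat :: "(nat \<times> nat) cmat" where
  "perm_mat = (\<lambda>(i, j) (k, l). if i = l \<and> j = k then 1 else 0)"

definition xi :: "nat \<Rightarrow> complex" where
  "xi n = exp (2 * \<i> * of_real pi / of_nat n)"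

definition matA :: "nat \<Rightarrow> nat cmat" where
  "matA n = (\<lambda>i k. if i = k then xi n ^ (k - 1) else 0)"

definition matB :: "nat \<Rightarrow> nat cmat" where
  "matB n = (\<lambda>i k. if i = (if k = 1 then n else k - 1) then 1 else 0)"

definition lattice :: "complex \<Rightarrow> complex set" where
  "lattice \<tau> = {of_int a + of_int b * \<tau> | a b :: int. True}"

text \<open>
  A meromorphic function of one variable is only determined off a discrete set, hence identities
  between such functions are stated for \<open>\<forall>\<^sub>\<approx>z\<close>. The matrix \<open>R\<close> itself is taken in the
  normal form \<open>nicely_meromorphic_on\<close>, so that \<open>R 0\<close> is meaningful.
\<close>

definition belavin_R ::
    "nat \<Rightarrow> complex \<Rightarrow> real \<Rightarrow> (complex \<Rightarrow> (nat \<times> nat) cmat) \<Rightarrow> bool" where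
  "belavin_R n \<tau> \<gamma> R \<longleftrightarrow>
    (let I = {1..n}; J = I \<times> I;
         A = matA n; A' = mat_inv I A; B = matB n; B' = mat_inv I B;
         q = exp (- 2 * \<i> * of_real pi * (of_nat n - 1) / of_nat n * of_real \<gamma>)
     in
      (\<forall>a\<in>J. \<forall>b\<in>J. (\<lambda>z. R z a b) nicely_meromorphic_on UNIV) \<and>
      (\<forall>\<^sub>\<approx>z. mat_eq J (mat_mul J (R z) (flip21 (R (- z)))) mat_one) \<and>
      (\<forall>p. (\<exists>a\<in>J. \<exists>b\<in>J. is_pole (\<lambda>z. R z a b) p) \<longleftrightarrow> p - of_real \<gamma> \<in> lattice \<tau>) \<and>
      (\<forall>p. \<forall>a\<in>J. \<forall>b\<in>J. is_pole (\<lambda>z. R z a b) p \<longrightarrow> zorder (\<lambda>z. R z a b) p = - 1) \<and>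
      mat_eq J (R 0) perm_mat \<and>
      (\<forall>\<^sub>\<approx>z. mat_eq J (R (z + 1)) (mat_mul J (leg1 A) (mat_mul J (R z) (leg1 A')))) \<and>
      (\<forall>\<^sub>\<approx>z. mat_eq J (R (z + 1)) (mat_mul J (leg2 A') (mat_mul J (R z) (leg2 A)))) \<and>
      (\<forall>\<^sub>\<approx>z. mat_eq J (R (z + \<tau>))
               (mat_scale q (mat_mul J (leg1 B) (mat_mul J (R z) (leg1 B'))))) \<and>
      (\<forall>\<^sub>\<approx>z. mat_eq J (R (z + \<tau>))
               (mat_scale q (mat_mul J (leg2 B') (mat_mul J (R z) (leg2 B))))))"

text \<open>
  A complex vector space is a type \<open>'v\<close> with a scalar multiplication \<open>s\<close>. An element of
  $\mathrm{End}(\mathbb{C}^n)\otimes\mathrm{End}(V)$ is given by its matrix coefficients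
  \<open>L i j \<in> End(V)\<close>, that is, \<open>L = (\<Sum>i j. E\<^sub>i\<^sub>j \<otimes> L i j)\<close>.
\<close>

type_synonym 'v scaling = "complex \<Rightarrow> 'v \<Rightarrow> 'v"
type_synonym 'v Lmat = "nat \<Rightarrow> nat \<Rightarrow> 'v \<Rightarrow> 'v"

definition fin_dim :: "'v::ab_group_add scaling \<Rightarrow> bool" where
  "fin_dim s \<longleftrightarrow> (\<exists>B. finite_dimensional_vector_space s B)"

definition functional :: "'v::ab_group_add scaling \<Rightarrow> ('v \<Rightarrow> complex) \<Rightarrow> bool" where
  "functional s f \<longleftrightarrow> Vector_Spaces.linear s (*) f"

definition mero_Lmat ::
    "nat \<Rightarrow> 'v::ab_group_add scaling \<Rightarrow> (complex \<Rightarrow> 'v Lmat) \<Rightarrow> bool" where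
  "mero_Lmat n s L \<longleftrightarrow>
     (\<forall>i\<in>{1..n}. \<forall>j\<in>{1..n}.
        (\<forall>z. Vector_Spaces.linear s s (L z i j)) \<and>
        (\<forall>v f. functional s f \<longrightarrow> (\<lambda>z. f (L z i j v)) meromorphic_on UNIV))"

definition Lmat_inverse :: "nat \<Rightarrow> 'v::ab_group_add Lmat \<Rightarrow> 'v Lmat \<Rightarrow> bool" where
  "Lmat_inverse n L K \<longleftrightarrow>
     (\<forall>i\<in>{1..n}. \<forall>k\<in>{1..n}. \<forall>v.
        (\<Sum>j=1..n. L i j (K j k v)) = (if i = k then v else 0) \<and>
        (\<Sum>j=1..n. K i j (L j k v)) = (if i = k then v else 0))"

text \<open>Operators on $\mathbb{C}^n\otimes\mathbb{C}^n\otimes V$, whose elements are functions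
  \<open>F\<close> on index pairs with values in \<open>V\<close>.\<close>

definition act12 ::
    "nat \<Rightarrow> 'v::ab_group_add scaling \<Rightarrow> (nat \<times> nat) cmat \<Rightarrow> (nat \<times> nat \<Rightarrow> 'v) \<Rightarrow> nat \<times> nat \<Rightarrow> 'v"
  where "act12 n s M F = (\<lambda>a. \<Sum>b\<in>{1..n} \<times> {1..n}. s (M a b) (F b))"

definition act13 ::
    "nat \<Rightarrow> 'v::ab_group_add Lmat \<Rightarrow> (nat \<times> nat \<Rightarrow> 'v) \<Rightarrow> nat \<times> nat \<Rightarrow> 'v" where
  "act13 n K F = (\<lambda>(i, j). \<Sum>k=1..n. K i k (F (k, j)))"

definition act23 ::
    "nat \<Rightarrow> 'v::ab_group_add Lmat \<Rightarrow> (nat \<times> nat \<Rightarrow> 'v) \<Rightarrow> nat \<times> nat \<Rightarrow> 'v" where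
  "act23 n K F = (\<lambda>(i, j). \<Sum>k=1..n. K j k (F (i, k)))"

definition RLL ::
    "nat \<Rightarrow> (complex \<Rightarrow> (nat \<times> nat) cmat) \<Rightarrow> 'v::ab_group_add scaling \<Rightarrow>
     (complex \<Rightarrow> 'v Lmat) \<Rightarrow> bool" where
  "RLL n R s L \<longleftrightarrow>
     (\<forall>\<^sub>\<approx>z. \<forall>\<^sub>\<approx>w. \<forall>F. \<forall>a\<in>{1..n} \<times> {1..n}.
        act12 n s (R (z - w)) (act13 n (L z) (act23 n (L w) F)) a =
        act23 n (L w) (act13 n (L z) (act12 n s (R (z - w)) F)) a)"

definition CB_object ::
    "nat \<Rightarrow> complex \<Rightarrow> (complex \<Rightarrow> (nat \<times> nat) cmat) \<Rightarrow> 'v::ab_group_add scaling \<Rightarrow>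
     (complex \<Rightarrow> 'v Lmat) \<Rightarrow> bool" where
  "CB_object n \<tau> R s L \<longleftrightarrow>
     fin_dim s \<and> mero_Lmat n s L \<and>
     (\<exists>K. mero_Lmat n s K \<and> (\<forall>\<^sub>\<approx>z. Lmat_inverse n (L z) (K z))) \<and>
     (\<forall>\<^sub>\<approx>z. \<forall>i\<in>{1..n}. \<forall>j\<in>{1..n}.
        L (z + of_nat n) i j = L z i j \<and> L (z + of_nat n * \<tau>) i j = L z i j) \<and>
     RLL n R s L"

definition CB_Hom ::
    "nat \<Rightarrow> 'v::ab_group_add scaling \<Rightarrow> (complex \<Rightarrow> 'v Lmat) \<Rightarrow>
     'w::ab_group_add scaling \<Rightarrow> (complex \<Rightarrow> 'w Lmat) \<Rightarrow> ('v \<Rightarrow> 'w) set" where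
  "CB_Hom n s L s' L' =
     {\<phi>. Vector_Spaces.linear s s' \<phi> \<and>
         (\<forall>\<^sub>\<approx>z. \<forall>i\<in>{1..n}. \<forall>j\<in>{1..n}. \<forall>v. \<phi> (L z i j v) = L' z i j (\<phi> v))}"

text \<open>$\lambda=\sum_i\lambda_iE_{ii}^*$ is represented by its coefficients, extended by zero
  off \<open>{1..n}\<close>; the topology is the product topology.\<close>

type_synonym hvec = "nat \<Rightarrow> complex"

definition hstar :: "nat \<Rightarrow> hvec set" where
  "hstar n = {p. (\<forall>i. i \<notin> {1..n} \<longrightarrow> p i = 0) \<and> (\<Sum>i=1..n. p i) = 0}"

definition omega :: "nat \<Rightarrow> nat \<Rightarrow> hvec" where
  "omega n i = (\<lambda>k. if k \<in> {1..n} then (if k = i then 1 else 0) - 1 / of_nat n else 0)"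

text \<open>\<open>move p r q\<close> is the point \<open>p + r q\<close>.\<close>

definition move :: "hvec \<Rightarrow> complex \<Rightarrow> hvec \<Rightarrow> hvec" where
  "move p r q = (\<lambda>k. p k + r * q k)"

text \<open>Holomorphy in several variables (\<open>U\<close> open): continuous, and complex differentiable along
  every complex line.\<close>

definition holo :: "nat \<Rightarrow> hvec set \<Rightarrow> (hvec \<Rightarrow> complex) \<Rightarrow> bool" where
  "holo n U f \<longleftrightarrow>
     continuous_on (U \<inter> hstar n) f \<and>
     (\<forall>p\<in>U \<inter> hstar n. \<forall>q\<in>hstar n. (\<lambda>t. f (move p t q)) field_differentiable (at 0))"

text \<open>\<open>P\<close> holds on a dense open subset of \<open>U \<inter> hstar n\<close>.\<close>

definition generically :: "nat \<Rightarrow> hvec set \<Rightarrow> (hvec \<Rightarrow> bool) \<Rightarrow> bool" where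
  "generically n U P \<longleftrightarrow>
     (\<exists>W. open W \<and> U \<inter> hstar n \<subseteq> closure (W \<inter> U \<inter> hstar n) \<and>
          (\<forall>p\<in>W \<inter> U \<inter> hstar n. P p))"

text \<open>
  Representatives of meromorphic functions: everywhere defined functions that locally agree
  generically with a quotient of holomorphic functions. Two of them represent the same
  meromorphic function iff they agree generically.
\<close>

definition mero :: "nat \<Rightarrow> (hvec \<Rightarrow> complex) \<Rightarrow> bool" where
  "mero n f \<longleftrightarrow>
     (\<forall>p\<in>hstar n. \<exists>U g h. open U \<and> p \<in> U \<and> holo n U g \<and> holo n U h \<and>
        generically n U (\<lambda>q. h q \<noteq> 0 \<and> f q = g q / h q))"

definition M_hstar :: "nat \<Rightarrow> (hvec \<Rightarrow> complex) set" where
  "M_hstar n =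
     {f. mero n f \<and>
         (\<forall>i\<in>{1..n}. generically n UNIV (\<lambda>p. f (move p (of_nat n) (omega n i)) = f p))}"

text \<open>$V_{\mathfrak{h}^*}=M_{\mathfrak{h}^*}\otimes V$ as \<open>V\<close>-valued functions (\<open>V\<close> is finite-dimensional).\<close>

definition V_hstar :: "nat \<Rightarrow> 'v::ab_group_add scaling \<Rightarrow> (hvec \<Rightarrow> 'v) set" where
  "V_hstar n s = {F. \<forall>f. functional s f \<longrightarrow> (\<lambda>p. f (F p)) \<in> M_hstar n}"

definition M_Hom ::
    "nat \<Rightarrow> 'v::ab_group_add scaling \<Rightarrow> 'w::ab_group_add scaling \<Rightarrow> (hvec \<Rightarrow> 'v \<Rightarrow> 'w) set" where
  "M_Hom n s s' =
     {\<phi>. (\<forall>p\<in>hstar n. Vector_Spaces.linear s s' (\<phi> p)) \<and> (\<forall>v. (\<lambda>p. \<phi> p v) \<in> V_hstar n s')}"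

definition mero_rel ::
    "nat \<Rightarrow> 'v::ab_group_add scaling \<Rightarrow> 'w::ab_group_add scaling \<Rightarrow>
     ((hvec \<Rightarrow> 'v \<Rightarrow> 'w) \<times> (hvec \<Rightarrow> 'v \<Rightarrow> 'w)) set" where
  "mero_rel n s s' =
     {(\<phi>, \<psi>). \<phi> \<in> M_Hom n s s' \<and> \<psi> \<in> M_Hom n s s' \<and> generically n UNIV (\<lambda>p. \<phi> p = \<psi> p)}"

text \<open>
  An element of $\mathbb{C}^n\otimes V_{\mathfrak{h}^*}$ is a function \<open>F\<close> whose \<open>i\<close>-th component is
  \<open>F i\<close>; the \<open>L\<close>-operators of $\mathcal{D}_B$ are families of operators on such functions. A morphism is
  a meromorphic function, that is, a class of representatives modulo \<open>mero_rel\<close>.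
\<close>

type_synonym 'v Dop = "(nat \<Rightarrow> hvec \<Rightarrow> 'v) \<Rightarrow> nat \<Rightarrow> hvec \<Rightarrow> 'v"

definition DB_Hom ::
    "nat \<Rightarrow> 'v::ab_group_add scaling \<Rightarrow> (complex \<Rightarrow> 'v Dop) \<Rightarrow>
     'w::ab_group_add scaling \<Rightarrow> (complex \<Rightarrow> 'w Dop) \<Rightarrow> (hvec \<Rightarrow> 'v \<Rightarrow> 'w) set set" where
  "DB_Hom n s L s' L' =
     {\<phi> \<in> M_Hom n s s'.
        \<forall>\<^sub>\<approx>z. \<forall>F. (\<forall>j\<in>{1..n}. F j \<in> V_hstar n s) \<longrightarrow>
          (\<forall>i\<in>{1..n}. generically n UNIV
             (\<lambda>p. \<phi> p (L z F i p) = L' z (\<lambda>j q. \<phi> q (F j q)) i p))}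
     // mero_rel n s s'"

definition theta :: "real \<Rightarrow> real \<Rightarrow> complex \<Rightarrow> complex \<Rightarrow> complex" where
  "theta \<kappa> \<kappa>' t \<tau> =
     (\<Sum>\<^sub>\<infinity>m\<in>(UNIV::int set).
        exp (\<i> * of_real pi * (of_int m + of_real \<kappa>) *
             ((of_int m + of_real \<kappa>) * \<tau> + 2 * (t + of_real \<kappa>'))))"

definition Phi :: "nat \<Rightarrow> complex \<Rightarrow> complex \<Rightarrow> nat \<Rightarrow> complex" where
  "Phi n \<tau> u l = theta ((real l - 1) / real n) 0 u (of_nat n * \<tau>)"

definition S_mat :: "nat \<Rightarrow> complex \<Rightarrow> complex \<Rightarrow> hvec \<Rightarrow> nat cmat" where
  "S_mat n \<tau> z p = (\<lambda>i j. Phi n \<tau> (z - of_nat n * p j) i)"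

definition mult1 :: "nat \<Rightarrow> 'v::ab_group_add scaling \<Rightarrow> (hvec \<Rightarrow> nat cmat) \<Rightarrow> 'v Dop" where
  "mult1 n s M F = (\<lambda>i p. \<Sum>j=1..n. s (M p i j) (F j p))"

definition exp_shift :: "nat \<Rightarrow> real \<Rightarrow> 'v Dop" where
  "exp_shift n \<gamma> F = (\<lambda>i p. F i (move p (- of_real \<gamma>) (omega n i)))"

definition mult12 :: "nat \<Rightarrow> 'v::ab_group_add Lmat \<Rightarrow> 'v Dop" where
  "mult12 n L F = (\<lambda>i p. \<Sum>j=1..n. L i j (F j p))"

definition H_obj ::
    "nat \<Rightarrow> complex \<Rightarrow> real \<Rightarrow> complex \<Rightarrow> complex \<Rightarrow> 'v::ab_group_add scaling \<Rightarrow>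
     (complex \<Rightarrow> 'v Lmat) \<Rightarrow> complex \<Rightarrow> 'v Dop" where
  "H_obj n \<tau> \<gamma> c x s L z =
     mult1 n s (S_mat n \<tau> (z - x)) \<circ> exp_shift n \<gamma> \<circ>
     mult1 n s (\<lambda>p. mat_inv {1..n} (S_mat n \<tau> (z - x - c) p)) \<circ> mult12 n (L z)"

definition H_mor ::
    "nat \<Rightarrow> 'v::ab_group_add scaling \<Rightarrow> 'w::ab_group_add scaling \<Rightarrow> ('v \<Rightarrow> 'w) \<Rightarrow>
     (hvec \<Rightarrow> 'v \<Rightarrow> 'w) set" where
  "H_mor n s s' \<phi> = mero_rel n s s' `` {\<lambda>_. \<phi>}"

text \<open>Isomorphism of vector spaces, where the target consists of classes of \<open>W\<close>-valued
  representatives and carries the operations induced by the pointwise ones.\<close>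

definition hom_iso ::
    "'w::ab_group_add scaling \<Rightarrow> (('v \<Rightarrow> 'w) \<Rightarrow> (hvec \<Rightarrow> 'v \<Rightarrow> 'w) set) \<Rightarrow>
     ('v \<Rightarrow> 'w) set \<Rightarrow> (hvec \<Rightarrow> 'v \<Rightarrow> 'w) set set \<Rightarrow> bool" where
  "hom_iso s' h X Y \<longleftrightarrow>
     bij_betw h X Y \<and>
     (\<forall>\<phi>\<in>X. \<forall>\<psi>\<in>X. \<forall>a b. \<forall>F\<in>h \<phi>. \<forall>G\<in>h \<psi>.
        (\<lambda>p v. s' a (F p v) + s' b (G p v)) \<in> h (\<lambda>v. s' a (\<phi> v) + s' b (\<psi> v)))"

end

theory Submission
  imports Defs
begin

text \<open>
  Put \<open>h = (1 + \<tau>) / 2\<close>, a zero of \<open>\<theta>(v) = theta 0 0 v \<tau>\<close>, and \<open>y = x + c\<close>. The functor is faithful because a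
  constant function determines its value, and a morphism of $\mathcal{C}_B$ commutes with everything that
  $\mathcal{H}^c_x$ adds to \<open>L\<close>. The content is that it is full.

  Let \<open>\<phi>\<close> be a morphism of $\mathcal{D}_B$. Cancelling the invertible factor $S(z-x,\lambda)$ in the intertwining
  relation and writing $q=\lambda-\gamma\omega_j$ in its \<open>j\<close>-th row, one gets (\<open>intertwiner_row\<close>)
  \[\sum_k(S(z-y,q)^{-1})_{jk}\,\bigl(\varphi(q+\gamma\omega_j)L_{kl}(z)-L'_{kl}(z)\varphi(q)\bigr)=0
    \quad\mbox{for all }j,l.\]
  All that is needed about $S^{-1}$ comes from one expansion: if $\sum_j\mu_j=0$, then
  $\prod_j\theta(u/n+\mu_j)=\sum_lb_l(\mu)\Phi_l(u)$ with coefficients that are continuous in \<open>\<mu>\<close> and do not all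
  vanish (\<open>sum_theta_coeff_Phi\<close>, \<open>tendsto_theta_coeff\<close>, \<open>theta_coeff_nonzero\<close>). Comparing zeros, the \<open>j\<close>-th row of
  $S(z,q)^{-1}$ is proportional to $b(q+(z-nh)\omega_j)$ (\<open>S_mat_inverse\<close>). Thus, up to scaling, all \<open>n\<close> rows
  tend to the same vector $b(q)$ as \<open>z\<close> tends to \<open>nh\<close>. If \<open>L\<close>, $L^{-1}$ and \<open>L'\<close> are regular at \<open>y + nh\<close>, letting
  \<open>z\<close> tend to this point in the relation above shows that $\varphi(q+\gamma\omega_j)$ does not depend on \<open>j\<close>
  (\<open>intertwiner_shift_independent\<close>). By periodicity the singularities are finite in number modulo the lattice
  (\<open>CB_object_regular\<close>), and they produce the exceptional values of \<open>x\<close>.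

  Hence the entries of \<open>\<phi>\<close> are invariant under $\gamma(\omega_i-\omega_j)$ and under $n(\omega_i-\omega_j)$. Because
  \<open>\<gamma>\<close> is real and irrational, these vectors generate a dense subgroup of the real points of $\mathfrak{h}^*$, and
  a meromorphic function with such a group of periods is constant (\<open>mero_const_of_periods\<close>). For constant \<open>\<phi>\<close>
  the invertible matrix $S^{-1}$ cancels from the relation, so that \<open>\<phi>\<close> is a morphism of $\mathcal{C}_B$
  (\<open>generically_const_intertwiner\<close>).
\<close>

section \<open>Theta series with integer summation index\<close>

text \<open>
  The summand of \<open>theta \<kappa> 0 t \<tau>\<close>, for characteristic \<open>\<kappa>' = 0\<close>.
\<close>

definition theta_term :: "real \<Rightarrow> complex \<Rightarrow> complex \<Rightarrow> int \<Rightarrow> complex" where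
  "theta_term \<kappa> t \<tau> m =
     exp (\<i> * of_real pi * (of_int m + of_real \<kappa>) * ((of_int m + of_real \<kappa>) * \<tau> + 2 * t))"

lemma summable_exp_minus_abs_int: "(\<lambda>m::int. exp (- \<bar>of_int m\<bar> :: real)) summable_on UNIV"
proof -
  have geo: "(\<lambda>k::nat. exp (- real k)) summable_on UNIV"
  proof -
    have "summable (\<lambda>k::nat. exp (-1::real) ^ k)"
      by (rule summable_geometric) auto
    also have "(\<lambda>k::nat. exp (-1::real) ^ k) = (\<lambda>k. exp (- real k))"
      by (auto simp: exp_of_nat_mult[symmetric])
    finally show ?thesis
      by (intro norm_summable_imp_summable_on) auto
  qed
  have "(\<lambda>m::int. exp (- \<bar>of_int m\<bar> :: real)) summable_on (int ` UNIV)"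
    by (subst summable_on_reindex) (auto simp: o_def geo)
  moreover have "(\<lambda>m::int. exp (- \<bar>of_int m\<bar> :: real)) summable_on ((\<lambda>k. - int k) ` UNIV)"
    by (subst summable_on_reindex) (auto simp: o_def geo inj_on_def)
  ultimately have "(\<lambda>m::int. exp (- \<bar>of_int m\<bar> :: real)) summable_on (int ` UNIV \<union> (\<lambda>k. - int k) ` UNIV)"
    by (rule summable_on_union)
  also have "int ` UNIV \<union> (\<lambda>k. - int k) ` UNIV = UNIV"
  proof -
    have "m \<in> int ` UNIV \<union> (\<lambda>k. - int k) ` UNIV" for m
      by (cases m rule: int_cases2) auto
    thus ?thesis by blast
  qed
  finally show ?thesis .
qed

text \<open>
  The quadratic term of the exponent beats every linear one; completing the square gives a bound that
  is uniform on horizontal strips, which yields both absolute convergence and holomorphy.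
\<close>

lemma norm_theta_term_le:
  assumes "Im \<tau> > 0" "\<bar>Im t\<bar> \<le> M"
  shows "norm (theta_term \<kappa> t \<tau> m) \<le>
           exp (\<bar>\<kappa>\<bar> + (2 * pi * M + 1)\<^sup>2 / (4 * pi * Im \<tau>)) * exp (- \<bar>of_int m\<bar>)"
proof -
  define x where "x = of_int m + \<kappa>"
  have M: "M \<ge> 0" using assms(2) by linarith
  have "norm (theta_term \<kappa> t \<tau> m) = exp (- pi * x * (x * Im \<tau> + 2 * Im t))"
    unfolding theta_term_def norm_exp_eq_Re by (simp add: x_def algebra_simps)
  also have "- pi * x * (x * Im \<tau> + 2 * Im t) \<le> \<bar>\<kappa>\<bar> + (2 * pi * M + 1)\<^sup>2 / (4 * pi * Im \<tau>) - \<bar>of_int m\<bar>"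
  proof -
    define a B where "a = pi * Im \<tau>" and "B = 2 * pi * M + 1"
    have a: "a > 0" using assms by (simp add: a_def)
    have 1: "- pi * x * (2 * Im t) \<le> 2 * pi * M * \<bar>x\<bar>"
    proof -
      have "- pi * x * (2 * Im t) \<le> \<bar>- pi * x * (2 * Im t)\<bar>" by simp
      also have "\<dots> = 2 * pi * \<bar>x\<bar> * \<bar>Im t\<bar>" by (simp add: abs_mult)
      also have "\<dots> \<le> 2 * pi * \<bar>x\<bar> * M" by (intro mult_left_mono assms) auto
      finally show ?thesis by (simp add: mult_ac)
    qed
    have 2: "B * \<bar>x\<bar> - a * x\<^sup>2 \<le> B\<^sup>2 / (4 * a)"
    proof -
      have "0 \<le> (2 * a * \<bar>x\<bar> - B)\<^sup>2" by simp
      also have "(2 * a * \<bar>x\<bar> - B)\<^sup>2 = 4 * a * (a * x\<^sup>2 - B * \<bar>x\<bar>) + B\<^sup>2"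
        by (simp add: power2_eq_square algebra_simps)
      finally have "4 * a * (B * \<bar>x\<bar> - a * x\<^sup>2) \<le> B\<^sup>2" by (simp add: algebra_simps)
      thus ?thesis using a by (simp add: field_simps)
    qed
    have 3: "\<bar>of_int m\<bar> \<le> \<bar>x\<bar> + \<bar>\<kappa>\<bar>" unfolding x_def by linarith
    have "- pi * x * (x * Im \<tau> + 2 * Im t) = - a * x\<^sup>2 + (- pi * x * (2 * Im t))"
      by (simp add: a_def power2_eq_square algebra_simps)
    also have "\<dots> \<le> - a * x\<^sup>2 + 2 * pi * M * \<bar>x\<bar>" using 1 by simp
    also have "\<dots> = B * \<bar>x\<bar> - a * x\<^sup>2 - \<bar>x\<bar>" by (simp add: B_def algebra_simps)
    finally show ?thesis using 2 3 unfolding a_def B_def by (simp add: mult_ac)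
  qed
  finally show ?thesis by (simp add: exp_add exp_diff exp_minus field_simps)
qed

lemma abs_summable_theta_term:
  assumes "Im \<tau> > 0"
  shows "(\<lambda>m. norm (theta_term \<kappa> t \<tau> m)) summable_on UNIV"
  by (rule Infinite_Sum.abs_summable_on_comparison_test'[OF summable_on_cmult_right[OF summable_exp_minus_abs_int]])
     (use norm_theta_term_le[OF assms order_refl] in auto)

lemma has_sum_theta:
  assumes "Im \<tau> > 0"
  shows "(theta_term \<kappa> t \<tau> has_sum theta \<kappa> 0 t \<tau>) UNIV"
proof -
  have "theta_term \<kappa> t \<tau> summable_on UNIV"
    using abs_summable_theta_term[OF assms] by (rule abs_summable_summable)
  moreover have "theta \<kappa> 0 t \<tau> = infsum (theta_term \<kappa> t \<tau>) UNIV"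
    unfolding theta_def theta_term_def by simp
  ultimately show ?thesis by (simp add: has_sum_infsum)
qed

lemma theta_holomorphic:
  assumes "Im \<tau> > 0"
  shows "(\<lambda>t. theta \<kappa> 0 t \<tau>) holomorphic_on A"
proof -
  have "(\<lambda>t. theta \<kappa> 0 t \<tau>) holomorphic_on ball z 1" for z
  proof -
    define K where "K = exp (\<bar>\<kappa>\<bar> + (2 * pi * (norm z + 1) + 1)\<^sup>2 / (4 * pi * Im \<tau>))"
    have bound: "norm (theta_term \<kappa> t \<tau> m) \<le> K * exp (- \<bar>of_int m\<bar>)" if "t \<in> cball z 1" for t m
    proof -
      have "\<bar>Im t\<bar> \<le> norm t" by (rule abs_Im_le_cmod)
      also have "\<dots> \<le> norm z + 1"
        using that norm_triangle_ineq2[of t z] by (simp add: dist_norm norm_minus_commute)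
      finally show ?thesis unfolding K_def by (rule norm_theta_term_le[OF assms])
    qed
    have lim: "uniform_limit (cball z 1) (\<lambda>X t. \<Sum>m\<in>X. theta_term \<kappa> t \<tau> m)
                 (\<lambda>t. theta \<kappa> 0 t \<tau>) (finite_subsets_at_top UNIV)"
      by (rule Weierstrass_m_test_general'[OF bound has_sum_theta[OF assms]])
         (auto intro!: summable_on_cmult_right summable_exp_minus_abs_int)
    have "\<forall>\<^sub>F X in finite_subsets_at_top UNIV.
            continuous_on (cball z 1) (\<lambda>t. \<Sum>m\<in>X. theta_term \<kappa> t \<tau> m) \<and>
            (\<lambda>t. \<Sum>m\<in>X. theta_term \<kappa> t \<tau> m) holomorphic_on ball z 1"
      unfolding theta_term_def
      by (intro always_eventually allI conjI continuous_intros holomorphic_intros)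
    from holomorphic_uniform_limit[OF this lim] show ?thesis by auto
  qed
  hence "(\<lambda>t. theta \<kappa> 0 t \<tau>) holomorphic_on (\<Union>z. ball z 1)"
    by (intro holomorphic_on_UN_open) auto
  also have "(\<Union>z::complex. ball z 1) = UNIV" by (auto intro: exI[of _ "_::complex"])
  finally show ?thesis by (rule holomorphic_on_subset) auto
qed

lemma sum_roots_of_unity:
  assumes "N > 0"
  shows "(\<Sum>r<N. exp (2 * \<i> * of_real pi * of_int m * of_nat r / of_nat N)) =
           (if int N dvd m then of_nat N else 0)"
proof -
  define w where "w = exp (2 * \<i> * of_real pi * of_int m / of_nat N)"
  have pow: "exp (2 * \<i> * of_real pi * of_int m * of_nat r / of_nat N) = w ^ r" for r
    unfolding w_def exp_of_nat_mult[symmetric] by (simp add: mult_ac)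
  have w1: "w = 1 \<longleftrightarrow> int N dvd m"
  proof
    assume "w = 1"
    then obtain k where "2 * pi * m / N = of_int (2 * k) * pi"
      unfolding w_def exp_eq_1 by auto
    hence "real_of_int m = of_int (k * int N)" using assms by (simp add: field_simps)
    hence "m = k * int N" by linarith
    thus "int N dvd m" by simp
  next
    assume "int N dvd m"
    then obtain k where "m = int N * k" by auto
    thus "w = 1" using assms unfolding w_def by (simp add: exp_eq_1)
  qed
  have "w ^ N = 1"
    using assms unfolding w_def exp_of_nat_mult[symmetric] by (simp add: exp_eq_1)
  thus ?thesis unfolding pow using w1 by (simp add: sum_gp_strict)
qed

lemma has_sum_sum:
  fixes f :: "'i \<Rightarrow> 'b \<Rightarrow> complex"
  assumes "finite I" "\<And>i. i \<in> I \<Longrightarrow> (f i has_sum S i) A"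
  shows "((\<lambda>x. \<Sum>i\<in>I. f i x) has_sum (\<Sum>i\<in>I. S i)) A"
  using assms by (induction I rule: finite_induct) (auto intro!: has_sum_add)

text \<open>
  Averaging the series over the points \<open>t = r / N\<close> keeps exactly the coefficients whose index is
  divisible by \<open>N\<close>. For large \<open>N\<close> all of these except \<open>c 0\<close> lie in the tail of an absolutely
  convergent series.
\<close>

lemma fourier_series_eq_0:
  fixes c :: "int \<Rightarrow> complex"
  assumes zero: "\<And>t. ((\<lambda>m. c m * exp (2 * \<i> * of_real pi * of_int m * t)) has_sum 0) UNIV"
    and abs: "(\<lambda>m. norm (c m)) summable_on UNIV"
  shows "c 0 = 0"
proof (rule ccontr)
  assume "c 0 \<noteq> 0"
  define S where "S = (\<Sum>\<^sub>\<infinity>m. norm (c m))"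
  have S: "((\<lambda>m. norm (c m)) has_sum S) UNIV" unfolding S_def using abs by simp
  have "\<forall>\<^sub>F X in finite_subsets_at_top UNIV. dist (sum (\<lambda>m. norm (c m)) X) S < norm (c 0)"
    using S \<open>c 0 \<noteq> 0\<close> unfolding has_sum_def by (intro tendstoD) auto
  then obtain F where F: "finite F" "\<And>X. finite X \<Longrightarrow> F \<subseteq> X \<Longrightarrow> dist (sum (\<lambda>m. norm (c m)) X) S < norm (c 0)"
    unfolding eventually_finite_subsets_at_top by auto
  (* Choose N so large that no non-zero multiple of N lies in F, outside which the tail is small. *)
  define N where "N = Suc (nat (Max (insert 0 (abs ` F))))"
  have N: "N > 0" by (simp add: N_def)
  have FN: "m = 0 \<or> \<not> int N dvd m" if "m \<in> F" for m
  proof -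
    have "\<bar>m\<bar> \<le> Max (insert 0 (abs ` F))" using F(1) that by (intro Max_ge) auto
    moreover have "0 \<le> Max (insert 0 (abs ` F))" using F(1) by (intro Max_ge) auto
    ultimately have "\<bar>m\<bar> < int N" unfolding N_def by linarith
    thus ?thesis using dvd_imp_le_int[of m "int N"] by auto
  qed
  have "((\<lambda>m. \<Sum>r<N. c m * exp (2 * \<i> * of_real pi * of_int m * (of_nat r / of_nat N))) has_sum (\<Sum>r<N. 0)) UNIV"
    by (intro has_sum_sum zero) auto
  also have "(\<lambda>m. \<Sum>r<N. c m * exp (2 * \<i> * of_real pi * of_int m * (of_nat r / of_nat N))) =
             (\<lambda>m. of_nat N * (if int N dvd m then c m else 0))"
    unfolding sum_distrib_left[symmetric] using sum_roots_of_unity[OF N] by (auto simp: fun_eq_iff)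
  finally have "((\<lambda>m. if int N dvd m then c m else 0) has_sum 0) UNIV"
    using N by (subst (asm) has_sum_cmult_right_iff) auto
  moreover have "((\<lambda>m. if int N dvd m then c m else 0) has_sum c 0) {0}"
    by (intro has_sum_finiteI) auto
  ultimately have "((\<lambda>m. if int N dvd m then c m else 0) has_sum (0 - c 0)) (UNIV - {0})"
    by (intro has_sum_Diff) auto
  moreover have "((\<lambda>m. norm (c m)) has_sum (S - sum (\<lambda>m. norm (c m)) (insert 0 F))) (UNIV - insert 0 F)"
    using F(1) by (intro has_sum_Diff S) auto
  hence "((\<lambda>m. if m \<in> insert 0 F then 0 else norm (c m)) has_sum (S - sum (\<lambda>m. norm (c m)) (insert 0 F))) (UNIV - {0})"
    by (subst (asm) has_sum_cong_neutral[of "UNIV - {0}" _ "\<lambda>m. if m \<in> insert 0 F then 0 else norm (c m)"]) auto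
  ultimately have "norm (0 - c 0) \<le> S - sum (\<lambda>m. norm (c m)) (insert 0 F)"
    by (rule norm_infsum_le) (use FN in auto)
  moreover have "dist (sum (\<lambda>m. norm (c m)) (insert 0 F)) S < norm (c 0)"
    using F by blast
  ultimately show False by (simp add: dist_real_def)
qed

lemma theta_not_identically_0:
  assumes "Im \<tau> > 0"
  shows "\<exists>t. theta \<kappa> 0 t \<tau> \<noteq> 0"
proof (rule ccontr)
  assume *: "\<not> ?thesis"
  define c where "c = theta_term \<kappa> 0 \<tau>"
  have "((\<lambda>m. c m * exp (2 * \<i> * of_real pi * of_int m * t)) has_sum 0) UNIV" for t
  proof -
    have "theta_term \<kappa> t \<tau> m = exp (2 * \<i> * of_real pi * \<kappa> * t) * (c m * exp (2 * \<i> * of_real pi * of_int m * t))" for m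
      unfolding c_def theta_term_def by (simp add: exp_add[symmetric] algebra_simps)
    hence "((\<lambda>m. exp (2 * \<i> * of_real pi * \<kappa> * t) * (c m * exp (2 * \<i> * of_real pi * of_int m * t))) has_sum 0) UNIV"
      using has_sum_theta[OF assms, of \<kappa> t] * by (metis (no_types, lifting) has_sum_cong)
    thus ?thesis by (subst (asm) has_sum_cmult_right_iff) auto
  qed
  moreover have "(\<lambda>m. norm (c m)) summable_on UNIV"
    unfolding c_def by (rule abs_summable_theta_term[OF assms])
  ultimately have "c 0 = 0" by (rule fourier_series_eq_0)
  thus False by (simp add: c_def theta_term_def)
qed

lemma theta_affine_eventually_nonzero:
  assumes "Im \<tau> > 0" "a \<noteq> 0"
  shows "\<forall>\<^sub>F t in at w. theta \<kappa> 0 (a * t + b) \<tau> \<noteq> 0"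
proof -
  obtain t0 where t0: "theta \<kappa> 0 t0 \<tau> \<noteq> 0" using theta_not_identically_0[OF assms(1)] by blast
  have "(\<lambda>t. theta \<kappa> 0 t \<tau>) \<circ> (\<lambda>t. a * t + b) holomorphic_on UNIV"
    by (intro holomorphic_on_compose_gen[OF _ theta_holomorphic[OF assms(1)]] holomorphic_intros) auto
  hence "\<forall>\<^sub>F t in at w. theta \<kappa> 0 (a * t + b) \<tau> \<noteq> 0 \<and> t \<in> UNIV"
    by (intro non_zero_neighbour_alt[where \<beta> = "(t0 - b) / a"]) (use t0 assms(2) in \<open>auto simp: o_def\<close>)
  thus ?thesis by simp
qed

text \<open>
  The reflection \<open>m \<mapsto> - 1 - m\<close> of the summation index changes the sign of every summand.
\<close>

lemma theta_half_period_eq_0: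
  assumes "Im \<tau> > 0"
  shows "theta 0 0 ((1 + \<tau>) / 2) \<tau> = 0"
proof -
  let ?f = "theta_term 0 ((1 + \<tau>) / 2) \<tau>"
  have bij: "bij_betw (\<lambda>m::int. - 1 - m) UNIV UNIV"
    by (rule bij_betwI[of _ _ _ "\<lambda>m. - 1 - m"]) auto
  have "?f (- 1 - m) = - ?f m" for m
  proof -
    have "?f (- 1 - m) = ?f m * exp (\<i> * (of_int (2 * (- m - 1) + 1) * of_real pi))"
      unfolding theta_term_def exp_add[symmetric]
      by (rule arg_cong[where f = exp]) (simp add: field_simps)
    also have "exp (\<i> * (of_int (2 * (- m - 1) + 1) * of_real pi)) = -1"
      using exp_plus_2pin[of "\<i> * pi" "- m - 1"] by (simp add: algebra_simps)
    finally show ?thesis by simp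
  qed
  hence "((\<lambda>m. - ?f m) has_sum theta 0 0 ((1 + \<tau>) / 2) \<tau>) UNIV"
    using has_sum_theta[OF assms, of 0 "(1 + \<tau>) / 2"] has_sum_reindex_bij_betw[OF bij, of ?f]
    by simp
  moreover have "((\<lambda>m. - ?f m) has_sum - theta 0 0 ((1 + \<tau>) / 2) \<tau>) UNIV"
    using has_sum_theta[OF assms] by (simp add: has_sum_uminus)
  ultimately have "theta 0 0 ((1 + \<tau>) / 2) \<tau> = - theta 0 0 ((1 + \<tau>) / 2) \<tau>"
    by (rule has_sum_unique)
  thus ?thesis by simp
qed

section \<open>Products of theta functions in the span of the components of $\Phi$\<close>

lemma has_sum_convolution_int:
  fixes f g :: "int \<Rightarrow> complex"
  assumes f: "(f has_sum A) UNIV" "(\<lambda>s. norm (f s)) summable_on UNIV"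
    and g: "(g has_sum B) UNIV" "(\<lambda>s. norm (g s)) summable_on UNIV"
  defines "D \<equiv> (\<lambda>s. \<Sum>\<^sub>\<infinity>k. f (s - k) * g k)"
  shows "((\<lambda>k. f (s - k) * g k) has_sum D s) UNIV"
    and "(D has_sum A * B) UNIV"
    and "(\<lambda>s. norm (D s)) summable_on UNIV"
proof -
  have "(\<lambda>x. norm (case x of (s, k) \<Rightarrow> f s * g k)) summable_on UNIV \<times> UNIV"
    unfolding Infinite_Sum.abs_summable_on_Sigma_iff
    using f(2) g(2) by (auto simp: norm_mult infsum_cmult_right' abs_mult
          intro!: summable_on_cmult_right summable_on_cmult_left)
  moreover have bij: "bij_betw (\<lambda>(s, k). (s - k, k)) (UNIV \<times> UNIV) (UNIV \<times> (UNIV :: int set))"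
    by (rule bij_betwI[of _ _ _ "\<lambda>(s, k). (s + k, k)"]) auto
  ultimately have P: "(\<lambda>x. norm (case x of (s, k) \<Rightarrow> f (s - k) * g k)) summable_on UNIV \<times> UNIV"
    using summable_on_reindex_bij_betw[OF bij, of "\<lambda>(s, k). norm (f s * g k)"]
    by (simp add: case_prod_unfold)
  hence P1: "(\<lambda>k. norm (f (s - k) * g k)) summable_on UNIV" for s
    unfolding Infinite_Sum.abs_summable_on_Sigma_iff by auto
  thus D: "((\<lambda>k. f (s - k) * g k) has_sum D s) UNIV" for s
    unfolding D_def by (intro has_sum_infsum) (rule abs_summable_summable)
  have prod: "((\<lambda>(s, k). f s * g k) has_sum A * B) (UNIV \<times> UNIV)"
  proof (rule has_sum_SigmaI)
    show "((\<lambda>k. case (s, k) of (s, k) \<Rightarrow> f s * g k) has_sum f s * B) UNIV" for s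
      using has_sum_cmult_right[OF g(1), of "f s"] by simp
    show "((\<lambda>s. f s * B) has_sum A * B) UNIV" by (rule has_sum_cmult_left[OF f(1)])
    show "(\<lambda>(s, k). f s * g k) summable_on UNIV \<times> UNIV"
      by (rule abs_summable_summable) fact
  qed
  hence "((\<lambda>(s, k). f (s - k) * g k) has_sum A * B) (UNIV \<times> UNIV)"
    using has_sum_reindex_bij_betw[OF bij, of "\<lambda>(s, k). f s * g k"]
    by (simp add: case_prod_unfold)
  thus "(D has_sum A * B) UNIV"
    by (rule has_sum_Sigma') (use D in auto)
  have "(\<lambda>s. norm (\<Sum>\<^sub>\<infinity>k. norm (f (s - k) * g k))) summable_on UNIV"
    using P unfolding Infinite_Sum.abs_summable_on_Sigma_iff by auto
  thus "(\<lambda>s. norm (D s)) summable_on UNIV"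
    by (rule Infinite_Sum.abs_summable_on_comparison_test)
       (use P1 in \<open>auto simp: D_def intro!: order_trans[OF norm_infsum_bound abs_ge_self]\<close>)
qed

text \<open>
  Quasi-periodicity of theta functions, read off from Fourier coefficients: the coefficients of one theta
  function satisfy a recursion of step 1, and convolution adds up the steps, so that those of a product
  of \<open>m\<close> factors satisfy a recursion of step \<open>m\<close>. The statement is about Fourier coefficients because
  the induction then needs only rearrangements of double series.
\<close>

lemma prod_theta_fourier_series:
  assumes "finite J" "Im \<tau> > 0"
  shows "\<exists>C. (\<forall>v. (\<lambda>s. norm (C s * exp (2 * \<i> * of_real pi * of_int s * v))) summable_on UNIV \<and>
                 ((\<lambda>s. C s * exp (2 * \<i> * of_real pi * of_int s * v)) has_sum
                    (\<Prod>j\<in>J. theta 0 0 (v + a j) \<tau>)) UNIV) \<and>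
             (\<forall>s. C (s + int (card J)) =
                    C s * exp (\<i> * of_real pi * (\<tau> * (2 * of_int s + of_nat (card J)) + 2 * (\<Sum>j\<in>J. a j))))"
  using assms(1)
proof (induction J)
  case empty
  define C :: "int \<Rightarrow> complex" where "C = (\<lambda>s. if s = 0 then 1 else 0)"
  have "((\<lambda>s. norm (C s * exp (2 * \<i> * of_real pi * of_int s * v))) has_sum 1) UNIV \<and>
        ((\<lambda>s. C s * exp (2 * \<i> * of_real pi * of_int s * v)) has_sum 1) UNIV" for v
    by (auto simp: C_def intro!: has_sum_finite_neutralI[of "{0}"] split: if_splits)
  thus ?case by (intro exI[of _ C]) (auto simp: C_def dest: has_sum_imp_summable)
next
  case (insert j J)
  let ?e = "\<lambda>s v. exp (2 * \<i> * of_real pi * of_int s * v)"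
  obtain C where C: "\<And>v. (\<lambda>s. norm (C s * ?e s v)) summable_on UNIV"
      "\<And>v. ((\<lambda>s. C s * ?e s v) has_sum (\<Prod>j\<in>J. theta 0 0 (v + a j) \<tau>)) UNIV"
      "\<And>s. C (s + int (card J)) =
              C s * exp (\<i> * of_real pi * (\<tau> * (2 * of_int s + of_nat (card J)) + 2 * (\<Sum>j\<in>J. a j)))"
    using insert.IH by blast
  define t where "t = theta_term 0 (a j) \<tau>"
  define D where "D = (\<lambda>s. \<Sum>\<^sub>\<infinity>k. C (s - k) * t k)"
  have te: "theta_term 0 (v + a j) \<tau> = (\<lambda>k. t k * ?e k v)" for v
    by (simp add: fun_eq_iff t_def theta_term_def exp_add[symmetric] algebra_simps)
  (* The recursion of step 1 for the new factor; it is matched with a shift of the summation index. *)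
  have tS: "t (k + 1) = t k * exp (\<i> * of_real pi * (\<tau> * (2 * of_int k + 1) + 2 * a j))" for k
    by (simp add: t_def theta_term_def exp_add[symmetric] algebra_simps)
  have De: "(\<Sum>\<^sub>\<infinity>k. (C (s - k) * ?e (s - k) v) * (t k * ?e k v)) = D s * ?e s v" for s v
  proof -
    have "(C (s - k) * ?e (s - k) v) * (t k * ?e k v) = (C (s - k) * t k) * ?e s v" for k
      by (simp add: exp_diff field_simps)
    thus ?thesis unfolding D_def infsum_cmult_left'[symmetric] by (intro infsum_cong)
  qed
  have \<theta>: "((\<lambda>k. t k * ?e k v) has_sum theta 0 0 (v + a j) \<tau>) UNIV"
    "(\<lambda>k. norm (t k * ?e k v)) summable_on UNIV" for v
    using has_sum_theta[OF assms(2), of 0 "v + a j"] abs_summable_theta_term[OF assms(2), of 0 "v + a j"]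
    unfolding te by auto
  have "((\<lambda>s. D s * ?e s v) has_sum (\<Prod>j\<in>insert j J. theta 0 0 (v + a j) \<tau>)) UNIV" for v
  proof -
    have "((\<lambda>s. D s * ?e s v) has_sum (\<Prod>j\<in>J. theta 0 0 (v + a j) \<tau>) * theta 0 0 (v + a j) \<tau>) UNIV"
      using has_sum_convolution_int(2)[OF C(2) C(1) \<theta>(1) \<theta>(2), of v v] unfolding De .
    thus ?thesis using insert.hyps by (simp add: mult.commute)
  qed
  moreover have "(\<lambda>s. norm (D s * ?e s v)) summable_on UNIV" for v
    using has_sum_convolution_int(3)[OF C(2) C(1) \<theta>(1) \<theta>(2), of v v] unfolding De .
  moreover have "D (s + int (card (insert j J))) = D s * exp (\<i> * of_real pi *
       (\<tau> * (2 * of_int s + of_nat (card (insert j J))) + 2 * (\<Sum>j\<in>insert j J. a j)))" (is "_ = _ * ?E") for s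
  proof -
    have bij: "bij_betw (\<lambda>k::int. k + 1) UNIV UNIV"
      by (rule bij_betwI[of _ _ _ "\<lambda>k. k - 1"]) auto
    have "D (s + int (card (insert j J))) = (\<Sum>\<^sub>\<infinity>k. C (s + int (card J) + 1 - k) * t k)"
      using insert.hyps by (simp add: D_def algebra_simps)
    also have "\<dots> = (\<Sum>\<^sub>\<infinity>k. C (s - k + int (card J)) * t (k + 1))"
      by (subst infsum_reindex_bij_betw[OF bij, symmetric]) (simp add: algebra_simps)
    also have "\<dots> = (\<Sum>\<^sub>\<infinity>k. C (s - k) * t k * ?E)"
    proof (intro infsum_cong)
      fix k
      show "C (s - k + int (card J)) * t (k + 1) = C (s - k) * t k * ?E"
        unfolding C(3) tS using insert.hyps by (simp add: exp_add[symmetric] algebra_simps)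
    qed
    finally show ?thesis by (simp add: D_def infsum_cmult_left')
  qed
  ultimately show ?case by blast
qed

text \<open>
  For \<open>n\<close> factors whose shifts sum to zero, the recursion of step \<open>n\<close> says that the Fourier
  coefficients with index in a fixed residue class modulo \<open>n\<close> are determined by one of them, and in the
  same way as for the corresponding component of $\Phi$. Summing by residue classes gives the expansion.
\<close>

lemma prod_theta_in_span_Phi:
  assumes n: "n \<ge> 1" and \<tau>: "Im \<tau> > 0" and a: "(\<Sum>j=1..n. a j) = 0"
  shows "\<exists>b. \<forall>u. (\<Sum>l=1..n. b l * Phi n \<tau> u l) = (\<Prod>j=1..n. theta 0 0 (u / of_nat n + a j) \<tau>)"
proof -
  let ?e = "\<lambda>s v. exp (2 * \<i> * of_real pi * of_int s * v)"
  obtain C where C: "\<And>v. ((\<lambda>s. C s * ?e s v) has_sum (\<Prod>j=1..n. theta 0 0 (v + a j) \<tau>)) UNIV"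
      "\<And>s. C (s + int n) = C s * exp (\<i> * of_real pi * \<tau> * (2 * of_int s + of_nat n))"
    using prod_theta_fourier_series[of "{1..n}" \<tau> a] \<tau> unfolding a
    by (auto simp: mult_ac)
  have Cm: "C (int n * m + r) = C r * exp (\<i> * of_real pi * \<tau> * (2 * of_int r * of_int m + of_nat n * of_int m ^ 2))" for m r
  proof (induction m rule: int_induct[where k = 0])
    case (step1 i)
    have "C (int n * (i + 1) + r) = C (int n * i + r + int n)" by (simp add: algebra_simps)
    also have "\<dots> = C r * exp (\<i> * of_real pi * \<tau> * (2 * of_int r * of_int (i + 1) + of_nat n * of_int (i + 1) ^ 2))"
      unfolding C(2) step1.IH by (simp add: exp_add[symmetric] algebra_simps power2_eq_square)
    finally show ?case .
  next
    case (step2 i)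
    have "C (int n * i + r) = C (int n * (i - 1) + r + int n)" by (simp add: algebra_simps)
    also have "\<dots> = C (int n * (i - 1) + r) * exp (\<i> * of_real pi * \<tau> * (2 * of_int (int n * (i - 1) + r) + of_nat n))"
      by (rule C(2))
    finally have "C (int n * (i - 1) + r) = C (int n * i + r) * exp (- (\<i> * of_real pi * \<tau> * (2 * of_int (int n * (i - 1) + r) + of_nat n)))"
      by (simp add: exp_minus)
    also have "\<dots> = C r * exp (\<i> * of_real pi * \<tau> * (2 * of_int r * of_int (i - 1) + of_nat n * of_int (i - 1) ^ 2))"
      unfolding step2.IH by (simp add: exp_add[symmetric] algebra_simps power2_eq_square)
    finally show ?case .
  qed auto
  (* C s * exp (- i pi tau s^2 / n) depends only on s modulo n; the l-th component collects s = l - 1. *)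
  define b where "b = (\<lambda>l. C (int l - 1) * exp (- (\<i> * of_real pi * \<tau> * (of_nat l - 1) ^ 2 / of_nat n)))"
  have "(\<Sum>l=1..n. b l * Phi n \<tau> u l) = (\<Prod>j=1..n. theta 0 0 (u / of_nat n + a j) \<tau>)" for u
  proof -
    define B where "B = (\<lambda>l. range (\<lambda>m. int n * m + (int l - 1)))"
    have sums: "((\<lambda>s. C s * ?e s (u / of_nat n)) has_sum b l * Phi n \<tau> u l) (B l)" if l: "l \<in> {1..n}" for l
    proof -
      have "C (int n * m + (int l - 1)) * ?e (int n * m + (int l - 1)) (u / of_nat n) =
              b l * theta_term ((real l - 1) / real n) u (of_nat n * \<tau>) m" for m
      proof -
        define N L M :: complex where "N = of_nat n" and "L = of_nat l - 1" and "M = of_int m"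
        have N: "N \<noteq> 0" using n by (simp add: N_def)
        have "\<i> * pi * \<tau> * (2 * L * M + N * M ^ 2) + 2 * \<i> * pi * (N * M + L) * (u / N) =
              - (\<i> * pi * \<tau> * L ^ 2 / N) + \<i> * pi * (M + L / N) * ((M + L / N) * (N * \<tau>) + 2 * u)"
          using N by (simp add: divide_simps) (simp add: algebra_simps power2_eq_square)
        hence "exp (\<i> * pi * \<tau> * (2 * L * M + N * M ^ 2)) * exp (2 * \<i> * pi * (N * M + L) * (u / N)) =
              exp (- (\<i> * pi * \<tau> * L ^ 2 / N)) * exp (\<i> * pi * (M + L / N) * ((M + L / N) * (N * \<tau>) + 2 * u))"
          unfolding exp_add[symmetric] by simp
        moreover have "of_int (int l - 1) = L" "of_int (int n * m + (int l - 1)) = N * M + L"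
          "of_real ((real l - 1) / real n) = L / N" by (simp_all add: L_def N_def M_def)
        ultimately show ?thesis
          unfolding Cm b_def theta_term_def by (simp add: L_def[symmetric] N_def[symmetric] M_def[symmetric])
      qed
      moreover have "((\<lambda>m. b l * theta_term ((real l - 1) / real n) u (of_nat n * \<tau>) m) has_sum b l * Phi n \<tau> u l) UNIV"
        unfolding Phi_def by (intro has_sum_cmult_right has_sum_theta) (use \<tau> n in auto)
      ultimately show ?thesis
        unfolding B_def using n by (subst has_sum_reindex) (auto simp: inj_on_def o_def)
    qed
    have disj: "B l \<inter> B l' = {}" if "l \<in> {1..n}" "l' \<in> {1..n}" "l \<noteq> l'" for l l'
    proof -
      have "(int n * m + (int l - 1)) mod int n = int l - 1" if "l \<in> {1..n}" for l m
        using that by simp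
      hence "s mod int n = int l - 1" if "s \<in> B l" "l \<in> {1..n}" for s l
        using that by (auto simp: B_def)
      hence "int l - 1 = int l' - 1" if "s \<in> B l" "s \<in> B l'" for s
        using that \<open>l \<in> {1..n}\<close> \<open>l' \<in> {1..n}\<close> by metis
      thus ?thesis using \<open>l \<noteq> l'\<close> by auto
    qed
    have "((\<lambda>s. C s * ?e s (u / of_nat n)) has_sum (\<Sum>l=1..n. b l * Phi n \<tau> u l)) (\<Union>l\<in>{1..n}. B l)"
      by (rule sum_has_sum[OF _ sums disj]) auto
    also have "(\<Union>l\<in>{1..n}. B l) = UNIV"
    proof -
      have "s \<in> B (nat (s mod int n) + 1)" "nat (s mod int n) + 1 \<in> {1..n}" for s
      proof -
        have *: "0 \<le> s mod int n" "s mod int n < int n" using n by auto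
        thus "nat (s mod int n) + 1 \<in> {1..n}" by auto
        have "s = int n * (s div int n) + (int (nat (s mod int n) + 1) - 1)" using * by simp
        thus "s \<in> B (nat (s mod int n) + 1)" unfolding B_def by (rule range_eqI)
      qed
      thus ?thesis by blast
    qed
    finally show ?thesis using C(1) by (rule has_sum_unique)
  qed
  thus ?thesis by blast
qed

lemma Phi_add_of_nat:
  assumes "n \<ge> 1" "Im \<tau> > 0" "l \<ge> 1"
  shows "Phi n \<tau> (u + of_nat r) l = exp (2 * \<i> * of_real pi * of_int (int l - 1) * of_nat r / of_nat n) * Phi n \<tau> u l"
proof -
  let ?\<kappa> = "(real l - 1) / real n"
  have \<tau>: "Im (of_nat n * \<tau>) > 0" using assms by simp
  have "theta_term ?\<kappa> (u + of_nat r) (of_nat n * \<tau>) m =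
          exp (2 * \<i> * of_real pi * of_int (int l - 1) * of_nat r / of_nat n) * theta_term ?\<kappa> u (of_nat n * \<tau>) m" for m
  proof -
    have "theta_term ?\<kappa> (u + of_nat r) (of_nat n * \<tau>) m =
          exp (2 * \<i> * of_real pi * of_int (int l - 1) * of_nat r / of_nat n) * theta_term ?\<kappa> u (of_nat n * \<tau>) m *
          exp (\<i> * (of_int (2 * (m * int r)) * of_real pi))"
      unfolding theta_term_def exp_add[symmetric]
      by (rule arg_cong[where f = exp]) (use assms in \<open>simp add: field_simps\<close>)
    also have "exp (\<i> * (of_int (2 * (m * int r)) * of_real pi)) = 1"
      by (auto simp: exp_eq_1 intro!: exI[of _ "m * int r"])
    finally show ?thesis by simp
  qed
  hence eq: "theta_term ?\<kappa> (u + of_nat r) (of_nat n * \<tau>) =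
      (\<lambda>m. exp (2 * \<i> * of_real pi * of_int (int l - 1) * of_nat r / of_nat n) * theta_term ?\<kappa> u (of_nat n * \<tau>) m)"
    by (rule ext)
  have "(theta_term ?\<kappa> (u + of_nat r) (of_nat n * \<tau>) has_sum
      exp (2 * \<i> * of_real pi * of_int (int l - 1) * of_nat r / of_nat n) * Phi n \<tau> u l) UNIV"
    unfolding Phi_def eq by (rule has_sum_cmult_right[OF has_sum_theta[OF \<tau>]])
  moreover have "(theta_term ?\<kappa> (u + of_nat r) (of_nat n * \<tau>) has_sum Phi n \<tau> (u + of_nat r) l) UNIV"
    unfolding Phi_def by (rule has_sum_theta[OF \<tau>])
  ultimately show ?thesis by (rule has_sum_unique[symmetric])
qed

text \<open>
  Any point at which the \<open>l\<close>-th component of $\Phi$ does not vanish; it serves to normalise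
  \<open>theta_coeff\<close>.
\<close>

definition Phi_point :: "nat \<Rightarrow> complex \<Rightarrow> nat \<Rightarrow> complex" where
  "Phi_point n \<tau> l = (SOME u. Phi n \<tau> u l \<noteq> 0)"

lemma Phi_point:
  assumes "n \<ge> 1" "Im \<tau> > 0"
  shows "Phi n \<tau> (Phi_point n \<tau> l) l \<noteq> 0"
proof -
  have "\<exists>u. Phi n \<tau> u l \<noteq> 0"
    unfolding Phi_def by (rule theta_not_identically_0) (use assms in auto)
  thus ?thesis unfolding Phi_point_def by (rule someI_ex)
qed

definition theta_prod :: "nat \<Rightarrow> complex \<Rightarrow> hvec \<Rightarrow> complex \<Rightarrow> complex" where
  "theta_prod n \<tau> \<mu> u = (\<Prod>j=1..n. theta 0 0 (u / of_nat n + \<mu> j) \<tau>)"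

text \<open>
  The coefficient of \<open>Phi n \<tau> u l\<close> in \<open>theta_prod n \<tau> \<mu> u\<close>, isolated by a discrete Fourier
  transform over \<open>u, u + 1, \<dots>, u + n - 1\<close>: the components of $\Phi$ are eigenvectors of \<open>u \<mapsto> u + 1\<close>
  for different eigenvalues. The explicit formula makes continuity in \<open>\<mu>\<close> evident.
\<close>

definition theta_coeff :: "nat \<Rightarrow> complex \<Rightarrow> hvec \<Rightarrow> nat \<Rightarrow> complex" where
  "theta_coeff n \<tau> \<mu> l =
     (\<Sum>r<n. exp (- (2 * \<i> * of_real pi * of_int (int l - 1) * of_nat r / of_nat n)) *
        theta_prod n \<tau> \<mu> (Phi_point n \<tau> l + of_nat r)) / (of_nat n * Phi n \<tau> (Phi_point n \<tau> l) l)"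

lemma sum_theta_coeff_Phi:
  assumes n: "n \<ge> 1" and \<tau>: "Im \<tau> > 0" and \<mu>: "(\<Sum>j=1..n. \<mu> j) = 0"
  shows "(\<Sum>l=1..n. theta_coeff n \<tau> \<mu> l * Phi n \<tau> u l) = theta_prod n \<tau> \<mu> u"
proof -
  obtain b where b: "\<And>u. (\<Sum>l=1..n. b l * Phi n \<tau> u l) = theta_prod n \<tau> \<mu> u"
    using prod_theta_in_span_Phi[OF assms] unfolding theta_prod_def by blast
  have "theta_coeff n \<tau> \<mu> l = b l" if l: "l \<in> {1..n}" for l
  proof -
    let ?u = "Phi_point n \<tau> l"
    let ?e = "\<lambda>m r. exp (2 * \<i> * of_real pi * of_int m * of_nat r / of_nat n)"
    have "(\<Sum>r<n. exp (- (2 * \<i> * of_real pi * of_int (int l - 1) * of_nat r / of_nat n)) * theta_prod n \<tau> \<mu> (?u + of_nat r)) =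
          (\<Sum>r<n. \<Sum>k=1..n. b k * Phi n \<tau> ?u k * ?e (int k - int l) r)"
    proof (rule sum.cong)
      fix r assume "r \<in> {..<n}"
      have "exp (- (2 * \<i> * of_real pi * of_int (int l - 1) * of_nat r / of_nat n)) * (b k * Phi n \<tau> (?u + of_nat r) k) =
            b k * Phi n \<tau> ?u k * ?e (int k - int l) r" if "k \<in> {1..n}" for k
      proof -
        have "exp (- (2 * \<i> * of_real pi * of_int (int l - 1) * of_nat r / of_nat n)) * ?e (int k - 1) r = ?e (int k - int l) r"
          unfolding exp_add[symmetric]
          by (rule arg_cong[where f = exp]) (use n in \<open>simp add: field_simps\<close>)
        thus ?thesis using Phi_add_of_nat[OF n \<tau>, of k] that by (simp add: mult_ac)
      qed
      thus "exp (- (2 * \<i> * of_real pi * of_int (int l - 1) * of_nat r / of_nat n)) * theta_prod n \<tau> \<mu> (?u + of_nat r) =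
            (\<Sum>k=1..n. b k * Phi n \<tau> ?u k * ?e (int k - int l) r)"
        unfolding b[symmetric] sum_distrib_left by (intro sum.cong) auto
    qed auto
    also have "\<dots> = (\<Sum>k=1..n. b k * Phi n \<tau> ?u k * (\<Sum>r<n. ?e (int k - int l) r))"
      by (subst sum.swap) (simp add: sum_distrib_left)
    also have "\<dots> = (\<Sum>k=1..n. if k = l then of_nat n * (b l * Phi n \<tau> ?u l) else 0)"
    proof (rule sum.cong)
      fix k assume k: "k \<in> {1..n}"
      have "int n dvd int k - int l \<longleftrightarrow> k = l"
        using k l zdvd_not_zless[of "\<bar>int k - int l\<bar>" "int n"] by fastforce
      thus "b k * Phi n \<tau> ?u k * (\<Sum>r<n. ?e (int k - int l) r) = (if k = l then of_nat n * (b l * Phi n \<tau> ?u l) else 0)"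
        using n by (subst sum_roots_of_unity) auto
    qed auto
    also have "\<dots> = of_nat n * (b l * Phi n \<tau> ?u l)" using l by simp
    finally show ?thesis
      unfolding theta_coeff_def using Phi_point[OF n \<tau>, of l] n by simp
  qed
  thus ?thesis using b by simp
qed

lemma tendsto_theta_coeff:
  assumes "Im \<tau> > 0" and lim: "\<And>j. j \<in> {1..n} \<Longrightarrow> ((\<lambda>t. g t j) \<longlongrightarrow> \<mu> j) F"
  shows "((\<lambda>t. theta_coeff n \<tau> (g t) l) \<longlongrightarrow> theta_coeff n \<tau> \<mu> l) F"
proof -
  have cont: "isCont (\<lambda>v. theta 0 0 v \<tau>) v" for v
    using holomorphic_on_imp_continuous_on[OF theta_holomorphic[OF assms(1), of 0 UNIV]]
    by (simp add: continuous_on_eq_continuous_at)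
  have "((\<lambda>t. theta_prod n \<tau> (g t) u) \<longlongrightarrow> theta_prod n \<tau> \<mu> u) F" for u
    unfolding theta_prod_def
    by (intro tendsto_prod isCont_tendsto_compose[OF cont] tendsto_add tendsto_const lim)
  thus ?thesis unfolding theta_coeff_def divide_inverse
    by (intro tendsto_mult tendsto_sum tendsto_const)
qed

text \<open>
  A product of finitely many non-zero holomorphic functions is not identically zero.
\<close>

lemma theta_coeff_nonzero:
  assumes n: "n \<ge> 1" and \<tau>: "Im \<tau> > 0" and \<mu>: "(\<Sum>j=1..n. \<mu> j) = 0"
  shows "\<exists>l\<in>{1..n}. theta_coeff n \<tau> \<mu> l \<noteq> 0"
proof (rule ccontr)
  assume *: "\<not> ?thesis"
  have "\<forall>\<^sub>F u in at 0. \<forall>j\<in>{1..n}. theta 0 0 (1 / of_nat n * u + \<mu> j) \<tau> \<noteq> 0"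
    by (intro eventually_ball_finite ballI theta_affine_eventually_nonzero) (use n \<tau> in auto)
  then obtain u where "\<forall>j\<in>{1..n}. theta 0 0 (1 / of_nat n * u + \<mu> j) \<tau> \<noteq> 0"
    using eventually_happens by fastforce
  thus False using * sum_theta_coeff_Phi[OF assms, of u] by (simp add: theta_prod_def)
qed

section \<open>The inverse of $S$\<close>

text \<open>
  Gaussian elimination of one equation and one unknown.
\<close>

lemma homogeneous_system_nontrivial_solution:
  fixes A :: "'i \<Rightarrow> 'j \<Rightarrow> complex"
  assumes "finite I" "finite J" "card I < card J"
  shows "\<exists>x. (\<exists>j\<in>J. x j \<noteq> 0) \<and> (\<forall>i\<in>I. (\<Sum>j\<in>J. A i j * x j) = 0)"
  using assms
proof (induction I arbitrary: A J rule: finite_induct)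
  case empty
  thus ?case by (intro exI[of _ "\<lambda>_. 1"]) (auto simp: card_gt_0_iff)
next
  case (insert i I)
  show ?case
  proof (cases "\<forall>j\<in>J. A i j = 0")
    case True
    have "card I < card J" using insert by simp
    from insert.IH[OF insert.prems(1) this, of A] show ?thesis using True by auto
  next
    case False
    then obtain p where p: "p \<in> J" "A i p \<noteq> 0" by auto
    (* Eliminate the unknown x p with the help of equation i. *)
    define A' where "A' = (\<lambda>r j. A r j - A r p / A i p * A i j)"
    have "card I < card (J - {p})" using insert p by simp
    then obtain x where x: "\<exists>j\<in>J - {p}. x j \<noteq> 0" "\<forall>r\<in>I. (\<Sum>j\<in>J - {p}. A' r j * x j) = 0"
      using insert.IH[of "J - {p}" A'] insert.prems(1) by auto
    define t where "t = - (\<Sum>j\<in>J - {p}. A i j * x j) / A i p"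
    define x' where "x' = x(p := t)"
    have expand: "(\<Sum>j\<in>J. A r j * x' j) = A r p * t + (\<Sum>j\<in>J - {p}. A r j * x j)" for r
      using insert.prems(1) p by (subst sum.remove[of _ p]) (auto simp: x'_def intro!: sum.cong)
    have "(\<Sum>j\<in>J. A r j * x' j) = 0" if "r \<in> insert i I" for r
    proof (cases "r = i")
      case True
      thus ?thesis unfolding expand t_def using p by simp
    next
      case False
      hence "0 = (\<Sum>j\<in>J - {p}. A' r j * x j)" using that x(2) by simp
      also have "\<dots> = (\<Sum>j\<in>J - {p}. A r j * x j) - A r p / A i p * (\<Sum>j\<in>J - {p}. A i j * x j)"
        unfolding A'_def by (simp add: left_diff_distrib sum_subtractf sum_distrib_left mult.assoc)
      also have "\<dots> = (\<Sum>j\<in>J. A r j * x' j)" unfolding expand t_def by simp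
      finally show ?thesis by simp
    qed
    moreover have "\<exists>j\<in>J. x' j \<noteq> 0" using x(1) by (auto simp: x'_def)
    ultimately show ?thesis by blast
  qed
qed

text \<open>
  Apply the previous lemma to the \<open>n\<close> columns of \<open>M\<close> together with the \<open>k\<close>-th unit vector (column
  \<open>0\<close>): the linear relation between them must involve the unit vector, since the columns are independent
  by the left inverse \<open>N\<close>, and applying \<open>N\<close> identifies the coefficients.
\<close>

lemma mat_left_inverse_imp_right_inverse:
  fixes n :: nat
  assumes NM: "mat_eq {1..n} (mat_mul {1..n} N M) mat_one"
  shows "mat_eq {1..n} (mat_mul {1..n} M N) mat_one"
  unfolding mat_eq_def
proof (intro ballI)
  fix i k assume ik: "i \<in> {1..n}" "k \<in> {1..n}"
  define A where "A = (\<lambda>i j. if j = 0 then mat_one i k else M i j)"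
  obtain x where x: "\<exists>j\<in>{0..n}. x j \<noteq> 0" "\<forall>i\<in>{1..n}. (\<Sum>j\<in>{0..n}. A i j * x j) = 0"
    using homogeneous_system_nontrivial_solution[of "{1..n}" "{0..n}" A] by auto
  have split: "(\<Sum>j\<in>{0..n}. A i j * x j) = mat_one i k * x 0 + (\<Sum>j=1..n. M i j * x j)" for i
    unfolding sum.atLeast_Suc_atMost[OF le0] by (simp add: A_def)
  have x_eq: "x a = - N a k * x 0" if a: "a \<in> {1..n}" for a
  proof -
    have "x a = (\<Sum>j=1..n. if j = a then x j else 0)" using a by simp
    also have "\<dots> = (\<Sum>j=1..n. mat_mul {1..n} N M a j * x j)"
    proof (intro sum.cong refl)
      fix j assume "j \<in> {1..n}"
      hence "mat_mul {1..n} N M a j = mat_one a j" using NM a unfolding mat_eq_def by blast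
      thus "(if j = a then x j else 0) = mat_mul {1..n} N M a j * x j" by (simp add: mat_one_def)
    qed
    also have "\<dots> = (\<Sum>i=1..n. N a i * (\<Sum>j=1..n. M i j * x j))"
      unfolding mat_mul_def sum_distrib_left sum_distrib_right by (subst sum.swap) (simp add: mult.assoc)
    also have "\<dots> = (\<Sum>i=1..n. if i = k then - N a k * x 0 else 0)"
    proof (intro sum.cong refl)
      fix i assume "i \<in> {1..n}"
      hence "(\<Sum>j=1..n. M i j * x j) = - (mat_one i k * x 0)"
        using x(2) unfolding split by (metis add.commute add_eq_0_iff)
      thus "N a i * (\<Sum>j=1..n. M i j * x j) = (if i = k then - N a k * x 0 else 0)"
        by (simp add: mat_one_def)
    qed
    also have "\<dots> = - N a k * x 0" using ik by simp
    finally show ?thesis .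
  qed
  have x0: "x 0 \<noteq> 0"
  proof
    assume "x 0 = 0"
    hence "x j = 0" if "j \<in> {0..n}" for j using x_eq[of j] that by (cases "j = 0") auto
    thus False using x(1) by blast
  qed
  have "0 = mat_one i k * x 0 + (\<Sum>j=1..n. M i j * x j)" using x(2) ik unfolding split by simp
  also have "(\<Sum>j=1..n. M i j * x j) = (\<Sum>j=1..n. - x 0 * (M i j * N j k))"
    by (intro sum.cong refl) (simp add: x_eq)
  also have "\<dots> = - x 0 * mat_mul {1..n} M N i k" unfolding mat_mul_def by (rule sum_distrib_left[symmetric])
  finally show "mat_mul {1..n} M N i k = mat_one i k" using x0 by (simp add: algebra_simps)
qed

text \<open>
  Together with a condition on \<open>z\<close> alone, this makes \<open>S(z, p)\<close> invertible. The point
  \<open>(1 + \<tau>) / 2\<close> is a zero of \<open>theta 0 0\<close>.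
\<close>

definition theta_regular :: "nat \<Rightarrow> complex \<Rightarrow> hvec \<Rightarrow> bool" where
  "theta_regular n \<tau> p \<longleftrightarrow>
     (\<forall>i\<in>{1..n}. \<forall>j\<in>{1..n}. i \<noteq> j \<longrightarrow> theta 0 0 ((1 + \<tau>) / 2 + p j - p i) \<tau> \<noteq> 0)"

lemma hstar_move [intro]: "p \<in> hstar n \<Longrightarrow> q \<in> hstar n \<Longrightarrow> move p r q \<in> hstar n"
  by (auto simp: hstar_def move_def sum.distrib sum_distrib_left[symmetric])

lemma omega_in_hstar: "i \<in> {1..n} \<Longrightarrow> omega n i \<in> hstar n"
  by (auto simp: hstar_def omega_def sum_subtractf)

text \<open>
  A row vector \<open>b\<close> is, up to a factor, the \<open>j\<close>-th row of $S(z,p)^{-1}$ iff the function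
  $u\mapsto\sum_l b_l\Phi_l(u)$ vanishes at $z-np_i$ for all \<open>i \<noteq> j\<close> but not at $z-np_j$. With \<open>h = (1 + \<tau>) / 2\<close>
  the function \<open>theta_prod n \<tau> \<mu>\<close> vanishes at $n(h-\mu_i)$ for all \<open>i\<close>, so one needs
  $\mu_i=p_i-(z-nh)/n$ for \<open>i \<noteq> j\<close>. Since the sum of the $\mu_i$ must be zero, this forces
  $\mu=p+(z-nh)\omega_j$. At \<open>z = nh\<close> these vectors no longer depend on \<open>j\<close>: there
  $S(z,p)^{-1}$ has a pole, and its rows become proportional to one vector.
\<close>

lemma S_mat_inverse:
  assumes n: "n \<ge> 1" and \<tau>: "Im \<tau> > 0" and p: "p \<in> hstar n" "theta_regular n \<tau> p"
    and z: "theta 0 0 (z - of_nat n * ((1 + \<tau>) / 2) + (1 + \<tau>) / 2) \<tau> \<noteq> 0"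
  defines "M \<equiv> S_mat n \<tau> z p"
  shows "mat_eq {1..n} (mat_mul {1..n} M (mat_inv {1..n} M)) mat_one"
    and "mat_eq {1..n} (mat_mul {1..n} (mat_inv {1..n} M) M) mat_one"
    and "j \<in> {1..n} \<Longrightarrow> \<exists>\<beta>. \<forall>k\<in>{1..n}.
           theta_coeff n \<tau> (move p (z - of_nat n * ((1 + \<tau>) / 2)) (omega n j)) k = \<beta> * mat_inv {1..n} M j k"
proof -
  define h where "h = (1 + \<tau>) / 2"
  define \<mu> where "\<mu> = (\<lambda>j. move p (z - of_nat n * h) (omega n j))"
  define \<beta> where "\<beta> = (\<lambda>j. theta_prod n \<tau> (\<mu> j) (z - of_nat n * p j))"
  have sum_\<mu>: "(\<Sum>i=1..n. \<mu> j i) = 0" if "j \<in> {1..n}" for j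
    using hstar_move[OF p(1) omega_in_hstar[OF that]] unfolding \<mu>_def hstar_def by blast
  (* The arguments at which the theta factors of the product are evaluated; the value h gives zero. *)
  have arg: "(z - of_nat n * p i) / of_nat n + \<mu> j m =
      (if m = j then z - of_nat n * h + h + p m - p i else h + p m - p i)" if "m \<in> {1..n}" for i j m
    using that n by (simp add: \<mu>_def move_def omega_def field_simps)
  have \<beta>: "\<beta> j \<noteq> 0" if j: "j \<in> {1..n}" for j
    unfolding \<beta>_def theta_prod_def
    using p(2) z j by (auto simp: arg theta_regular_def h_def)
  have row: "(\<Sum>k=1..n. theta_coeff n \<tau> (\<mu> j) k * M k i) = (if i = j then \<beta> j else 0)"
    if "i \<in> {1..n}" "j \<in> {1..n}" for i j
  proof -
    have "(\<Sum>k=1..n. theta_coeff n \<tau> (\<mu> j) k * M k i) = theta_prod n \<tau> (\<mu> j) (z - of_nat n * p i)"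
      unfolding M_def S_mat_def by (rule sum_theta_coeff_Phi[OF n \<tau> sum_\<mu>[OF that(2)]])
    also have "\<dots> = (if i = j then \<beta> j else 0)"
    proof (cases "i = j")
      case False
      have "theta 0 0 ((z - of_nat n * p i) / of_nat n + \<mu> j i) \<tau> = 0"
        using False that(1) theta_half_period_eq_0[OF \<tau>] by (simp add: arg h_def)
      thus ?thesis using False that(1) unfolding theta_prod_def by auto
    qed (simp add: \<beta>_def)
    finally show ?thesis .
  qed
  define N :: "nat cmat" where "N = (\<lambda>j k. theta_coeff n \<tau> (\<mu> j) k / \<beta> j)"
  have NM: "mat_eq {1..n} (mat_mul {1..n} N M) mat_one"
    unfolding mat_eq_def
  proof (intro ballI)
    fix a b assume ab: "a \<in> {1..n}" "b \<in> {1..n}"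
    have "mat_mul {1..n} N M a b = (\<Sum>k=1..n. theta_coeff n \<tau> (\<mu> a) k * M k b) / \<beta> a"
      by (simp add: mat_mul_def N_def sum_divide_distrib)
    thus "mat_mul {1..n} N M a b = mat_one a b"
      using row[OF ab(2,1)] \<beta>[OF ab(1)] by (auto simp: mat_one_def)
  qed
  have "mat_eq {1..n} (mat_mul {1..n} M N) mat_one \<and> mat_eq {1..n} (mat_mul {1..n} N M) mat_one"
    using NM mat_left_inverse_imp_right_inverse by blast
  hence inv: "mat_eq {1..n} (mat_mul {1..n} M (mat_inv {1..n} M)) mat_one \<and>
              mat_eq {1..n} (mat_mul {1..n} (mat_inv {1..n} M) M) mat_one"
    unfolding mat_inv_def
    by (rule someI[of "\<lambda>N. mat_eq {1..n} (mat_mul {1..n} M N) mat_one \<and> mat_eq {1..n} (mat_mul {1..n} N M) mat_one"])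
  thus inv1: "mat_eq {1..n} (mat_mul {1..n} M (mat_inv {1..n} M)) mat_one"
    and "mat_eq {1..n} (mat_mul {1..n} (mat_inv {1..n} M) M) mat_one" by auto
  assume j: "j \<in> {1..n}"
  have "theta_coeff n \<tau> (\<mu> j) k = \<beta> j * mat_inv {1..n} M j k" if k: "k \<in> {1..n}" for k
  proof -
    have "theta_coeff n \<tau> (\<mu> j) k = (\<Sum>i=1..n. if i = k then theta_coeff n \<tau> (\<mu> j) k else 0)"
      using k by simp
    also have "\<dots> = (\<Sum>i=1..n. theta_coeff n \<tau> (\<mu> j) i * mat_one i k)"
      by (intro sum.cong) (auto simp: mat_one_def)
    also have "\<dots> = (\<Sum>i=1..n. \<Sum>m=1..n. theta_coeff n \<tau> (\<mu> j) i * M i m * mat_inv {1..n} M m k)"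
    proof (intro sum.cong refl)
      fix i assume "i \<in> {1..n}"
      hence "mat_one i k = (\<Sum>m=1..n. M i m * mat_inv {1..n} M m k)"
        using inv1 k unfolding mat_eq_def mat_mul_def by metis
      thus "theta_coeff n \<tau> (\<mu> j) i * mat_one i k =
              (\<Sum>m=1..n. theta_coeff n \<tau> (\<mu> j) i * M i m * mat_inv {1..n} M m k)"
        by (simp add: sum_distrib_left mult.assoc)
    qed
    also have "\<dots> = (\<Sum>m=1..n. (\<Sum>i=1..n. theta_coeff n \<tau> (\<mu> j) i * M i m) * mat_inv {1..n} M m k)"
      by (subst sum.swap) (simp add: sum_distrib_right)
    also have "\<dots> = (\<Sum>m=1..n. (if m = j then \<beta> j else 0) * mat_inv {1..n} M m k)"
    proof (intro sum.cong refl)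
      fix m assume "m \<in> {1..n}"
      from row[OF this j] show "(\<Sum>i=1..n. theta_coeff n \<tau> (\<mu> j) i * M i m) * mat_inv {1..n} M m k =
          (if m = j then \<beta> j else 0) * mat_inv {1..n} M m k" by (rule arg_cong)
    qed
    also have "\<dots> = (\<Sum>m=1..n. if m = j then \<beta> j * mat_inv {1..n} M j k else 0)"
      by (intro sum.cong) auto
    also have "\<dots> = \<beta> j * mat_inv {1..n} M j k" using j by (simp add: sum.delta)
    finally show ?thesis .
  qed
  thus "\<exists>\<beta>. \<forall>k\<in>{1..n}.
      theta_coeff n \<tau> (move p (z - of_nat n * ((1 + \<tau>) / 2)) (omega n j)) k = \<beta> * mat_inv {1..n} M j k"
    unfolding \<mu>_def h_def by blast
qed

section \<open>Generic points of $\mathfrak{h}^*$\<close>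

lemma generically_iff:
  "generically n U P \<longleftrightarrow>
     (\<exists>W. open W \<and> (\<forall>D. open D \<longrightarrow> D \<inter> U \<inter> hstar n \<noteq> {} \<longrightarrow> D \<inter> W \<inter> U \<inter> hstar n \<noteq> {}) \<and>
          (\<forall>p\<in>W \<inter> U \<inter> hstar n. P p))"
proof -
  have "U \<inter> hstar n \<subseteq> closure (W \<inter> U \<inter> hstar n) \<longleftrightarrow>
          (\<forall>D. open D \<longrightarrow> D \<inter> U \<inter> hstar n \<noteq> {} \<longrightarrow> D \<inter> W \<inter> U \<inter> hstar n \<noteq> {})" for W
    unfolding closure_iff_nhds_not_empty subset_iff by blast
  thus ?thesis unfolding generically_def by auto
qed

lemma genericallyE:
  assumes "generically n U P"
  obtains W where "open W" "\<And>D. open D \<Longrightarrow> D \<inter> U \<inter> hstar n \<noteq> {} \<Longrightarrow> D \<inter> W \<inter> U \<inter> hstar n \<noteq> {}"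
    "\<And>p. p \<in> W \<Longrightarrow> p \<in> U \<Longrightarrow> p \<in> hstar n \<Longrightarrow> P p"
proof -
  obtain W where W: "open W \<and> (\<forall>D. open D \<longrightarrow> D \<inter> U \<inter> hstar n \<noteq> {} \<longrightarrow> D \<inter> W \<inter> U \<inter> hstar n \<noteq> {}) \<and>
      (\<forall>p\<in>W \<inter> U \<inter> hstar n. P p)"
    using assms unfolding generically_iff by (rule exE)
  show ?thesis by (rule that[of W]) (use W in simp_all)
qed

lemma genericallyI:
  assumes "open W" "\<And>D. open D \<Longrightarrow> D \<inter> U \<inter> hstar n \<noteq> {} \<Longrightarrow> D \<inter> W \<inter> U \<inter> hstar n \<noteq> {}"
    "\<And>p. p \<in> W \<Longrightarrow> p \<in> U \<Longrightarrow> p \<in> hstar n \<Longrightarrow> P p"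
  shows "generically n U P"
  unfolding generically_iff by (rule exI[of _ W]) (use assms in simp)

lemma generically_mono:
  assumes "generically n U P" "\<And>p. p \<in> U \<Longrightarrow> p \<in> hstar n \<Longrightarrow> P p \<Longrightarrow> Q p"
  shows "generically n U Q"
proof -
  obtain W where W: "open W" "\<And>D. open D \<Longrightarrow> D \<inter> U \<inter> hstar n \<noteq> {} \<Longrightarrow> D \<inter> W \<inter> U \<inter> hstar n \<noteq> {}"
      "\<And>p. p \<in> W \<Longrightarrow> p \<in> U \<Longrightarrow> p \<in> hstar n \<Longrightarrow> P p"
    using assms(1) by (rule genericallyE) blast
  show ?thesis by (rule genericallyI[OF W(1,2) assms(2)[OF _ _ W(3)]])
qed

lemma generically_always:
  assumes "\<And>p. p \<in> U \<Longrightarrow> p \<in> hstar n \<Longrightarrow> P p"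
  shows "generically n U P"
  by (rule genericallyI[of UNIV]) (use assms in auto)

lemma generically_conj:
  assumes "generically n U P" "generically n U Q"
  shows "generically n U (\<lambda>p. P p \<and> Q p)"
proof -
  obtain V W where V: "open V" "\<And>D. open D \<Longrightarrow> D \<inter> U \<inter> hstar n \<noteq> {} \<Longrightarrow> D \<inter> V \<inter> U \<inter> hstar n \<noteq> {}"
      "\<And>p. p \<in> V \<Longrightarrow> p \<in> U \<Longrightarrow> p \<in> hstar n \<Longrightarrow> P p"
    using assms(1) by (rule genericallyE) blast
  obtain W where W: "open W" "\<And>D. open D \<Longrightarrow> D \<inter> U \<inter> hstar n \<noteq> {} \<Longrightarrow> D \<inter> W \<inter> U \<inter> hstar n \<noteq> {}"
      "\<And>p. p \<in> W \<Longrightarrow> p \<in> U \<Longrightarrow> p \<in> hstar n \<Longrightarrow> Q p"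
    using assms(2) by (rule genericallyE) blast
  have "D \<inter> (V \<inter> W) \<inter> U \<inter> hstar n \<noteq> {}" if "open D" "D \<inter> U \<inter> hstar n \<noteq> {}" for D
    using W(2)[OF open_Int[OF that(1) V(1)] V(2)[OF that]] by (simp add: Int_ac)
  thus ?thesis by (intro genericallyI[of "V \<inter> W"]) (use V W in auto)
qed

lemma generically_ball_finite:
  assumes "finite I" "\<And>i. i \<in> I \<Longrightarrow> generically n U (P i)"
  shows "generically n U (\<lambda>p. \<forall>i\<in>I. P i p)"
  using assms by (induction I rule: finite_induct) (auto intro: generically_always generically_conj)

lemma generically_ex:
  assumes "generically n U P" "open D" "D \<inter> U \<inter> hstar n \<noteq> {}"
  shows "\<exists>p\<in>D \<inter> U \<inter> hstar n. P p"
proof -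
  obtain W where W: "\<And>D. open D \<Longrightarrow> D \<inter> U \<inter> hstar n \<noteq> {} \<Longrightarrow> D \<inter> W \<inter> U \<inter> hstar n \<noteq> {}"
      "\<And>p. p \<in> W \<Longrightarrow> p \<in> U \<Longrightarrow> p \<in> hstar n \<Longrightarrow> P p"
    using assms(1) by (rule genericallyE) blast
  from W(1)[OF assms(2,3)] obtain p where "p \<in> D" "p \<in> W" "p \<in> U" "p \<in> hstar n" by auto
  thus ?thesis using W(2) by blast
qed

lemma generically_UNIV_ex:
  assumes "generically n UNIV P"
  shows "\<exists>p\<in>hstar n. P p"
proof -
  have "(\<lambda>_. 0) \<in> UNIV \<inter> UNIV \<inter> hstar n" by (simp add: hstar_def)
  hence "UNIV \<inter> UNIV \<inter> hstar n \<noteq> {}" by blast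
  from generically_ex[OF assms open_UNIV this] show ?thesis by simp
qed

lemma generically_subset:
  assumes "generically n U P" "open V" "V \<inter> hstar n \<subseteq> U"
  shows "generically n V P"
proof -
  obtain W where W: "open W" "\<And>D. open D \<Longrightarrow> D \<inter> U \<inter> hstar n \<noteq> {} \<Longrightarrow> D \<inter> W \<inter> U \<inter> hstar n \<noteq> {}"
      "\<And>p. p \<in> W \<Longrightarrow> p \<in> U \<Longrightarrow> p \<in> hstar n \<Longrightarrow> P p"
    using assms(1) by (rule genericallyE) blast
  have "D \<inter> W \<inter> V \<inter> hstar n \<noteq> {}" if "open D" "D \<inter> V \<inter> hstar n \<noteq> {}" for D
  proof -
    have "(D \<inter> V) \<inter> U \<inter> hstar n \<noteq> {}" using that(2) assms(3) by auto
    from W(2)[OF open_Int[OF that(1) assms(2)] this] show ?thesis by auto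
  qed
  thus ?thesis by (intro genericallyI[OF W(1)]) (use W(3) assms(3) in auto)
qed

text \<open>
  A union of open sets on which \<open>P\<close> holds is again such a set, so that generic validity can be checked
  near each point.
\<close>

lemma generically_local:
  assumes "\<And>p. p \<in> hstar n \<Longrightarrow> \<exists>U. open U \<and> p \<in> U \<and> generically n U P"
  shows "generically n UNIV P"
proof -
  define W where "W = \<Union>{D. open D \<and> (\<forall>p\<in>D \<inter> hstar n. P p)}"
  have "D \<inter> W \<inter> hstar n \<noteq> {}" if D: "open D" "D \<inter> hstar n \<noteq> {}" for D
  proof -
    obtain p where p: "p \<in> D" "p \<in> hstar n" using D by auto
    then obtain U where U: "open U" "p \<in> U" "generically n U P"
      using assms[of p] by auto
    obtain V where V: "open V" "\<And>D. open D \<Longrightarrow> D \<inter> U \<inter> hstar n \<noteq> {} \<Longrightarrow> D \<inter> V \<inter> U \<inter> hstar n \<noteq> {}"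
      "\<And>p. p \<in> V \<Longrightarrow> p \<in> U \<Longrightarrow> p \<in> hstar n \<Longrightarrow> P p"
      using U(3) by (rule genericallyE) blast
    have "open (V \<inter> U) \<and> (\<forall>p\<in>V \<inter> U \<inter> hstar n. P p)" using U V by auto
    hence "V \<inter> U \<subseteq> W" unfolding W_def by (intro Union_upper) auto
    moreover have "D \<inter> V \<inter> U \<inter> hstar n \<noteq> {}" by (rule V(2)) (use p U D in auto)
    ultimately show ?thesis by auto
  qed
  moreover have "open W" unfolding W_def by auto
  ultimately show ?thesis by (intro genericallyI[of W]) (auto simp: W_def)
qed

lemma continuous_on_move: "continuous_on A (\<lambda>p. move p r q)"
  unfolding move_def
  by (intro continuous_on_coordinatewise_then_product continuous_intros
        continuous_on_subset[OF continuous_on_product_coordinates]) auto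

lemma continuous_on_move_line: "continuous_on A (\<lambda>t. move p t q)"
  unfolding move_def by (intro continuous_on_coordinatewise_then_product continuous_intros)

lemma move_0 [simp]: "move p 0 q = p" by (simp add: move_def)
lemma move_move [simp]: "move (move p r q) r' q = move p (r + r') q"
  by (simp add: move_def algebra_simps)

lemma open_move_vimage: "open D \<Longrightarrow> open {p. move p r q \<in> D}"
  using open_vimage[OF _ continuous_on_move, of D r q] by (simp add: vimage_def)

lemma open_move_line_vimage: "open D \<Longrightarrow> open {t. move p t q \<in> D}"
  using open_vimage[OF _ continuous_on_move_line, of D p q] by (simp add: vimage_def)

lemma generically_translate:
  assumes "generically n UNIV P" "v \<in> hstar n"
  shows "generically n UNIV (\<lambda>p. P (move p r v))"
proof -
  obtain W where W: "open W" "\<And>D. open D \<Longrightarrow> D \<inter> hstar n \<noteq> {} \<Longrightarrow> D \<inter> W \<inter> hstar n \<noteq> {}"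
      "\<And>p. p \<in> W \<Longrightarrow> p \<in> hstar n \<Longrightarrow> P p"
    using assms(1) by (rule genericallyE) auto
  have "D \<inter> {p. move p r v \<in> W} \<inter> hstar n \<noteq> {}" if D: "open D" "D \<inter> hstar n \<noteq> {}" for D
  proof -
    obtain p where p: "p \<in> D" "p \<in> hstar n" using D by auto
    have "move p r v \<in> {p. move p (- r) v \<in> D} \<inter> hstar n"
      using p assms(2) by (auto intro: hstar_move)
    hence "{p. move p (- r) v \<in> D} \<inter> hstar n \<noteq> {}" by blast
    from W(2)[OF open_move_vimage[OF D(1)] this] obtain q where q: "move q (- r) v \<in> D" "q \<in> W" "q \<in> hstar n" by auto
    hence "move q (- r) v \<in> D \<inter> {p. move p r v \<in> W} \<inter> hstar n"
      using assms(2) by (auto intro: hstar_move)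
    thus ?thesis by blast
  qed
  thus ?thesis
    by (intro genericallyI[of "{p. move p r v \<in> W}"]) (use W assms(2) in \<open>auto intro: open_move_vimage hstar_move\<close>)
qed

text \<open>
  Relations between functions that are continuous on an open set propagate from generic points to all
  points of that set. This removes exceptional sets that depend on an auxiliary parameter.
\<close>

lemma generically_eq_imp_eq:
  fixes f g :: "hvec \<Rightarrow> complex"
  assumes "open D" "continuous_on (D \<inter> hstar n) f" "continuous_on (D \<inter> hstar n) g"
    and eq: "generically n UNIV (\<lambda>p. p \<in> D \<longrightarrow> f p = g p)" and p: "p \<in> D" "p \<in> hstar n"
  shows "f p = g p"
proof (rule ccontr)
  assume neq: "f p \<noteq> g p"
  have "continuous_on (D \<inter> hstar n) (\<lambda>p. f p - g p)" by (intro continuous_intros assms)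
  moreover have "open (- {0 :: complex})" by auto
  ultimately obtain A where A: "open A" "A \<inter> (D \<inter> hstar n) = (\<lambda>p. f p - g p) -` (- {0}) \<inter> (D \<inter> hstar n)"
    unfolding continuous_on_open_invariant by blast
  have "p \<in> A \<inter> D \<inter> UNIV \<inter> hstar n" using A neq p by auto
  then obtain q where "q \<in> A \<inter> D \<inter> UNIV \<inter> hstar n" "q \<in> D \<longrightarrow> f q = g q"
    using generically_ex[OF eq open_Int[OF A(1) assms(1)]] by blast
  thus False using A by auto
qed

section \<open>Meromorphic functions on $\mathfrak{h}^*$\<close>

lemma holo_subset: "holo n U f \<Longrightarrow> V \<subseteq> U \<Longrightarrow> holo n V f"
  unfolding holo_def by (meson Int_mono continuous_on_subset order_refl subsetD)

lemma eventually_move_in_open: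
  assumes "open D" "p \<in> D"
  shows "\<forall>\<^sub>F t in nhds 0. move p t q \<in> D"
  using eventually_nhds_in_open[OF open_move_line_vimage[OF assms(1), of p q], of 0] assms(2) by simp

lemma holo_quotient:
  assumes "open U" "holo n U g" "holo n U h"
    and eq: "\<And>q. q \<in> U \<Longrightarrow> q \<in> hstar n \<Longrightarrow> h q \<noteq> 0 \<and> f q = g q / h q"
  shows "holo n U f"
  unfolding holo_def
proof (intro conjI ballI)
  have "continuous_on (U \<inter> hstar n) (\<lambda>q. g q / h q)"
    using assms unfolding holo_def by (intro continuous_on_divide) auto
  thus "continuous_on (U \<inter> hstar n) f"
    by (rule continuous_on_cong[THEN iffD1, rotated -1]) (use eq in auto)
next
  fix p q assume p: "p \<in> U \<inter> hstar n" and q: "q \<in> hstar n"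
  have diff: "(\<lambda>t. g (move p t q) / h (move p t q)) field_differentiable (at 0)"
    using assms p q unfolding holo_def by (intro field_differentiable_divide) auto
  have ev: "\<forall>\<^sub>F t in nhds 0. g (move p t q) / h (move p t q) = f (move p t q)"
  proof (rule eventually_mono[OF eventually_move_in_open[of U p q]])
    fix t assume "move p t q \<in> U"
    thus "g (move p t q) / h (move p t q) = f (move p t q)"
      using eq[of "move p t q"] p q hstar_move by auto
  qed (use assms(1) p in auto)
  then obtain e where e: "e > 0" "\<And>t. dist t 0 < e \<Longrightarrow> g (move p t q) / h (move p t q) = f (move p t q)"
    unfolding eventually_nhds_metric by blast
  show "(\<lambda>t. f (move p t q)) field_differentiable (at 0)"
    by (rule field_differentiable_transform_within[OF e(1) _ _ diff]) (use e(2) in auto)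
qed

lemma holo_line:
  assumes "open U" "holo n U f" "p \<in> hstar n" "q \<in> hstar n"
  shows "(\<lambda>t. f (move p t q)) holomorphic_on {t. move p t q \<in> U}"
proof -
  have "(\<lambda>t. f (move p t q)) field_differentiable (at t)" if "move p t q \<in> U" for t
  proof -
    have "move p t q \<in> U \<inter> hstar n" using that assms(3,4) hstar_move by auto
    hence "(\<lambda>s. f (move (move p t q) s q)) field_differentiable (at 0)"
      using assms(2,4) unfolding holo_def by blast
    hence "(\<lambda>s. f (move (move p t q) s q)) field_differentiable (at (t - t))"
      by (simp only: diff_self)
    moreover have "(\<lambda>s. s - t) field_differentiable (at t)"
      by (intro derivative_intros)
    ultimately have "(\<lambda>s. f (move (move p t q) s q)) \<circ> (\<lambda>s. s - t) field_differentiable (at t)"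
      by (intro field_differentiable_compose)
    thus ?thesis by (simp add: o_def)
  qed
  thus ?thesis
    unfolding holomorphic_on_def by (auto intro: field_differentiable_at_within)
qed

text \<open>
  The largest open set on which the representative \<open>f\<close> itself is holomorphic.
\<close>

definition regular_set :: "nat \<Rightarrow> (hvec \<Rightarrow> complex) \<Rightarrow> hvec set" where
  "regular_set n f = \<Union>{D. open D \<and> holo n D f}"

lemma open_regular_set: "open (regular_set n f)"
  unfolding regular_set_def by auto

lemma holo_regular_set: "holo n (regular_set n f) f"
  unfolding holo_def
proof (intro conjI ballI)
  show "continuous_on (regular_set n f \<inter> hstar n) f"
    unfolding continuous_on_eq_continuous_within
  proof
    fix p assume p: "p \<in> regular_set n f \<inter> hstar n"
    then obtain D where D: "open D" "p \<in> D" "holo n D f" unfolding regular_set_def by auto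
    hence "continuous (at p within (D \<inter> hstar n)) f"
      using p unfolding holo_def continuous_on_eq_continuous_within by auto
    moreover have "at p within (D \<inter> hstar n) = at p within (regular_set n f \<inter> hstar n)"
      by (rule at_within_nhd[of _ D]) (use D in \<open>auto simp: regular_set_def\<close>)
    ultimately show "continuous (at p within (regular_set n f \<inter> hstar n)) f" by simp
  qed
qed (auto simp: regular_set_def holo_def)

lemma mero_generically_regular:
  assumes "mero n f"
  shows "generically n UNIV (\<lambda>p. p \<in> regular_set n f)"
proof (rule generically_local)
  fix p assume "p \<in> hstar n"
  then obtain U g h where U: "open U" "p \<in> U" "holo n U g" "holo n U h"
      "generically n U (\<lambda>q. h q \<noteq> 0 \<and> f q = g q / h q)"
    using assms unfolding mero_def by blast
  then obtain W where W: "open W" "\<And>D. open D \<Longrightarrow> D \<inter> U \<inter> hstar n \<noteq> {} \<Longrightarrow> D \<inter> W \<inter> U \<inter> hstar n \<noteq> {}"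
      "\<And>q. q \<in> W \<Longrightarrow> q \<in> U \<Longrightarrow> q \<in> hstar n \<Longrightarrow> h q \<noteq> 0 \<and> f q = g q / h q"
    by (elim genericallyE) blast
  have "holo n (W \<inter> U) f"
    by (rule holo_quotient[where g = g and h = h]) (use U W holo_subset in auto)
  hence "W \<inter> U \<subseteq> regular_set n f" using U W unfolding regular_set_def by auto
  hence "generically n U (\<lambda>p. p \<in> regular_set n f)"
    using W by (intro genericallyI[of W]) auto
  thus "\<exists>U. open U \<and> p \<in> U \<and> generically n U (\<lambda>p. p \<in> regular_set n f)" using U by blast
qed

text \<open>
  Only the coordinates in \<open>{1..n}\<close> are restricted; on \<open>hstar n\<close> the others vanish, so that these sets
  form a basis of neighbourhoods there. Their intersections with complex lines are convex.
\<close>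

definition polydisc :: "nat \<Rightarrow> hvec \<Rightarrow> real \<Rightarrow> hvec set" where
  "polydisc n p r = {q. \<forall>k\<in>{1..n}. q k \<in> ball (p k) r}"

lemma open_polydisc: "open (polydisc n p r)"
  unfolding polydisc_def using product_topology_basis'[of "{1..n}" "\<lambda>k. ball (p k) r" "\<lambda>k. k"] by auto

lemma polydisc_nbhd:
  assumes "open U" "p \<in> U" "p \<in> hstar n"
  shows "\<exists>r>0. polydisc n p r \<inter> hstar n \<subseteq> U"
proof -
  have "openin (product_topology (\<lambda>_. euclidean) UNIV) U"
    using assms(1) by (simp add: euclidean_product_topology)
  then obtain X where X: "p \<in> Pi\<^sub>E UNIV X" "\<And>i. open (X i)" "Pi\<^sub>E UNIV X \<subseteq> U"
    using product_topology_open_contains_basis[OF _ assms(2)] by (metis open_openin)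
  have "\<exists>r>0. \<forall>i\<in>I. ball (p i) r \<subseteq> X i" if "finite I" for I
    using that
  proof (induction I rule: finite_induct)
    case empty
    show ?case by (auto intro: exI[of _ 1])
  next
    case (insert i I)
    then obtain r where r: "r > 0" "\<forall>i\<in>I. ball (p i) r \<subseteq> X i" by blast
    obtain r' where r': "r' > 0" "ball (p i) r' \<subseteq> X i"
      using X(1,2) unfolding open_contains_ball by (metis PiE_mem UNIV_I)
    have "ball (p j) (min r r') \<subseteq> X j" if "j \<in> insert i I" for j
    proof -
      have "ball (p j) (min r r') \<subseteq> ball (p j) r" "ball (p j) (min r r') \<subseteq> ball (p j) r'" by auto
      thus ?thesis using that r r' by blast
    qed
    thus ?case using r r' by (intro exI[of _ "min r r'"]) auto
  qed
  from this[of "{1..n}"] obtain r where r: "r > 0" "\<forall>i\<in>{1..n}. ball (p i) r \<subseteq> X i" by auto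
  have "q \<in> U" if q: "q \<in> polydisc n p r" "q \<in> hstar n" for q
  proof -
    have "q i \<in> X i" for i
    proof (cases "i \<in> {1..n}")
      case True
      hence "q i \<in> ball (p i) r" using q(1) unfolding polydisc_def by blast
      thus ?thesis using r(2) True by blast
    next
      case False
      hence "q i = p i" using q assms(3) unfolding hstar_def by auto
      thus ?thesis using X(1) by auto
    qed
    thus ?thesis using X(3) by auto
  qed
  thus ?thesis using r by blast
qed

lemma hstar_diff: "p \<in> hstar n \<Longrightarrow> q \<in> hstar n \<Longrightarrow> (\<lambda>k. q k - p k) \<in> hstar n"
  by (auto simp: hstar_def sum_subtractf)

lemma convex_move_polydisc: "convex {t. move p t q \<in> polydisc n a r}"
proof (rule convexI)
  fix x y :: complex and u v :: real
  assume xy: "x \<in> {t. move p t q \<in> polydisc n a r}" "y \<in> {t. move p t q \<in> polydisc n a r}"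
    and uv: "0 \<le> u" "0 \<le> v" "u + v = 1"
  have "p k + (u *\<^sub>R x + v *\<^sub>R y) * q k \<in> ball (a k) r" if "k \<in> {1..n}" for k
  proof -
    have "u *\<^sub>R (p k + x * q k) + v *\<^sub>R (p k + y * q k) \<in> ball (a k) r"
      using xy that uv by (intro convexD[OF convex_ball]) (auto simp: polydisc_def move_def)
    also have "u *\<^sub>R (p k + x * q k) + v *\<^sub>R (p k + y * q k) = (u + v) *\<^sub>R p k + (u *\<^sub>R x + v *\<^sub>R y) * q k"
      by (simp add: algebra_simps scaleR_conv_of_real)
    finally show ?thesis using uv by simp
  qed
  thus "u *\<^sub>R x + v *\<^sub>R y \<in> {t. move p t q \<in> polydisc n a r}"
    by (simp add: polydisc_def move_def)
qed

text \<open>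
  The identity theorem in one variable, applied on the complex line through \<open>q0\<close> and \<open>q\<close>; this line
  meets the polydisc in a convex, hence connected, open set.
\<close>

lemma holo_identity_polydisc:
  assumes f: "holo n (polydisc n a r) f" and g: "holo n (polydisc n a r) g"
    and D: "open D" "q0 \<in> D" "q0 \<in> polydisc n a r" "q0 \<in> hstar n"
    and eq: "\<And>q. q \<in> D \<Longrightarrow> q \<in> polydisc n a r \<Longrightarrow> q \<in> hstar n \<Longrightarrow> f q = g q"
    and q: "q \<in> polydisc n a r" "q \<in> hstar n"
  shows "f q = g q"
proof -
  define d where "d = (\<lambda>k. q k - q0 k)"
  have d: "d \<in> hstar n" unfolding d_def by (rule hstar_diff[OF D(4) q(2)])
  define T where "T = {t. move q0 t d \<in> polydisc n a r}"
  define T0 where "T0 = {t. move q0 t d \<in> D \<inter> polydisc n a r}"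
  have "f (move q0 1 d) = g (move q0 1 d)"
  proof (rule analytic_continuation_open[of T0 T "\<lambda>t. f (move q0 t d)" "\<lambda>t. g (move q0 t d)" 1])
    show "open T0" "open T" unfolding T0_def T_def
      by (intro open_move_line_vimage open_Int D open_polydisc)+
    show "T0 \<noteq> {}" using D by (auto simp: T0_def intro: exI[of _ 0])
    show "connected T" unfolding T_def by (intro convex_connected convex_move_polydisc)
    show "(\<lambda>t. f (move q0 t d)) holomorphic_on T" "(\<lambda>t. g (move q0 t d)) holomorphic_on T"
      unfolding T_def
      by (rule holo_line[OF open_polydisc f D(4) d], rule holo_line[OF open_polydisc g D(4) d])
    show "1 \<in> T" using q by (simp add: T_def d_def move_def)
    show "f (move q0 t d) = g (move q0 t d)" if "t \<in> T0" for t
      using that by (intro eq) (auto simp: T0_def intro: hstar_move D d)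
  qed (auto simp: T0_def T_def)
  thus ?thesis by (simp add: d_def move_def)
qed

lemma connected_hstar: "connected (hstar n)"
proof -
  have "path_connected (hstar n)"
    unfolding path_connected_def
  proof (intro ballI)
    fix p q assume pq: "p \<in> hstar n" "q \<in> hstar n"
    let ?g = "\<lambda>t::real. move p (of_real t) (\<lambda>k. q k - p k)"
    have "continuous_on {0..1} ?g"
      unfolding move_def by (intro continuous_on_coordinatewise_then_product continuous_intros)
    moreover have "path_image ?g \<subseteq> hstar n"
      unfolding path_image_def using pq by (auto intro!: hstar_move hstar_diff)
    moreover have "pathstart ?g = p" "pathfinish ?g = q"
      by (auto simp: pathstart_def pathfinish_def move_def)
    ultimately show "\<exists>g. path g \<and> path_image g \<subseteq> hstar n \<and> pathstart g = p \<and> pathfinish g = q"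
      unfolding path_def by blast
  qed
  thus ?thesis by (rule path_connected_imp_connected)
qed

text \<open>
  A dense open set may be disconnected, so a generically locally constant representative need not be
  generically constant. Meromorphy excludes this: near every point \<open>f = g / h\<close> generically, so if
  \<open>f = c\<close> generically somewhere on a polydisc then \<open>g = c h\<close> on all of it by the identity theorem. Hence the
  set of points near which \<open>f = c\<close> generically is open and closed in the connected space \<open>hstar n\<close>.
\<close>

lemma mero_generically_const:
  assumes f: "mero n f" and D: "open D" "D \<inter> hstar n \<noteq> {}" and c: "\<And>q. q \<in> D \<Longrightarrow> q \<in> hstar n \<Longrightarrow> f q = c"
  shows "generically n UNIV (\<lambda>q. f q = c)"
proof -
  define A where "A = \<Union>{U. open U \<and> generically n U (\<lambda>q. f q = c)}"
  have "open A" unfolding A_def by auto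
  have A_ne: "A \<inter> hstar n \<noteq> {}"
  proof -
    have "generically n D (\<lambda>q. f q = c)" using c by (intro generically_always)
    hence "D \<subseteq> A" using D unfolding A_def by auto
    thus ?thesis using D by auto
  qed
  (* Each point has a neighbourhood P that lies in A as soon as it meets A. *)
  have closed: "\<exists>P. open P \<and> p \<in> P \<and> (P \<inter> A \<inter> hstar n \<noteq> {} \<longrightarrow> generically n P (\<lambda>q. f q = c))"
    if p: "p \<in> hstar n" for p
  proof -
    obtain U g h where U: "open U" "p \<in> U" "holo n U g" "holo n U h"
      "generically n U (\<lambda>q. h q \<noteq> 0 \<and> f q = g q / h q)"
      using f p unfolding mero_def by blast
    obtain r where r: "r > 0" "polydisc n p r \<inter> hstar n \<subseteq> U"
      using polydisc_nbhd[OF U(1,2) p] by blast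
    let ?P = "polydisc n p r"
    have gP: "generically n ?P (\<lambda>q. h q \<noteq> 0 \<and> f q = g q / h q)"
      by (rule generically_subset[OF U(5) open_polydisc r(2)])
    have hol: "holo n ?P g" "holo n ?P h"
      using U(3,4) r(2) unfolding holo_def by (auto intro: continuous_on_subset)
    have "generically n ?P (\<lambda>q. f q = c)" if ne: "?P \<inter> A \<inter> hstar n \<noteq> {}"
    proof -
      obtain V where V: "open V" "generically n V (\<lambda>q. f q = c)" "V \<inter> ?P \<inter> hstar n \<noteq> {}"
        using ne unfolding A_def by blast
      have VP: "open (V \<inter> ?P)" using V open_polydisc by auto
      have "generically n (V \<inter> ?P) (\<lambda>q. (h q \<noteq> 0 \<and> f q = g q / h q) \<and> f q = c)"
        by (intro generically_conj generically_subset[OF gP VP] generically_subset[OF V(2) VP]) auto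
      then obtain W where W: "open W" "\<And>D. open D \<Longrightarrow> D \<inter> (V \<inter> ?P) \<inter> hstar n \<noteq> {} \<Longrightarrow> D \<inter> W \<inter> (V \<inter> ?P) \<inter> hstar n \<noteq> {}"
          "\<And>q. q \<in> W \<Longrightarrow> q \<in> V \<inter> ?P \<Longrightarrow> q \<in> hstar n \<Longrightarrow> (h q \<noteq> 0 \<and> f q = g q / h q) \<and> f q = c"
        by (rule genericallyE) blast
      from W(2)[of UNIV] V(3) obtain q0 where q0: "q0 \<in> W \<inter> V" "q0 \<in> ?P" "q0 \<in> hstar n" by auto
      have hc: "holo n ?P (\<lambda>q. c * h q)"
        using hol(2) unfolding holo_def
        by (auto intro!: continuous_on_mult_left field_differentiable_mult field_differentiable_const)
      have "g q = c * h q" if "q \<in> ?P" "q \<in> hstar n" for q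
      proof (rule holo_identity_polydisc[OF hol(1) hc _ q0 _ that])
        show "open (W \<inter> V)" using W V by auto
        show "g q = c * h q" if "q \<in> W \<inter> V" "q \<in> ?P" "q \<in> hstar n" for q
          using W(3)[of q] that by auto
      qed
      thus ?thesis using gP by (elim generically_mono) auto
    qed
    thus ?thesis using p r by (intro exI[of _ ?P] conjI open_polydisc impI) (auto simp: polydisc_def)
  qed
  have "hstar n \<subseteq> A"
  proof (rule ccontr)
    assume "\<not> hstar n \<subseteq> A"
    define B where "B = \<Union>{P. open P \<and> P \<inter> A \<inter> hstar n = {}}"
    have "open B" unfolding B_def by auto
    have "hstar n \<subseteq> A \<union> B"
    proof
      fix p assume "p \<in> hstar n"
      from closed[OF this] obtain P where "open P" "p \<in> P" "P \<inter> A \<inter> hstar n \<noteq> {} \<longrightarrow> generically n P (\<lambda>q. f q = c)" by blast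
      thus "p \<in> A \<union> B" unfolding A_def B_def by blast
    qed
    moreover have "A \<inter> B \<inter> hstar n = {}" unfolding B_def by blast
    moreover have "B \<inter> hstar n \<noteq> {}" using \<open>\<not> hstar n \<subseteq> A\<close> \<open>hstar n \<subseteq> A \<union> B\<close> by blast
    ultimately show False
      using connectedD[OF connected_hstar \<open>open A\<close> \<open>open B\<close>] A_ne by blast
  qed
  thus ?thesis unfolding A_def by (intro generically_local) blast
qed

section \<open>Dense groups of real periods\<close>

lemma mero_period:
  assumes f: "mero n f" and v: "v \<in> hstar n" "generically n UNIV (\<lambda>p. f (move p 1 v) = f p)"
    and q: "q \<in> regular_set n f" "move q 1 v \<in> regular_set n f" "q \<in> hstar n"
  shows "f (move q 1 v) = f q"
proof -
  let ?\<Omega> = "regular_set n f"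
  have cont: "continuous_on (?\<Omega> \<inter> hstar n) f"
    using holo_regular_set[of n f] unfolding holo_def by blast
  let ?D = "?\<Omega> \<inter> {q. move q 1 v \<in> ?\<Omega>}"
  have "continuous_on (?D \<inter> hstar n) (\<lambda>q. f (move q 1 v))"
    by (rule continuous_on_compose2[OF cont continuous_on_move]) (use v(1) hstar_move in auto)
  moreover have "continuous_on (?D \<inter> hstar n) f" by (rule continuous_on_subset[OF cont]) auto
  moreover have "open ?D" by (intro open_Int open_regular_set open_move_vimage)
  moreover have "generically n UNIV (\<lambda>p. p \<in> ?D \<longrightarrow> f (move p 1 v) = f p)"
    using v(2) by (rule generically_mono) simp
  ultimately show ?thesis
    using q by (intro generically_eq_imp_eq[of ?D n "\<lambda>q. f (move q 1 v)" f q]) auto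
qed

text \<open>
  By continuity, \<open>f\<close> is invariant under every real translation that does not leave the regular set. Near
  a regular point \<open>p\<close>, split the displacement as \<open>a + \<i> b\<close> with \<open>a\<close>, \<open>b\<close> real. The translation by \<open>a\<close> is
  harmless, and on the complex line \<open>p + t b\<close> the function is constant for real \<open>t\<close>, hence for all \<open>t\<close>.
\<close>

lemma mero_const_of_dense_real_periods:
  assumes f: "mero n f"
    and dense: "\<And>v e. v \<in> hstar n \<Longrightarrow> (\<And>k. v k \<in> \<real>) \<Longrightarrow> e > 0 \<Longrightarrow>
       \<exists>v'\<in>hstar n. (\<forall>k. dist (v k) (v' k) < e) \<and> generically n UNIV (\<lambda>p. f (move p 1 v') = f p)"
  shows "\<exists>c. generically n UNIV (\<lambda>p. f p = c)"
proof -
  let ?\<Omega> = "regular_set n f"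
  have hol: "holo n ?\<Omega> f" by (rule holo_regular_set)
  (* Real translations within the regular set preserve f: approximate them by periods. *)
  have step: "f (move q 1 v) = f q"
    if v: "v \<in> hstar n" "\<And>k. v k \<in> \<real>" and q: "q \<in> ?\<Omega>" "q \<in> hstar n" "move q 1 v \<in> ?\<Omega>" for v q
  proof (rule ccontr)
    assume neq: "f (move q 1 v) \<noteq> f q"
    have "continuous_on (?\<Omega> \<inter> hstar n) f" using hol unfolding holo_def by blast
    moreover have "open (- {f q})" by auto
    ultimately obtain A where A: "open A" "A \<inter> (?\<Omega> \<inter> hstar n) = f -` (- {f q}) \<inter> (?\<Omega> \<inter> hstar n)"
      unfolding continuous_on_open_invariant by blast
    have qv: "move q 1 v \<in> hstar n" using q v hstar_move by auto
    hence "move q 1 v \<in> A \<inter> ?\<Omega>" using A neq q by auto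
    then obtain r where r: "r > 0" "polydisc n (move q 1 v) r \<inter> hstar n \<subseteq> A \<inter> ?\<Omega>"
      using polydisc_nbhd[of "A \<inter> ?\<Omega>" "move q 1 v" n] A(1) open_regular_set qv by blast
    obtain v' where v': "v' \<in> hstar n" "\<forall>k. dist (v k) (v' k) < r" "generically n UNIV (\<lambda>p. f (move p 1 v') = f p)"
      using dense[OF v r(1)] by blast
    have "move q 1 v' \<in> polydisc n (move q 1 v) r"
      using v'(2) by (auto simp: polydisc_def move_def dist_norm)
    hence "move q 1 v' \<in> A \<inter> (?\<Omega> \<inter> hstar n)" using r(2) q(2) v'(1) hstar_move by auto
    moreover from this have "f (move q 1 v') = f q"
      by (intro mero_period[OF f v'(1,3)] q) auto
    ultimately show False using A(2) by auto
  qed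
  have "(\<lambda>_. 0) \<in> hstar n" by (simp add: hstar_def)
  then obtain p where p: "p \<in> hstar n" "p \<in> ?\<Omega>"
    using generically_ex[OF mero_generically_regular[OF f], of UNIV] by blast
  obtain r where r: "r > 0" "polydisc n p r \<inter> hstar n \<subseteq> ?\<Omega>"
    using polydisc_nbhd[OF open_regular_set p(2,1)] by blast
  let ?P = "polydisc n p r"
  have pP: "p \<in> ?P" using r(1) by (simp add: polydisc_def)
  have "f q = f p" if q: "q \<in> ?P" "q \<in> hstar n" for q
  proof -
    define a b where "a = (\<lambda>k. complex_of_real (Re (q k - p k)))" and "b = (\<lambda>k. complex_of_real (Im (q k - p k)))"
    have d: "(\<lambda>k. q k - p k) \<in> hstar n" by (rule hstar_diff[OF p(1) q(2)])
    have d0: "(\<Sum>k=1..n. q k - p k) = 0" using d unfolding hstar_def by blast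
    have "(\<Sum>k=1..n. a k) = of_real (Re (\<Sum>k=1..n. q k - p k))"
         "(\<Sum>k=1..n. b k) = of_real (Im (\<Sum>k=1..n. q k - p k))"
      by (simp_all only: a_def b_def of_real_sum Re_sum Im_sum)
    hence "(\<Sum>k=1..n. a k) = 0" "(\<Sum>k=1..n. b k) = 0" unfolding d0 by simp_all
    moreover have "a i = 0" "b i = 0" if "i \<notin> {1..n}" for i
      using d that unfolding hstar_def a_def b_def by auto
    ultimately have ab: "a \<in> hstar n" "b \<in> hstar n" unfolding hstar_def by auto
    have ab_real: "a k \<in> \<real>" "b k \<in> \<real>" for k unfolding a_def b_def by (rule Reals_of_real)+
    (* Each coordinate of b is bounded by the corresponding one of q - p. *)
    have ib: "move p \<i> b \<in> ?P"
      using q(1) unfolding polydisc_def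
    proof clarify
      fix k assume "k \<in> {1..n}" "\<forall>k\<in>{1..n}. q k \<in> ball (p k) r"
      hence "norm (q k - p k) < r" by (simp add: dist_norm norm_minus_commute)
      moreover have "\<bar>Im (q k - p k)\<bar> \<le> norm (q k - p k)" by (rule abs_Im_le_cmod)
      moreover have "norm (b k) = \<bar>Im (q k - p k)\<bar>" by (simp only: b_def norm_of_real)
      ultimately show "move p \<i> b k \<in> ball (p k) r"
        by (simp add: move_def dist_norm norm_mult)
    qed
    have q_eq: "move (move p \<i> b) 1 a = q"
      unfolding move_def a_def b_def by (rule ext, rule complex_eqI) simp_all
    have ib': "move p \<i> b \<in> hstar n" using p ab hstar_move by auto
    have "f q = f (move p \<i> b)"
      unfolding q_eq[symmetric] by (intro step ab ab_real) (use r(2) ib ib' q q_eq in auto)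
    also have "f (move p \<i> b) = f p"
    proof -
      (* The parameters t for which p + t b stays in the polydisc; both 0 and i belong to it. *)
      define T where "T = {t. move p t b \<in> ?P}"
      have T: "open T" "connected T" "0 \<in> T" "\<i> \<in> T"
        unfolding T_def using ib pP
        by (auto intro: open_move_line_vimage open_polydisc convex_connected convex_move_polydisc)
      have holT: "(\<lambda>t. f (move p t b) - f p) holomorphic_on T"
      proof (intro holomorphic_intros)
        have "holo n (?P \<inter> ?\<Omega>) f" by (rule holo_subset[OF hol]) auto
        hence "(\<lambda>t. f (move p t b)) holomorphic_on {t. move p t b \<in> ?P \<inter> ?\<Omega>}"
          by (rule holo_line[OF open_Int[OF open_polydisc open_regular_set] _ p(1) ab(2)])
        moreover have "T \<subseteq> {t. move p t b \<in> ?P \<inter> ?\<Omega>}"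
          unfolding T_def using subsetD[OF r(2)] hstar_move[OF p(1) ab(2)] by auto
        ultimately show "(\<lambda>t. f (move p t b)) holomorphic_on T" by (rule holomorphic_on_subset)
      qed
      have real0: "f (move p (of_real x) b) - f p = 0" if "complex_of_real x \<in> T" for x
      proof -
        have eq: "move p (of_real x) b = move p 1 (\<lambda>k. of_real x * b k)" by (simp add: move_def)
        have "(\<lambda>k. of_real x * b k) \<in> hstar n"
          using ab(2) by (auto simp: hstar_def sum_distrib_left[symmetric])
        moreover have "move p (of_real x) b \<in> ?\<Omega>"
          using that subsetD[OF r(2)] hstar_move[OF p(1) ab(2)] unfolding T_def by auto
        ultimately have "f (move p 1 (\<lambda>k. of_real x * b k)) = f p"
          by (intro step) (use p ab_real(2) eq in \<open>auto intro: Reals_mult\<close>)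
        thus ?thesis by (simp add: eq)
      qed
      have "f (move p \<i> b) - f p = 0"
      proof (rule analytic_continuation[OF holT T(1,2) _ T(3) _ _ T(4)])
        show "T \<inter> \<real> \<subseteq> T" by auto
        show "f (move p t b) - f p = 0" if "t \<in> T \<inter> \<real>" for t
          using that real0 by (auto elim!: Reals_cases)
        show "0 islimpt T \<inter> \<real>"
        proof (rule islimptI)
          fix S :: "complex set" assume S: "0 \<in> S" "open S"
          then obtain e where e: "e > 0" "ball 0 e \<subseteq> S \<inter> T"
            using T(1,3) open_contains_ball_eq[OF open_Int[OF S(2) T(1)]] by blast
          have "complex_of_real (e / 2) \<in> ball 0 e" using e by simp
          thus "\<exists>y\<in>T \<inter> \<real>. y \<in> S \<and> y \<noteq> 0"
            using e by (intro bexI[of _ "complex_of_real (e / 2)"]) auto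
        qed
      qed
      thus ?thesis by simp
    qed
    finally show ?thesis .
  qed
  thus ?thesis using mero_generically_const[OF f open_polydisc] pP p by blast
qed

text \<open>
  Kronecker's theorem for the irrational number \<open>\<gamma> / n\<close>.
\<close>

lemma dense_int_combinations:
  fixes \<gamma> x e :: real
  assumes "\<gamma> \<notin> \<rat>" "n \<ge> (1::nat)" "e > 0"
  shows "\<exists>a b :: int. \<bar>\<gamma> * of_int a + real n * of_int b - x\<bar> < e"
proof -
  have "\<gamma> / real n \<notin> \<rat>"
  proof
    assume "\<gamma> / real n \<in> \<rat>"
    hence "\<gamma> / real n * real n \<in> \<rat>" by (intro Rats_mult) auto
    thus False using assms by simp
  qed
  moreover have "0 \<le> frac (x / real n)" "frac (x / real n) \<le> 1" "0 < e / real n"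
    using assms frac_lt_1[of "x / real n"] by (auto simp: less_imp_le)
  ultimately obtain k :: nat where k: "\<bar>frac (real k * (\<gamma> / real n)) - frac (x / real n)\<bar> < e / real n"
    by (rule Kronecker_approx_1_explicit) blast
  define b where "b = \<lfloor>x / real n\<rfloor> - \<lfloor>real k * (\<gamma> / real n)\<rfloor>"
  have "\<gamma> * of_int (int k) + real n * of_int b - x = real n * (frac (real k * (\<gamma> / real n)) - frac (x / real n))"
    using assms by (simp add: frac_def b_def field_simps)
  also have "\<bar>\<dots>\<bar> = \<bar>frac (real k * (\<gamma> / real n)) - frac (x / real n)\<bar> * real n"
    by (simp only: abs_mult abs_of_nat mult.commute)
  also have "\<dots> < e" using k assms(2) by (subst (asm) pos_less_divide_eq) auto
  finally show ?thesis by blast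
qed

text \<open>
  The periods form a group which contains $\gamma(\omega_i-\omega_1)$ and $n(\omega_i-\omega_1)$. Since \<open>\<gamma>\<close> is
  irrational, the integer combinations of these vectors are dense among the real points.
\<close>

lemma mero_const_of_periods:
  assumes f: "mero n f" and n: "n \<ge> 1" and \<gamma>: "\<gamma> \<notin> \<rat>"
    and per_n: "\<And>i. i \<in> {1..n} \<Longrightarrow> generically n UNIV (\<lambda>p. f (move p (of_nat n) (omega n i)) = f p)"
    and per_\<gamma>: "\<And>i. i \<in> {1..n} \<Longrightarrow>
       generically n UNIV (\<lambda>p. f (move p (of_real \<gamma>) (omega n i)) = f (move p (of_real \<gamma>) (omega n 1)))"
  shows "\<exists>c. generically n UNIV (\<lambda>p. f p = c)"
proof -
  define Per where "Per = {v \<in> hstar n. generically n UNIV (\<lambda>p. f (move p 1 v) = f p)}"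
  have zero: "(\<lambda>_. 0) \<in> Per" by (auto simp: Per_def hstar_def move_def intro: generically_always)
  have add: "(\<lambda>k. v k + w k) \<in> Per" if "v \<in> Per" "w \<in> Per" for v w
  proof -
    have "generically n UNIV (\<lambda>p. f (move (move p 1 v) 1 w) = f (move p 1 v) \<and> f (move p 1 v) = f p)"
      using that by (intro generically_conj generically_translate[where P = "\<lambda>p. f (move p 1 w) = f p"]) (auto simp: Per_def)
    hence "generically n UNIV (\<lambda>p. f (move p 1 (\<lambda>k. v k + w k)) = f p)"
      by (rule generically_mono) (simp add: move_def add.assoc)
    moreover have "(\<lambda>k. v k + w k) \<in> hstar n" using that by (auto simp: Per_def hstar_def sum.distrib)
    ultimately show ?thesis by (simp add: Per_def)
  qed
  have neg: "(\<lambda>k. - v k) \<in> Per" if "v \<in> Per" for v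
  proof -
    have "generically n UNIV (\<lambda>p. f (move (move p (- 1) v) 1 v) = f (move p (- 1) v))"
      using that by (intro generically_translate[where P = "\<lambda>p. f (move p 1 v) = f p"]) (auto simp: Per_def)
    hence "generically n UNIV (\<lambda>p. f (move p 1 (\<lambda>k. - v k)) = f p)"
      by (rule generically_mono) (simp add: move_def)
    thus ?thesis using that by (auto simp: Per_def hstar_def sum_negf)
  qed
  have mult: "(\<lambda>k. of_int a * v k) \<in> Per" if "v \<in> Per" for v a
  proof (induction a rule: int_induct[where k = 0])
    case base
    show ?case using zero by simp
  next
    case (step1 i)
    from add[OF step1.IH that] show ?case by (simp add: algebra_simps)
  next
    case (step2 i)
    from add[OF step2.IH neg[OF that]] show ?case by (simp add: algebra_simps)
  qed
  define \<delta> where "\<delta> = (\<lambda>i k. omega n i k - omega n 1 k)"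
  have \<delta>: "(\<lambda>k. r * \<delta> i k) \<in> hstar n" if "i \<in> {1..n}" for i r
    using omega_in_hstar[OF that] omega_in_hstar[of 1 n] n
    by (auto simp: \<delta>_def hstar_def sum_subtractf sum_distrib_left[symmetric])
  have \<delta>_\<gamma>: "(\<lambda>k. of_real \<gamma> * \<delta> i k) \<in> Per" if i: "i \<in> {1..n}" for i
  proof -
    have "generically n UNIV (\<lambda>p. f (move (move p (- of_real \<gamma>) (omega n 1)) (of_real \<gamma>) (omega n i)) =
            f (move (move p (- of_real \<gamma>) (omega n 1)) (of_real \<gamma>) (omega n 1)))"
      by (rule generically_translate[OF per_\<gamma>[OF i] omega_in_hstar]) (use n in auto)
    hence "generically n UNIV (\<lambda>p. f (move p 1 (\<lambda>k. of_real \<gamma> * \<delta> i k)) = f p)"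
      by (rule generically_mono) (simp add: move_def \<delta>_def algebra_simps)
    thus ?thesis using \<delta>[OF i] by (simp add: Per_def)
  qed
  have \<delta>_n: "(\<lambda>k. of_nat n * \<delta> i k) \<in> Per" if i: "i \<in> {1..n}" for i
  proof -
    have per: "(\<lambda>k. of_nat n * omega n i k) \<in> Per" if "i \<in> {1..n}" for i
      using per_n[OF that] omega_in_hstar[OF that]
      by (auto simp: Per_def move_def hstar_def sum_distrib_left[symmetric])
    from add[OF per[OF i] neg[OF per[of 1]]] n show ?thesis by (simp add: \<delta>_def algebra_simps)
  qed
  have sum: "(\<lambda>k. \<Sum>i\<in>I. v i k) \<in> Per" if "finite I" "\<And>i. i \<in> I \<Longrightarrow> v i \<in> Per" for I and v :: "nat \<Rightarrow> hvec"
    using that by (induction I rule: finite_induct) (auto simp: zero add)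
  (* The k-th coordinate is r k for k > 1; the first one restores the sum zero. *)
  have \<delta>_sum: "(\<Sum>i=1..n. r i * \<delta> i k) = (if k \<in> {1..n} then r k - (if k = 1 then \<Sum>i=1..n. r i else 0) else 0)"
    for r :: "nat \<Rightarrow> complex" and k
  proof -
    have "r i * \<delta> i k = (if k \<in> {1..n} then (if i = k then r k else 0) - (if k = 1 then r i else 0) else 0)" for i
      by (auto simp: \<delta>_def omega_def)
    thus ?thesis by (auto simp: sum_subtractf)
  qed
  show ?thesis
  proof (rule mero_const_of_dense_real_periods[OF f])
    fix v :: hvec and e :: real
    assume v: "v \<in> hstar n" "\<And>k. v k \<in> \<real>" and e: "e > 0"
    have "\<exists>a b :: int. \<bar>\<gamma> * of_int a + real n * of_int b - Re (v i)\<bar> < e / (2 * real n)" for i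
      by (rule dense_int_combinations) (use \<gamma> n e in auto)
    then obtain a b :: "nat \<Rightarrow> int" where ab: "\<And>i. \<bar>\<gamma> * of_int (a i) + real n * of_int (b i) - Re (v i)\<bar> < e / (2 * real n)"
      by metis
    define r where "r = (\<lambda>i. complex_of_real \<gamma> * of_int (a i) + of_nat n * of_int (b i))"
    have r: "norm (v i - r i) < e / (2 * real n)" for i
    proof -
      have "v i - r i = of_real (Re (v i) - (\<gamma> * of_int (a i) + real n * of_int (b i)))"
        using v(2)[of i] by (auto simp: r_def elim!: Reals_cases)
      thus ?thesis using ab[of i] by (simp only: norm_of_real abs_minus_commute)
    qed
    define v' where "v' = (\<lambda>k. \<Sum>i=1..n. r i * \<delta> i k)"
    have "(\<lambda>k. r i * \<delta> i k) \<in> Per" if "i \<in> {1..n}" for i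
      using add[OF mult[OF \<delta>_\<gamma>[OF that], of "a i"] mult[OF \<delta>_n[OF that], of "b i"]]
      by (simp add: r_def algebra_simps)
    hence "v' \<in> Per" unfolding v'_def by (intro sum) auto
    moreover have "dist (v k) (v' k) < e" for k
    proof (cases "k \<in> {1..n}")
      case True
      have "(\<Sum>i=1..n. v i) = 0" using v(1) unfolding hstar_def by blast
      hence v_r: "(\<Sum>i=1..n. v i - r i) = - (\<Sum>i=1..n. r i)" by (simp only: sum_subtractf) simp
      have "v k - v' k = (v k - r k) - (if k = 1 then \<Sum>i=1..n. v i - r i else 0)"
        unfolding v'_def \<delta>_sum v_r using True by simp
      also have "norm \<dots> \<le> norm (v k - r k) + (\<Sum>i=1..n. norm (v i - r i))"
        by (intro order_trans[OF norm_triangle_ineq4] add_left_mono) (auto intro: norm_sum sum_nonneg)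
      also have "\<dots> < e / 2 + (\<Sum>i=1..n. e / (2 * real n))"
      proof (rule add_less_le_mono)
        have "e / (2 * real n) \<le> e / 2" using n e by (simp add: field_simps)
        thus "norm (v k - r k) < e / 2" using r[of k] by linarith
        show "(\<Sum>i=1..n. norm (v i - r i)) \<le> (\<Sum>i=1..n. e / (2 * real n))"
          by (intro sum_mono less_imp_le r)
      qed
      also have "\<dots> = e" using n by simp
      finally show ?thesis by (simp add: dist_norm)
    next
      case False
      thus ?thesis using e v(1) unfolding v'_def \<delta>_sum by (auto simp: hstar_def)
    qed
    ultimately show "\<exists>v'\<in>hstar n. (\<forall>k. dist (v k) (v' k) < e) \<and> generically n UNIV (\<lambda>p. f (move p 1 v') = f p)"
      by (auto simp: Per_def)
  qed
qed

text \<open>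
  Moving \<open>p\<close> in the direction $\omega_j-\omega_i$ changes $p_j-p_i$, and the zeros of a non-zero
  holomorphic function are isolated.
\<close>

lemma generically_theta_regular:
  assumes "Im \<tau> > 0"
  shows "generically n UNIV (theta_regular n \<tau>)"
proof -
  have "generically n UNIV (\<lambda>p. theta 0 0 ((1 + \<tau>) / 2 + p j - p i) \<tau> \<noteq> 0)"
    if ij: "i \<in> {1..n}" "j \<in> {1..n}" "i \<noteq> j" for i j
  proof (rule genericallyI)
    let ?f = "\<lambda>p. theta 0 0 ((1 + \<tau>) / 2 + p j - p i) \<tau>"
    have "continuous_on UNIV (\<lambda>t. theta 0 0 t \<tau>)"
      by (rule holomorphic_on_imp_continuous_on[OF theta_holomorphic[OF assms]])
    hence "continuous_on UNIV ?f"
      by (rule continuous_on_compose2)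
         (auto intro!: continuous_intros continuous_on_product_coordinates)
    hence "open (?f -` (- {0}))" by (intro open_vimage) auto
    thus "open {p. ?f p \<noteq> 0}" by (simp add: vimage_def)
    fix D assume D: "open D" "D \<inter> UNIV \<inter> hstar n \<noteq> {}"
    then obtain p where p: "p \<in> D" "p \<in> hstar n" by auto
    define d where "d = (\<lambda>k. omega n j k - omega n i k)"
    have d: "d \<in> hstar n" "d j = 1" "d i = - 1"
      using hstar_diff[OF omega_in_hstar[OF ij(1)] omega_in_hstar[OF ij(2)]] ij by (auto simp: d_def omega_def)
    have "\<forall>\<^sub>F t in at 0. theta 0 0 (2 * t + ((1 + \<tau>) / 2 + p j - p i)) \<tau> \<noteq> 0"
      by (rule theta_affine_eventually_nonzero[OF assms]) auto
    moreover have "\<forall>\<^sub>F t in at 0. move p t d \<in> D"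
      using eventually_move_in_open[OF D(1) p(1), of d] by (simp add: eventually_nhds_conv_at)
    ultimately have "\<forall>\<^sub>F t in at 0. theta 0 0 (2 * t + ((1 + \<tau>) / 2 + p j - p i)) \<tau> \<noteq> 0 \<and> move p t d \<in> D"
      by (rule eventually_conj)
    then obtain t where t: "theta 0 0 (2 * t + ((1 + \<tau>) / 2 + p j - p i)) \<tau> \<noteq> 0" "move p t d \<in> D"
      using eventually_happens by fastforce
    have "move p t d \<in> D \<inter> {p. ?f p \<noteq> 0} \<inter> UNIV \<inter> hstar n"
      using t p d hstar_move by (auto simp: move_def algebra_simps)
    thus "D \<inter> {p. ?f p \<noteq> 0} \<inter> UNIV \<inter> hstar n \<noteq> {}" by blast
  qed auto
  note pair = this
  have "generically n UNIV (\<lambda>p. i \<noteq> j \<longrightarrow> theta 0 0 ((1 + \<tau>) / 2 + p j - p i) \<tau> \<noteq> 0)"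
    if "i \<in> {1..n}" "j \<in> {1..n}" for i j
  proof (cases "i = j")
    case False
    from pair[OF that False] show ?thesis by (rule generically_mono) simp
  qed (auto intro: generically_always)
  thus ?thesis unfolding theta_regular_def by (intro generically_ball_finite finite_atLeastAtMost)
qed

section \<open>Coordinates on finite-dimensional spaces\<close>

lemma linear_map_add: "Vector_Spaces.linear s s' f \<Longrightarrow> f (x + y) = f x + f y"
  by (simp add: Vector_Spaces.linear_iff)

lemma linear_map_scale: "Vector_Spaces.linear s s' f \<Longrightarrow> f (s c x) = s' c (f x)"
  by (simp add: Vector_Spaces.linear_iff)

lemma linear_map_zero: "Vector_Spaces.linear s s' f \<Longrightarrow> f 0 = 0"
  using linear_map_add[of s s' f 0 0] by simp

lemma linear_map_sum: "Vector_Spaces.linear s s' f \<Longrightarrow> f (\<Sum>i\<in>I. g i) = (\<Sum>i\<in>I. f (g i))"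
  by (induction I rule: infinite_finite_induct) (auto simp: linear_map_zero linear_map_add)

lemma functional_compose:
  "functional s' f \<Longrightarrow> Vector_Spaces.linear s s' \<phi> \<Longrightarrow> functional s (\<lambda>v. f (\<phi> v))"
  unfolding functional_def by (simp add: Vector_Spaces.linear_iff)

lemma functional_diff: "functional s f \<Longrightarrow> functional s g \<Longrightarrow> functional s (\<lambda>v. f v - g v)"
  unfolding functional_def by (simp add: Vector_Spaces.linear_iff algebra_simps)

lemma fin_dim_coordinates:
  fixes s :: "'v::ab_group_add scaling"
  assumes "fin_dim s"
  obtains B and r :: "'v \<Rightarrow> 'v \<Rightarrow> complex"
  where "finite B" "\<And>b. functional s (r b)" "\<And>v. (\<Sum>b\<in>B. s (r b v) b) = v"
proof -
  obtain B where "finite_dimensional_vector_space s B" using assms unfolding fin_dim_def by blast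
  then interpret finite_dimensional_vector_space s B .
  show ?thesis
  proof (rule that[of B "\<lambda>b v. representation B v b"])
    show "functional s (\<lambda>v. representation B v b)" for b
      unfolding functional_def by (rule linear_representation[OF independent_Basis span_Basis])
    show "(\<Sum>b\<in>B. s (representation B v b) b) = v" for v
      by (rule sum_representation_eq) (use independent_Basis span_Basis finite_Basis in auto)
  qed (rule finite_Basis)
qed

lemma linear_map_coordinates:
  assumes "Vector_Spaces.linear s s' f" "(\<Sum>b\<in>B. s (r b v) b) = v"
  shows "f v = (\<Sum>b\<in>B. s' (r b v) (f b))"
  using linear_map_sum[OF assms(1), of "\<lambda>b. s (r b v) b" B] assms(2) linear_map_scale[OF assms(1)] by simp

lemma functional_coordinates:
  assumes "functional s f" "(\<Sum>b\<in>B. s (r b v) b) = v"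
  shows "f v = (\<Sum>b\<in>B. r b v * f b)"
  using linear_map_coordinates[where r = r and B = B, OF assms(1)[unfolded functional_def] assms(2)] .

section \<open>Singularities in the spectral parameter\<close>

lemma eventually_cosparse_shift:
  fixes c :: complex
  assumes "eventually P (cosparse UNIV)"
  shows "eventually (\<lambda>z. P (z + c)) (cosparse UNIV)"
proof -
  have "eventually (\<lambda>z. P (z + c)) (at x)" for x
  proof -
    have "eventually P (at (x - (- c)))"
      using assms by (simp add: eventually_cosparse_open_eq)
    hence "eventually P (filtermap (\<lambda>z. z - (- c)) (at x))" by (simp only: filtermap_at_shift)
    thus ?thesis by (simp add: eventually_filtermap)
  qed
  thus ?thesis by (simp add: eventually_cosparse_open_eq)
qed

lemma eventually_theta_nonzero:
  assumes "Im \<tau> > 0"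
  shows "\<forall>\<^sub>\<approx>z. theta 0 0 (z + b) \<tau> \<noteq> 0"
  using theta_affine_eventually_nonzero[OF assms, of 1 0 b] by (simp add: eventually_cosparse_open_eq)

text \<open>
  All matrix coefficients have a finite limit at \<open>\<zeta>\<close>. A limit, rather than analyticity, is the right notion
  here: the values of \<open>L\<close> on a sparse set are arbitrary.
\<close>

definition regular_at :: "nat \<Rightarrow> 'v::ab_group_add scaling \<Rightarrow> (complex \<Rightarrow> 'v Lmat) \<Rightarrow> complex \<Rightarrow> bool" where
  "regular_at n s L \<zeta> \<longleftrightarrow>
     (\<forall>i\<in>{1..n}. \<forall>j\<in>{1..n}. \<forall>v f. functional s f \<longrightarrow> (\<exists>a. (\<lambda>z. f (L z i j v)) \<midarrow>\<zeta>\<rightarrow> a))"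

lemma eventually_regular_at:
  assumes "fin_dim s" "mero_Lmat n s L"
  shows "eventually (regular_at n s L) (cosparse UNIV)"
proof -
  obtain B r where B: "finite B" "\<And>b. functional s (r b)" "\<And>v. (\<Sum>b\<in>B. s (r b v) b) = v"
    using fin_dim_coordinates[OF assms(1)] by metis
  have lin: "Vector_Spaces.linear s s (L z i j)" if "i \<in> {1..n}" "j \<in> {1..n}" for z i j
    using assms(2) that unfolding mero_Lmat_def by blast
  have "\<forall>\<^sub>\<approx>\<zeta>. \<exists>a. (\<lambda>z. r b (L z i j d)) \<midarrow>\<zeta>\<rightarrow> a" if "i \<in> {1..n}" "j \<in> {1..n}" for i j b d
  proof -
    have "(\<lambda>z. r b (L z i j d)) meromorphic_on UNIV"
      using assms(2) that B(2) unfolding mero_Lmat_def by blast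
    hence "\<forall>\<^sub>\<approx>\<zeta>. (\<lambda>z. r b (L z i j d)) analytic_on {\<zeta>}"
      by (rule meromorphic_on_imp_analytic_cosparse)
    thus ?thesis
      by (rule eventually_mono) (use analytic_at_imp_isCont isCont_def in blast)
  qed
  hence "\<forall>\<^sub>\<approx>\<zeta>. \<forall>i\<in>{1..n}. \<forall>j\<in>{1..n}. \<forall>b\<in>B. \<forall>d\<in>B. \<exists>a. (\<lambda>z. r b (L z i j d)) \<midarrow>\<zeta>\<rightarrow> a"
    by (intro eventually_ball_finite ballI B finite_atLeastAtMost)
  thus ?thesis
  proof (rule eventually_mono)
    fix \<zeta> assume *: "\<forall>i\<in>{1..n}. \<forall>j\<in>{1..n}. \<forall>b\<in>B. \<forall>d\<in>B. \<exists>a. (\<lambda>z. r b (L z i j d)) \<midarrow>\<zeta>\<rightarrow> a"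
    show "regular_at n s L \<zeta>"
      unfolding regular_at_def
    proof (intro ballI allI impI)
      fix i j v f assume ij: "i \<in> {1..n}" "j \<in> {1..n}" and f: "functional s f"
      have eq: "f (L z i j v) = (\<Sum>d\<in>B. r d v * (\<Sum>b\<in>B. r b (L z i j d) * f b))" for z
      proof -
        have "f (L z i j v) = (\<Sum>d\<in>B. r d v * f (L z i j d))"
          by (rule functional_coordinates[where r = r, OF functional_compose[OF f lin[OF ij]] B(3)])
        also have "\<dots> = (\<Sum>d\<in>B. r d v * (\<Sum>b\<in>B. r b (L z i j d) * f b))"
          by (intro sum.cong refl arg_cong2[where f = "(*)"] functional_coordinates[where r = r, OF f B(3)])
        finally show ?thesis .
      qed
      obtain a where a: "\<And>b d. b \<in> B \<Longrightarrow> d \<in> B \<Longrightarrow> (\<lambda>z. r b (L z i j d)) \<midarrow>\<zeta>\<rightarrow> a b d"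
        using * ij by metis
      have "(\<lambda>z. \<Sum>d\<in>B. r d v * (\<Sum>b\<in>B. r b (L z i j d) * f b)) \<midarrow>\<zeta>\<rightarrow> (\<Sum>d\<in>B. r d v * (\<Sum>b\<in>B. a b d * f b))"
        by (intro tendsto_sum tendsto_mult tendsto_const a)
      thus "\<exists>a. (\<lambda>z. f (L z i j v)) \<midarrow>\<zeta>\<rightarrow> a" unfolding eq by blast
    qed
  qed
qed

lemma regular_at_shift:
  assumes eq: "\<forall>\<^sub>\<approx>z. \<forall>i\<in>{1..n}. \<forall>j\<in>{1..n}. L (z + c) i j = L z i j"
  shows "regular_at n s L (\<zeta> + c) \<longleftrightarrow> regular_at n s L \<zeta>"
proof -
  have "((\<lambda>z. f (L z i j v)) \<midarrow>\<zeta> + c\<rightarrow> a) \<longleftrightarrow> ((\<lambda>z. f (L z i j v)) \<midarrow>\<zeta>\<rightarrow> a)"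
    if "i \<in> {1..n}" "j \<in> {1..n}" for i j v f and a :: complex
  proof -
    have "((\<lambda>z. f (L z i j v)) \<midarrow>\<zeta> + c\<rightarrow> a) \<longleftrightarrow> filterlim (\<lambda>z. f (L z i j v)) (nhds a) (filtermap (\<lambda>z. z - (- c)) (at \<zeta>))"
      unfolding filtermap_at_shift by simp
    also have "\<dots> \<longleftrightarrow> ((\<lambda>z. f (L (z + c) i j v)) \<midarrow>\<zeta>\<rightarrow> a)"
      by (simp add: filterlim_filtermap)
    also have "\<dots> \<longleftrightarrow> ((\<lambda>z. f (L z i j v)) \<midarrow>\<zeta>\<rightarrow> a)"
    proof (rule filterlim_cong[OF refl refl])
      have "\<forall>\<^sub>F z in at \<zeta>. \<forall>i\<in>{1..n}. \<forall>j\<in>{1..n}. L (z + c) i j = L z i j"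
        using eq by (simp add: eventually_cosparse_open_eq)
      thus "\<forall>\<^sub>F z in at \<zeta>. f (L (z + c) i j v) = f (L z i j v)"
        by (rule eventually_mono) (use that in simp)
    qed
    finally show ?thesis .
  qed
  thus ?thesis unfolding regular_at_def by simp
qed

lemma lattice_coordinates:
  assumes "Im \<tau> \<noteq> 0"
  shows "z = of_real (Re z - Im z / Im \<tau> * Re \<tau>) + of_real (Im z / Im \<tau>) * \<tau>"
  using assms by (simp add: complex_eq_iff)

text \<open>
  Singularities are isolated and periodic under $n\mathbb{Z}+n\tau\mathbb{Z}$, hence each of them is congruent to one
  in a compact fundamental domain.
\<close>

lemma finite_irregular:
  assumes n: "n \<ge> 1" and \<tau>: "Im \<tau> > 0" and L: "fin_dim s" "mero_Lmat n s L"
    and per: "\<forall>\<^sub>\<approx>z. \<forall>i\<in>{1..n}. \<forall>j\<in>{1..n}. L (z + of_nat n) i j = L z i j"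
      "\<forall>\<^sub>\<approx>z. \<forall>i\<in>{1..n}. \<forall>j\<in>{1..n}. L (z + of_nat n * \<tau>) i j = L z i j"
  obtains P where "finite P" "\<And>\<zeta>. (\<And>p. p \<in> P \<Longrightarrow> \<zeta> - p \<notin> lattice \<tau>) \<Longrightarrow> regular_at n s L \<zeta>"
proof -
  let ?reg = "regular_at n s L"
  have int_shift: "?reg (\<zeta> + of_int a * c) \<longleftrightarrow> ?reg \<zeta>" if "\<And>\<zeta>. ?reg (\<zeta> + c) \<longleftrightarrow> ?reg \<zeta>" for \<zeta> c a
  proof (induction a rule: int_induct[where k = 0])
    case (step1 i)
    thus ?case using that[of "\<zeta> + of_int i * c"] by (simp add: algebra_simps)
  next
    case (step2 i)
    thus ?case using that[of "\<zeta> + of_int (i - 1) * c"] by (simp add: algebra_simps)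
  qed simp
  define K where "K = (\<lambda>(x, y). complex_of_real x + of_real y * \<tau>) ` ({0..real n} \<times> {0..real n})"
  have "compact K" unfolding K_def
    by (intro compact_continuous_image compact_Times compact_Icc)
       (auto simp: case_prod_unfold intro!: continuous_intros)
  have "{\<zeta>. \<not> ?reg \<zeta>} sparse_in UNIV"
    using eventually_regular_at[OF L] by (simp add: eventually_cosparse)
  hence "{\<zeta>. \<not> ?reg \<zeta>} sparse_in K" by (rule sparse_in_subset) auto
  hence fin: "finite (K \<inter> {\<zeta>. \<not> ?reg \<zeta>})"
    using \<open>compact K\<close> by (intro sparse_in_compact_finite)
  show ?thesis
  proof (rule that[OF fin], rule ccontr)
    fix \<zeta> assume *: "\<And>p. p \<in> K \<inter> {\<zeta>. \<not> ?reg \<zeta>} \<Longrightarrow> \<zeta> - p \<notin> lattice \<tau>" and irr: "\<not> ?reg \<zeta>"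
    define y where "y = Im \<zeta> / Im \<tau>"
    define x where "x = Re \<zeta> - y * Re \<tau>"
    have \<zeta>: "\<zeta> = of_real x + of_real y * \<tau>"
      unfolding x_def y_def using lattice_coordinates[of \<tau> \<zeta>] \<tau> by simp
    define a b where "a = \<lfloor>x / real n\<rfloor>" and "b = \<lfloor>y / real n\<rfloor>"
    have bounds: "0 \<le> x - real n * of_int \<lfloor>x / real n\<rfloor> \<and> x - real n * of_int \<lfloor>x / real n\<rfloor> \<le> real n" for x
    proof -
      have "of_int \<lfloor>x / real n\<rfloor> * real n \<le> x" "x < (of_int \<lfloor>x / real n\<rfloor> + 1) * real n"
        using n by (intro floor_divide_lower floor_divide_upper; simp)+
      thus ?thesis by (simp add: algebra_simps)
    qed
    define p where "p = of_real (x - real n * of_int a) + of_real (y - real n * of_int b) * \<tau>"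
    have "p \<in> K" unfolding K_def p_def a_def b_def
      by (rule image_eqI[of _ _ "(x - real n * of_int \<lfloor>x / real n\<rfloor>, y - real n * of_int \<lfloor>y / real n\<rfloor>)"])
         (use bounds in \<open>simp_all del: of_real_diff\<close>)
    have \<zeta>_p: "\<zeta> = p + of_int a * of_nat n + of_int b * (of_nat n * \<tau>)"
      unfolding \<zeta> p_def by (simp add: algebra_simps)
    have "?reg \<zeta> \<longleftrightarrow> ?reg p"
      unfolding \<zeta>_p using int_shift[OF regular_at_shift[OF per(1)]] int_shift[OF regular_at_shift[OF per(2)]] by simp
    hence "p \<in> K \<inter> {\<zeta>. \<not> ?reg \<zeta>}" using irr \<open>p \<in> K\<close> by auto
    moreover have "\<zeta> - p \<in> lattice \<tau>"
    proof -
      have "\<zeta> - p = of_int (a * int n) + of_int (b * int n) * \<tau>" by (simp add: \<zeta>_p)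
      thus ?thesis unfolding lattice_def by blast
    qed
    ultimately show False using * by blast
  qed
qed

lemma Lmat_inverse_unique:
  fixes M :: "'v::ab_group_add Lmat"
  assumes "Lmat_inverse n M K" "Lmat_inverse n M' K'"
    and eq: "\<And>i j. i \<in> {1..n} \<Longrightarrow> j \<in> {1..n} \<Longrightarrow> M' i j = M i j"
    and lin: "\<And>i j. i \<in> {1..n} \<Longrightarrow> j \<in> {1..n} \<Longrightarrow> Vector_Spaces.linear s s (K' i j)"
    and ij: "i \<in> {1..n}" "j \<in> {1..n}"
  shows "K' i j = K i j"
proof
  fix v
  have "K' i j v = (\<Sum>m=1..n. if m = j then K' i j v else 0)" using ij by simp
  also have "\<dots> = (\<Sum>m=1..n. K' i m (\<Sum>l=1..n. M m l (K l j v)))"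
  proof (intro sum.cong refl)
    fix m assume m: "m \<in> {1..n}"
    have "(\<Sum>l=1..n. M m l (K l j v)) = (if m = j then v else 0)"
      using assms(1) m ij unfolding Lmat_inverse_def by blast
    thus "(if m = j then K' i j v else 0) = K' i m (\<Sum>l=1..n. M m l (K l j v))"
      using linear_map_zero[OF lin[OF ij(1) m]] by simp
  qed
  also have "\<dots> = (\<Sum>l=1..n. \<Sum>m=1..n. K' i m (M' m l (K l j v)))"
    using ij eq by (subst sum.swap) (auto intro!: sum.cong simp: linear_map_sum[OF lin])
  also have "\<dots> = (\<Sum>l=1..n. if i = l then K l j v else 0)"
    using assms(2) ij unfolding Lmat_inverse_def by (intro sum.cong refl) blast
  also have "\<dots> = K i j v" using ij by simp
  finally show "K' i j v = K i j v" .
qed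

lemma Lmat_inverse_periodic:
  assumes K: "mero_Lmat n s K" "\<forall>\<^sub>\<approx>z. Lmat_inverse n (L z) (K z)"
    and per: "\<forall>\<^sub>\<approx>z. \<forall>i\<in>{1..n}. \<forall>j\<in>{1..n}. L (z + c) i j = L z i j"
  shows "\<forall>\<^sub>\<approx>z. \<forall>i\<in>{1..n}. \<forall>j\<in>{1..n}. K (z + c) i j = K z i j"
proof -
  have "\<forall>\<^sub>\<approx>z. Lmat_inverse n (L (z + c)) (K (z + c))"
    by (rule eventually_cosparse_shift[OF K(2)])
  with K(2) per show ?thesis
  proof eventually_elim
    case (elim z)
    have "Vector_Spaces.linear s s (K (z + c) i j)" if "i \<in> {1..n}" "j \<in> {1..n}" for i j
      using K(1) that unfolding mero_Lmat_def by blast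
    thus ?case using Lmat_inverse_unique[OF elim(1,3)] elim(2) by blast
  qed
qed

text \<open>
  The inverse \<open>K\<close> of \<open>L\<close> inherits the periods of \<open>L\<close>, so its singularities are finite in number modulo the
  lattice as well. They must be avoided too, because the limit of \<open>L\<close> at a point has to be invertible.
\<close>

lemma CB_object_regular:
  assumes n: "n \<ge> 1" and \<tau>: "Im \<tau> > 0" and L: "CB_object n \<tau> R s L"
  obtains K P where "mero_Lmat n s K" "\<forall>\<^sub>\<approx>z. Lmat_inverse n (L z) (K z)" "finite P"
    "\<forall>\<zeta>. (\<forall>p\<in>P. \<zeta> - p \<notin> lattice \<tau>) \<longrightarrow> regular_at n s L \<zeta> \<and> regular_at n s K \<zeta>"
proof -
  have L': "fin_dim s" "mero_Lmat n s L" using L unfolding CB_object_def by auto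
  obtain K where K: "mero_Lmat n s K" "\<forall>\<^sub>\<approx>z. Lmat_inverse n (L z) (K z)"
    using L unfolding CB_object_def by blast
  have "\<forall>\<^sub>\<approx>z. \<forall>i\<in>{1..n}. \<forall>j\<in>{1..n}. L (z + of_nat n) i j = L z i j \<and> L (z + of_nat n * \<tau>) i j = L z i j"
    using L unfolding CB_object_def by blast
  hence per: "\<forall>\<^sub>\<approx>z. \<forall>i\<in>{1..n}. \<forall>j\<in>{1..n}. L (z + of_nat n) i j = L z i j"
    "\<forall>\<^sub>\<approx>z. \<forall>i\<in>{1..n}. \<forall>j\<in>{1..n}. L (z + of_nat n * \<tau>) i j = L z i j"
    by (auto elim!: eventually_mono)
  obtain P where P: "finite P" "\<And>\<zeta>. (\<And>p. p \<in> P \<Longrightarrow> \<zeta> - p \<notin> lattice \<tau>) \<Longrightarrow> regular_at n s L \<zeta>"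
    using finite_irregular[OF n \<tau> L' per] by blast
  obtain P' where P': "finite P'" "\<And>\<zeta>. (\<And>p. p \<in> P' \<Longrightarrow> \<zeta> - p \<notin> lattice \<tau>) \<Longrightarrow> regular_at n s K \<zeta>"
    using finite_irregular[OF n \<tau> L'(1) K(1) Lmat_inverse_periodic[OF K per(1)] Lmat_inverse_periodic[OF K per(2)]]
    by blast
  show ?thesis
    by (rule that[OF K, of "P \<union> P'"]) (use P P' in auto)
qed

section \<open>Generically constant representatives\<close>

lemma M_hstar_generically_const:
  assumes "generically n UNIV (\<lambda>p. f p = c)"
  shows "f \<in> M_hstar n"
proof -
  have holo_const: "holo n UNIV (\<lambda>_. a)" for a
    by (simp add: holo_def field_differentiable_const)
  have "mero n f"
    unfolding mero_def
  proof
    fix p :: hvec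
    have "open (UNIV :: hvec set) \<and> p \<in> UNIV \<and> holo n UNIV (\<lambda>_. c) \<and> holo n UNIV (\<lambda>_. 1) \<and>
          generically n UNIV (\<lambda>q. (1::complex) \<noteq> 0 \<and> f q = c / 1)"
      using assms holo_const by simp
    thus "\<exists>U g h. open U \<and> p \<in> U \<and> holo n U g \<and> holo n U h \<and> generically n U (\<lambda>q. h q \<noteq> 0 \<and> f q = g q / h q)"
      by blast
  qed
  moreover have "generically n UNIV (\<lambda>p. f (move p (of_nat n) (omega n i)) = f p)" if "i \<in> {1..n}" for i
    using generically_conj[OF generically_translate[OF assms omega_in_hstar[OF that], of "of_nat n"] assms]
    by (rule generically_mono) simp
  ultimately show ?thesis by (simp add: M_hstar_def)
qed

lemma M_Hom_generically_const:
  assumes "\<And>p. p \<in> hstar n \<Longrightarrow> Vector_Spaces.linear s s' (\<phi> p)"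
    and "generically n UNIV (\<lambda>p. \<phi> p = \<phi>\<^sub>0)"
  shows "\<phi> \<in> M_Hom n s s'"
proof -
  have "(\<lambda>p. f (\<phi> p v)) \<in> M_hstar n" for f v
    by (rule M_hstar_generically_const[of _ _ "f (\<phi>\<^sub>0 v)"]) (rule generically_mono[OF assms(2)], simp)
  thus ?thesis using assms(1) by (simp add: M_Hom_def V_hstar_def)
qed

lemma const_in_V_hstar: "(\<lambda>_. v) \<in> V_hstar n s"
  unfolding V_hstar_def by (auto intro!: M_hstar_generically_const generically_always)

section \<open>The intertwining relation row by row\<close>

lemma H_obj_apply:
  "H_obj n \<tau> \<gamma> c x s L z F i p =
     (\<Sum>j=1..n. s (S_mat n \<tau> (z - x) p i j)
        (\<Sum>k=1..n. s (mat_inv {1..n} (S_mat n \<tau> (z - x - c) (move p (- of_real \<gamma>) (omega n j))) j k)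
           (\<Sum>m=1..n. L z k m (F m (move p (- of_real \<gamma>) (omega n j))))))"
  by (simp add: H_obj_def mult1_def exp_shift_def mult12_def)

lemma mat_left_inverse_kernel:
  fixes n :: nat
  assumes "mat_eq {1..n} (mat_mul {1..n} N M) mat_one"
    and "\<And>i. i \<in> {1..n} \<Longrightarrow> (\<Sum>j=1..n. M i j * y j) = 0" and k: "k \<in> {1..n}"
  shows "y k = 0"
proof -
  have "y k = (\<Sum>j=1..n. if j = k then y j else 0)" using k by simp
  also have "\<dots> = (\<Sum>j=1..n. mat_mul {1..n} N M k j * y j)"
  proof (intro sum.cong refl)
    fix j assume "j \<in> {1..n}"
    hence "mat_mul {1..n} N M k j = mat_one k j" using assms(1) k unfolding mat_eq_def by blast
    thus "(if j = k then y j else 0) = mat_mul {1..n} N M k j * y j" by (simp add: mat_one_def)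
  qed
  also have "\<dots> = (\<Sum>i=1..n. N k i * (\<Sum>j=1..n. M i j * y j))"
    unfolding mat_mul_def sum_distrib_left sum_distrib_right by (subst sum.swap) (simp add: mult.assoc)
  also have "\<dots> = 0" using assms(2) by (intro sum.neutral) simp
  finally show ?thesis .
qed

text \<open>
  Test the intertwining relation on the vectors that are constant in \<open>\<lambda>\<close>, with the single entry \<open>v\<close> at the
  position \<open>l\<close>. Both sides have the form $\sum_jS_{ij}(z-x,\lambda)\,y_j$, and \<open>S(z - x, \<lambda>)\<close> is invertible for
  generic \<open>\<lambda>\<close>, so the shifts in the different directions $\omega_j$ can be separated. Finally
  $\lambda=q+\gamma\omega_j$ is substituted.
\<close>

lemma intertwiner_row:
  assumes n: "n \<ge> 1" and \<tau>: "Im \<tau> > 0" and \<phi>: "\<phi> \<in> M_Hom n s s'"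
    and L: "\<And>i j. i \<in> {1..n} \<Longrightarrow> j \<in> {1..n} \<Longrightarrow> Vector_Spaces.linear s s (L z i j)"
    and L': "\<And>i j. i \<in> {1..n} \<Longrightarrow> j \<in> {1..n} \<Longrightarrow> Vector_Spaces.linear s' s' (L' z i j)"
    and eq: "\<And>F i. \<forall>j\<in>{1..n}. F j \<in> V_hstar n s \<Longrightarrow> i \<in> {1..n} \<Longrightarrow> generically n UNIV
       (\<lambda>p. \<phi> p (H_obj n \<tau> \<gamma> c x s L z F i p) = H_obj n \<tau> \<gamma> c x s' L' z (\<lambda>j q. \<phi> q (F j q)) i p)"
    and z: "theta 0 0 (z - x - of_nat n * ((1 + \<tau>) / 2) + (1 + \<tau>) / 2) \<tau> \<noteq> 0"
    and j: "j \<in> {1..n}" and l: "l \<in> {1..n}" and f: "functional s' f"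
  shows "generically n UNIV (\<lambda>q. (\<Sum>k=1..n. mat_inv {1..n} (S_mat n \<tau> (z - x - c) q) j k *
            (f (\<phi> (move q (of_real \<gamma>) (omega n j)) (L z k l v)) - f (L' z k l (\<phi> q v)))) = 0)"
proof -
  define F where "F = (\<lambda>m (_::hvec). if m = l then v else 0)"
  define P where "P = (\<lambda>p j. move p (- of_real \<gamma>) (omega n j))"
  define N where "N = (\<lambda>p j k. mat_inv {1..n} (S_mat n \<tau> (z - x - c) (P p j)) j k)"
  define y where "y = (\<lambda>p j. \<Sum>k=1..n. N p j k * (f (\<phi> p (L z k l v)) - f (L' z k l (\<phi> (P p j) v))))"
  have lin_\<phi>: "Vector_Spaces.linear s s' (\<phi> p)" if "p \<in> hstar n" for p
    using \<phi> that unfolding M_Hom_def by blast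
  have P: "P p j \<in> hstar n" if "p \<in> hstar n" "j \<in> {1..n}" for p j
    unfolding P_def using that by (intro hstar_move omega_in_hstar)
  have f_lin: "Vector_Spaces.linear s' (*) f" using f unfolding functional_def .
  have FV: "\<forall>j\<in>{1..n}. F j \<in> V_hstar n s" by (simp add: F_def const_in_V_hstar)
  have "generically n UNIV (\<lambda>p. theta_regular n \<tau> p \<and> (\<forall>i\<in>{1..n}.
          \<phi> p (H_obj n \<tau> \<gamma> c x s L z F i p) = H_obj n \<tau> \<gamma> c x s' L' z (\<lambda>j q. \<phi> q (F j q)) i p))"
    by (intro generically_conj generically_theta_regular[OF \<tau>] generically_ball_finite eq[OF FV] finite_atLeastAtMost)
  hence "generically n UNIV (\<lambda>p. y p j = 0)"
  proof (rule generically_mono)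
    fix p assume p: "p \<in> hstar n" and *: "theta_regular n \<tau> p \<and> (\<forall>i\<in>{1..n}.
          \<phi> p (H_obj n \<tau> \<gamma> c x s L z F i p) = H_obj n \<tau> \<gamma> c x s' L' z (\<lambda>j q. \<phi> q (F j q)) i p)"
    have inv: "mat_eq {1..n} (mat_mul {1..n} (mat_inv {1..n} (S_mat n \<tau> (z - x) p)) (S_mat n \<tau> (z - x) p)) mat_one"
      by (rule S_mat_inverse(2)[OF n \<tau> p _ z]) (use * in blast)
    have "(\<Sum>j=1..n. S_mat n \<tau> (z - x) p i j * y p j) = 0" if i: "i \<in> {1..n}" for i
    proof -
      have LF: "(\<Sum>m=1..n. L z k m (F m q)) = L z k l v" if k: "k \<in> {1..n}" for k q
      proof -
        have "(\<Sum>m=1..n. L z k m (F m q)) = (\<Sum>m=1..n. if m = l then L z k l v else 0)"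
          by (intro sum.cong refl) (auto simp: F_def linear_map_zero[OF L[OF k]])
        thus ?thesis using l by simp
      qed
      have LF': "(\<Sum>m=1..n. L' z k m (\<phi> (P p j) (F m (P p j)))) = L' z k l (\<phi> (P p j) v)"
        if k: "k \<in> {1..n}" and j: "j \<in> {1..n}" for k j
      proof -
        have "(\<Sum>m=1..n. L' z k m (\<phi> (P p j) (F m (P p j)))) = (\<Sum>m=1..n. if m = l then L' z k l (\<phi> (P p j) v) else 0)"
          by (intro sum.cong refl) (auto simp: F_def linear_map_zero[OF L'[OF k]] linear_map_zero[OF lin_\<phi>[OF P[OF p j]]])
        thus ?thesis using l by simp
      qed
      have H1: "H_obj n \<tau> \<gamma> c x s L z F i p =
              (\<Sum>j=1..n. s (S_mat n \<tau> (z - x) p i j) (\<Sum>k=1..n. s (N p j k) (L z k l v)))"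
        unfolding H_obj_apply N_def P_def by (intro sum.cong refl arg_cong2[where f = s] LF)
      have H2: "H_obj n \<tau> \<gamma> c x s' L' z (\<lambda>j q. \<phi> q (F j q)) i p =
              (\<Sum>j=1..n. s' (S_mat n \<tau> (z - x) p i j) (\<Sum>k=1..n. s' (N p j k) (L' z k l (\<phi> (P p j) v))))"
        unfolding H_obj_apply N_def P_def
        by (intro sum.cong refl arg_cong2[where f = s'] LF'[unfolded P_def])
      have "f (\<phi> p (H_obj n \<tau> \<gamma> c x s L z F i p)) =
              (\<Sum>j=1..n. S_mat n \<tau> (z - x) p i j * (\<Sum>k=1..n. N p j k * f (\<phi> p (L z k l v))))"
        unfolding H1 by (simp only: linear_map_sum[OF lin_\<phi>[OF p]] linear_map_scale[OF lin_\<phi>[OF p]]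
          linear_map_sum[OF f_lin] linear_map_scale[OF f_lin])
      moreover have "f (H_obj n \<tau> \<gamma> c x s' L' z (\<lambda>j q. \<phi> q (F j q)) i p) =
              (\<Sum>j=1..n. S_mat n \<tau> (z - x) p i j * (\<Sum>k=1..n. N p j k * f (L' z k l (\<phi> (P p j) v))))"
        unfolding H2 by (simp only: linear_map_sum[OF f_lin] linear_map_scale[OF f_lin])
      ultimately show ?thesis
        using * i unfolding y_def by (simp add: right_diff_distrib sum_subtractf)
    qed
    from mat_left_inverse_kernel[OF inv this j] show "y p j = 0" .
  qed
  from generically_translate[OF this omega_in_hstar[OF j], of "of_real \<gamma>"]
  show ?thesis by (rule generically_mono) (simp add: y_def N_def P_def)
qed

text \<open>
  Rescaling the \<open>j\<close>-th row removes its pole and makes it continuous in both variables.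
\<close>

lemma intertwiner_theta_row:
  assumes n: "n \<ge> 1" and \<tau>: "Im \<tau> > 0" and j: "j \<in> {1..n}"
    and z: "theta 0 0 (z - of_nat n * ((1 + \<tau>) / 2) + (1 + \<tau>) / 2) \<tau> \<noteq> 0"
    and eq: "generically n UNIV (\<lambda>q. (\<Sum>k=1..n. mat_inv {1..n} (S_mat n \<tau> z q) j k * y q k) = 0)"
  shows "generically n UNIV (\<lambda>q. (\<Sum>k=1..n.
           theta_coeff n \<tau> (move q (z - of_nat n * ((1 + \<tau>) / 2)) (omega n j)) k * y q k) = 0)"
  using generically_conj[OF generically_theta_regular[OF \<tau>] eq]
proof (rule generically_mono)
  fix q assume q: "q \<in> hstar n" and *: "theta_regular n \<tau> q \<and>
      (\<Sum>k=1..n. mat_inv {1..n} (S_mat n \<tau> z q) j k * y q k) = 0"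
  obtain \<beta> where "\<forall>k\<in>{1..n}. theta_coeff n \<tau> (move q (z - of_nat n * ((1 + \<tau>) / 2)) (omega n j)) k =
      \<beta> * mat_inv {1..n} (S_mat n \<tau> z q) j k"
    using S_mat_inverse(3)[OF n \<tau> q _ z j] * by blast
  hence "(\<Sum>k=1..n. theta_coeff n \<tau> (move q (z - of_nat n * ((1 + \<tau>) / 2)) (omega n j)) k * y q k) =
         (\<Sum>k=1..n. \<beta> * (mat_inv {1..n} (S_mat n \<tau> z q) j k * y q k))"
    by (intro sum.cong refl) (simp add: mult.assoc)
  also have "\<dots> = 0" using * by (simp only: sum_distrib_left[symmetric]) simp
  finally show "(\<Sum>k=1..n. theta_coeff n \<tau> (move q (z - of_nat n * ((1 + \<tau>) / 2)) (omega n j)) k * y q k) = 0" .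
qed

section \<open>Intertwiners are generically constant\<close>

text \<open>
  One dense open set serves for all matrix coefficients of \<open>\<phi>\<close>, since they are combinations of finitely many.
\<close>

lemma M_Hom_continuous:
  assumes "fin_dim s" "fin_dim s'" and \<phi>: "\<phi> \<in> M_Hom n s s'"
  obtains \<Omega> where "open \<Omega>" "generically n UNIV (\<lambda>p. p \<in> \<Omega>)"
    "\<And>f w. functional s' f \<Longrightarrow> continuous_on (\<Omega> \<inter> hstar n) (\<lambda>p. f (\<phi> p w))"
proof -
  obtain B r where B: "finite B" "\<And>b. functional s (r b)" "\<And>v. (\<Sum>b\<in>B. s (r b v) b) = v"
    using fin_dim_coordinates[OF assms(1)] by metis
  obtain B' r' where B': "finite B'" "\<And>b. functional s' (r' b)" "\<And>v. (\<Sum>b\<in>B'. s' (r' b v) b) = v"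
    using fin_dim_coordinates[OF assms(2)] by metis
  have mero: "mero n (\<lambda>p. r' a (\<phi> p d))" for a d
    using \<phi> B'(2) unfolding M_Hom_def V_hstar_def M_hstar_def by blast
  define \<Omega> where "\<Omega> = (\<Inter>a\<in>B'. \<Inter>d\<in>B. regular_set n (\<lambda>p. r' a (\<phi> p d)))"
  show ?thesis
  proof (rule that[of \<Omega>])
    show "open \<Omega>" unfolding \<Omega>_def using B B' by (intro open_INT ballI open_regular_set) auto
    have "generically n UNIV (\<lambda>p. \<forall>a\<in>B'. \<forall>d\<in>B. p \<in> regular_set n (\<lambda>p. r' a (\<phi> p d)))"
      by (intro generically_ball_finite B B' mero_generically_regular mero)
    thus "generically n UNIV (\<lambda>p. p \<in> \<Omega>)" by (rule generically_mono) (simp add: \<Omega>_def)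
    fix f w assume f: "functional s' f"
    have "continuous_on (\<Omega> \<inter> hstar n) (\<lambda>p. r' a (\<phi> p d))" if "a \<in> B'" "d \<in> B" for a d
    proof (rule continuous_on_subset)
      show "continuous_on (regular_set n (\<lambda>p. r' a (\<phi> p d)) \<inter> hstar n) (\<lambda>p. r' a (\<phi> p d))"
        using holo_regular_set unfolding holo_def by blast
    qed (use that in \<open>auto simp: \<Omega>_def\<close>)
    hence cont: "continuous_on (\<Omega> \<inter> hstar n) (\<lambda>p. \<Sum>d\<in>B. r d w * (\<Sum>a\<in>B'. r' a (\<phi> p d) * f a))"
      by (intro continuous_on_sum continuous_on_mult continuous_on_const)
    have "f (\<phi> p w) = (\<Sum>d\<in>B. r d w * (\<Sum>a\<in>B'. r' a (\<phi> p d) * f a))" if "p \<in> hstar n" for p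
    proof -
      have "functional s (\<lambda>w. f (\<phi> p w))"
        using functional_compose[OF f] \<phi> that unfolding M_Hom_def by blast
      from functional_coordinates[where r = r and B = B, OF this B(3)]
      have "f (\<phi> p w) = (\<Sum>d\<in>B. r d w * f (\<phi> p d))" .
      also have "\<dots> = (\<Sum>d\<in>B. r d w * (\<Sum>a\<in>B'. r' a (\<phi> p d) * f a))"
        by (intro sum.cong refl arg_cong2[where f = "(*)"] functional_coordinates[where r = r', OF f B'(3)])
      finally show ?thesis .
    qed
    with cont show "continuous_on (\<Omega> \<inter> hstar n) (\<lambda>p. f (\<phi> p w))"
      by (subst continuous_on_cong[OF refl]) auto
  qed
qed

lemma continuous_on_theta_coeff:
  assumes "Im \<tau> > 0"
  shows "continuous_on A (\<lambda>q. theta_coeff n \<tau> (move q r w) k)"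
  unfolding continuous_on_def
proof
  fix q assume "q \<in> A"
  show "((\<lambda>q. theta_coeff n \<tau> (move q r w) k) \<longlongrightarrow> theta_coeff n \<tau> (move q r w) k) (at q within A)"
  proof (rule tendsto_theta_coeff[OF assms])
    fix j
    have "continuous_on A (\<lambda>q. move q r w j)"
      by (rule continuous_on_product_then_coordinatewise[OF continuous_on_move])
    thus "((\<lambda>q. move q r w j) \<longlongrightarrow> move q r w j) (at q within A)"
      using \<open>q \<in> A\<close> unfolding continuous_on_def by blast
  qed
qed

text \<open>
  For each \<open>z\<close> the row relation holds generically in \<open>q\<close>, hence by continuity at all \<open>q\<close> of a dense open
  set that does not depend on \<open>z\<close>, and one can let \<open>z\<close> tend to \<open>\<zeta>\<close> with \<open>q\<close> fixed. In the limit the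
  coefficient vectors of all rows become the same non-zero vector \<open>b\<close>. Subtracting rows \<open>i\<close> and \<open>j\<close> removes
  \<open>L'\<close> and leaves $\sum_kb_k\,\psi(L_{kl}(\zeta)v)=0$, where \<open>\<psi>\<close> is the difference of the two values of
  \<open>f \<circ> \<phi>\<close>. As \<open>L(\<zeta>)\<close> is invertible, \<open>\<psi> = 0\<close>.
\<close>

lemma intertwiner_shift_independent:
  fixes s :: "'v::ab_group_add scaling" and s' :: "'w::ab_group_add scaling"
  assumes n: "n \<ge> 1" and \<tau>: "Im \<tau> > 0" and fin: "fin_dim s" "fin_dim s'" and \<phi>: "\<phi> \<in> M_Hom n s s'"
    and L: "mero_Lmat n s L" "regular_at n s L \<zeta>" and L': "mero_Lmat n s' L'" "regular_at n s' L' \<zeta>"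
    and K: "\<forall>\<^sub>\<approx>z. Lmat_inverse n (L z) (K z)" "regular_at n s K \<zeta>"
    and eq: "\<forall>\<^sub>\<approx>z. \<forall>j\<in>{1..n}. \<forall>l\<in>{1..n}. \<forall>v f. functional s' f \<longrightarrow>
       generically n UNIV (\<lambda>q. (\<Sum>k=1..n. theta_coeff n \<tau> (move q (z - \<zeta>) (omega n j)) k *
            (f (\<phi> (move q \<gamma> (omega n j)) (L z k l v)) - f (L' z k l (\<phi> q v)))) = 0)"
    and f: "functional s' f" and ij: "i \<in> {1..n}" "j \<in> {1..n}"
  shows "generically n UNIV (\<lambda>q. f (\<phi> (move q \<gamma> (omega n i)) d) = f (\<phi> (move q \<gamma> (omega n j)) d))"
proof -
  obtain B r where B: "finite B" "\<And>b. functional s (r b)" "\<And>v. (\<Sum>b\<in>B. s (r b v) b) = v"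
    using fin_dim_coordinates[OF fin(1)] by metis
  obtain \<Omega> where \<Omega>: "open \<Omega>" "generically n UNIV (\<lambda>p. p \<in> \<Omega>)"
    "\<And>f w. functional s' f \<Longrightarrow> continuous_on (\<Omega> \<inter> hstar n) (\<lambda>p. f (\<phi> p w))"
    using M_Hom_continuous[OF fin \<phi>] by blast
  have lin_\<phi>: "Vector_Spaces.linear s s' (\<phi> p)" if "p \<in> hstar n" for p
    using \<phi> that unfolding M_Hom_def by blast
  have lin_L: "Vector_Spaces.linear s s (L z i j)" if "i \<in> {1..n}" "j \<in> {1..n}" for z i j
    using L(1) that unfolding mero_Lmat_def by blast
  have lin_L': "Vector_Spaces.linear s' s' (L' z i j)" if "i \<in> {1..n}" "j \<in> {1..n}" for z i j
    using L'(1) that unfolding mero_Lmat_def by blast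
  define E where "E = (\<lambda>z q j l v. \<Sum>k=1..n. theta_coeff n \<tau> (move q (z - \<zeta>) (omega n j)) k *
            (f (\<phi> (move q \<gamma> (omega n j)) (L z k l v)) - f (L' z k l (\<phi> q v))))"
  define D where "D = (\<lambda>j. \<Omega> \<inter> {q. move q \<gamma> (omega n j) \<in> \<Omega>})"
  (* For fixed q in D j; the exceptional sets in q, which depend on z, are removed by continuity. *)
  have E0: "\<forall>\<^sub>F z in at \<zeta>. E z q j l v = 0"
    if j: "j \<in> {1..n}" and l: "l \<in> {1..n}" and q: "q \<in> D j" "q \<in> hstar n" for q j l v
  proof -
    have "\<forall>\<^sub>F z in at \<zeta>. generically n UNIV (\<lambda>q. E z q j l v = 0)"
      using eventually_cosparse_imp_eventually_at[OF eq] by (rule eventually_mono) (use j l f in \<open>auto simp: E_def\<close>)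
    thus ?thesis
    proof (rule eventually_mono)
      fix z assume z: "generically n UNIV (\<lambda>q. E z q j l v = 0)"
      have "continuous_on (D j \<inter> hstar n) (\<lambda>q. f (\<phi> (move q \<gamma> (omega n j)) (L z k l v)))" for k
        by (rule continuous_on_compose2[OF \<Omega>(3)[OF f] continuous_on_move])
           (auto simp: D_def intro: hstar_move omega_in_hstar[OF j])
      moreover have "continuous_on (D j \<inter> hstar n) (\<lambda>q. f (L' z k l (\<phi> q v)))" if "k \<in> {1..n}" for k
        by (rule continuous_on_subset[OF \<Omega>(3)[OF functional_compose[OF f lin_L'[OF that l]]]]) (auto simp: D_def)
      ultimately have "continuous_on (D j \<inter> hstar n) (\<lambda>q. E z q j l v)"
        unfolding E_def
        by (intro continuous_on_sum continuous_on_mult continuous_on_theta_coeff[OF \<tau>] continuous_on_diff)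
      moreover have "open (D j)" unfolding D_def by (intro open_Int \<Omega> open_move_vimage)
      ultimately show "E z q j l v = 0"
        using q by (intro generically_eq_imp_eq[of "D j" n "\<lambda>q. E z q j l v" "\<lambda>_. 0" q])
                   (auto intro: generically_mono[OF z])
    qed
  qed
  define \<Lambda> where "\<Lambda> = (\<lambda>(g :: 'v \<Rightarrow> complex) k l v. Lim (at \<zeta>) (\<lambda>z. g (L z k l v)))"
  have \<Lambda>: "(\<lambda>z. g (L z k l v)) \<midarrow>\<zeta>\<rightarrow> \<Lambda> g k l v" if "functional s g" "k \<in> {1..n}" "l \<in> {1..n}" for g k l v
    using L(2) that tendsto_Lim[of "at \<zeta>" "\<lambda>z. g (L z k l v)"] unfolding regular_at_def \<Lambda>_def by force
  define \<Lambda>' where "\<Lambda>' = (\<lambda>k l w. Lim (at \<zeta>) (\<lambda>z. f (L' z k l w)))"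
  have \<Lambda>': "(\<lambda>z. f (L' z k l w)) \<midarrow>\<zeta>\<rightarrow> \<Lambda>' k l w" if "k \<in> {1..n}" "l \<in> {1..n}" for k l w
    using L'(2) f that tendsto_Lim[of "at \<zeta>" "\<lambda>z. f (L' z k l w)"] unfolding regular_at_def \<Lambda>'_def by force
  have lim0: "(\<Sum>k=1..n. theta_coeff n \<tau> q k * (\<Lambda> (\<lambda>w. f (\<phi> (move q \<gamma> (omega n j)) w)) k l v - \<Lambda>' k l (\<phi> q v))) = 0"
    if j: "j \<in> {1..n}" and l: "l \<in> {1..n}" and q: "q \<in> D j" "q \<in> hstar n" for q j l v
  proof -
    have g: "functional s (\<lambda>w. f (\<phi> (move q \<gamma> (omega n j)) w))"
      by (rule functional_compose[OF f lin_\<phi>]) (intro hstar_move q omega_in_hstar j)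
    have "(\<lambda>z. theta_coeff n \<tau> (move q (z - \<zeta>) (omega n j)) k) \<midarrow>\<zeta>\<rightarrow> theta_coeff n \<tau> q k" for k
    proof (rule tendsto_theta_coeff[OF \<tau>])
      fix m
      have "(\<lambda>z. q m + (z - \<zeta>) * omega n j m) \<midarrow>\<zeta>\<rightarrow> q m + (\<zeta> - \<zeta>) * omega n j m"
        by (intro tendsto_intros)
      thus "(\<lambda>z. move q (z - \<zeta>) (omega n j) m) \<midarrow>\<zeta>\<rightarrow> q m" by (simp add: move_def)
    qed
    hence "(\<lambda>z. E z q j l v) \<midarrow>\<zeta>\<rightarrow>
        (\<Sum>k=1..n. theta_coeff n \<tau> q k * (\<Lambda> (\<lambda>w. f (\<phi> (move q \<gamma> (omega n j)) w)) k l v - \<Lambda>' k l (\<phi> q v)))"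
      unfolding E_def by (intro tendsto_sum tendsto_mult tendsto_diff \<Lambda>[OF g] \<Lambda>' l)
    moreover have "(\<lambda>z. E z q j l v) \<midarrow>\<zeta>\<rightarrow> 0"
      by (rule tendsto_eventually[OF E0[OF j l q]])
    ultimately show ?thesis by (rule tendsto_unique[rotated]) simp
  qed
  have "f (\<phi> (move q \<gamma> (omega n i)) d) = f (\<phi> (move q \<gamma> (omega n j)) d)"
    if q: "q \<in> D i" "q \<in> D j" "q \<in> hstar n" for q
  proof -
    have g: "functional s (\<lambda>w. f (\<phi> (move q \<gamma> (omega n j)) w))" if "j \<in> {1..n}" for j
      by (rule functional_compose[OF f lin_\<phi>]) (intro hstar_move q omega_in_hstar that)
    define \<psi> where "\<psi> = (\<lambda>w. f (\<phi> (move q \<gamma> (omega n i)) w) - f (\<phi> (move q \<gamma> (omega n j)) w))"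
    have \<psi>: "functional s \<psi>" unfolding \<psi>_def by (rule functional_diff[OF g[OF ij(1)] g[OF ij(2)]])
    have \<Lambda>_\<psi>: "\<Lambda> \<psi> k l v = \<Lambda> (\<lambda>w. f (\<phi> (move q \<gamma> (omega n i)) w)) k l v - \<Lambda> (\<lambda>w. f (\<phi> (move q \<gamma> (omega n j)) w)) k l v"
      if "k \<in> {1..n}" "l \<in> {1..n}" for k l v
    proof (rule tendsto_unique[OF _ \<Lambda>[OF \<psi> that]])
      show "(\<lambda>z. \<psi> (L z k l v)) \<midarrow>\<zeta>\<rightarrow> \<Lambda> (\<lambda>w. f (\<phi> (move q \<gamma> (omega n i)) w)) k l v - \<Lambda> (\<lambda>w. f (\<phi> (move q \<gamma> (omega n j)) w)) k l v"
        unfolding \<psi>_def by (intro tendsto_diff \<Lambda>[OF g[OF ij(1)]] \<Lambda>[OF g[OF ij(2)]] that)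
    qed simp
    have \<psi>0: "(\<Sum>k=1..n. theta_coeff n \<tau> q k * \<Lambda> \<psi> k l v) = 0" if l: "l \<in> {1..n}" for l v
    proof -
      have "(\<Sum>k=1..n. theta_coeff n \<tau> q k * \<Lambda> \<psi> k l v) =
          (\<Sum>k=1..n. theta_coeff n \<tau> q k * (\<Lambda> (\<lambda>w. f (\<phi> (move q \<gamma> (omega n i)) w)) k l v - \<Lambda>' k l (\<phi> q v))) -
          (\<Sum>k=1..n. theta_coeff n \<tau> q k * (\<Lambda> (\<lambda>w. f (\<phi> (move q \<gamma> (omega n j)) w)) k l v - \<Lambda>' k l (\<phi> q v)))"
        unfolding sum_subtractf[symmetric] by (intro sum.cong refl) (simp add: \<Lambda>_\<psi>[OF _ l] algebra_simps)
      also have "\<dots> = 0" using lim0[OF ij(1) l q(1,3)] lim0[OF ij(2) l q(2,3)] by simp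
      finally show ?thesis .
    qed
    have q_sum: "(\<Sum>j=1..n. q j) = 0" using q(3) unfolding hstar_def by blast
    obtain m where m: "m \<in> {1..n}" "theta_coeff n \<tau> q m \<noteq> 0"
      using theta_coeff_nonzero[OF n \<tau> q_sum] by blast
    define \<kappa> where "\<kappa> = (\<lambda>l b. Lim (at \<zeta>) (\<lambda>z. r b (K z l m d)))"
    have \<kappa>: "(\<lambda>z. r b (K z l m d)) \<midarrow>\<zeta>\<rightarrow> \<kappa> l b" if "l \<in> {1..n}" for l b
      using K(2) B(2) that m tendsto_Lim[of "at \<zeta>" "\<lambda>z. r b (K z l m d)"] unfolding regular_at_def \<kappa>_def by force
    (* The limit of L K = 1, in coordinates. *)
    have inv: "(\<Sum>l=1..n. \<Sum>b\<in>B. \<kappa> l b * \<Lambda> \<psi> k l b) = (if k = m then \<psi> d else 0)" if k: "k \<in> {1..n}" for k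
    proof -
      have lim: "(\<lambda>z. \<Sum>l=1..n. \<Sum>b\<in>B. r b (K z l m d) * \<psi> (L z k l b)) \<midarrow>\<zeta>\<rightarrow> (\<Sum>l=1..n. \<Sum>b\<in>B. \<kappa> l b * \<Lambda> \<psi> k l b)"
        by (intro tendsto_sum tendsto_mult \<kappa> \<Lambda>[OF \<psi> k])
      have "\<forall>\<^sub>F z in at \<zeta>. (\<Sum>l=1..n. \<Sum>b\<in>B. r b (K z l m d) * \<psi> (L z k l b)) = (if k = m then \<psi> d else 0)"
        using eventually_cosparse_imp_eventually_at[OF K(1) UNIV_I]
      proof (rule eventually_mono)
        fix z assume inv: "Lmat_inverse n (L z) (K z)"
        have "(\<Sum>l=1..n. \<Sum>b\<in>B. r b (K z l m d) * \<psi> (L z k l b)) = (\<Sum>l=1..n. \<psi> (L z k l (K z l m d)))"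
        proof (intro sum.cong refl)
          fix l assume "l \<in> {1..n}"
          from functional_coordinates[where r = r and B = B, OF functional_compose[OF \<psi> lin_L[OF k this]] B(3)]
          show "(\<Sum>b\<in>B. r b (K z l m d) * \<psi> (L z k l b)) = \<psi> (L z k l (K z l m d))" by (rule sym)
        qed
        also have "\<dots> = \<psi> (\<Sum>l=1..n. L z k l (K z l m d))"
          by (rule linear_map_sum[OF \<psi>[unfolded functional_def], symmetric])
        also have "(\<Sum>l=1..n. L z k l (K z l m d)) = (if k = m then d else 0)"
          using inv k m(1) unfolding Lmat_inverse_def by blast
        finally show "(\<Sum>l=1..n. \<Sum>b\<in>B. r b (K z l m d) * \<psi> (L z k l b)) = (if k = m then \<psi> d else 0)"
          using linear_map_zero[OF \<psi>[unfolded functional_def]] by auto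
      qed
      from tendsto_unique[OF _ lim tendsto_eventually[OF this]] show ?thesis by simp
    qed
    have "theta_coeff n \<tau> q m * \<psi> d = (\<Sum>k=1..n. if k = m then theta_coeff n \<tau> q m * \<psi> d else 0)"
      using m by simp
    also have "\<dots> = (\<Sum>k=1..n. theta_coeff n \<tau> q k * (\<Sum>l=1..n. \<Sum>b\<in>B. \<kappa> l b * \<Lambda> \<psi> k l b))"
    proof (intro sum.cong refl)
      fix k assume k: "k \<in> {1..n}"
      show "(if k = m then theta_coeff n \<tau> q m * \<psi> d else 0) =
              theta_coeff n \<tau> q k * (\<Sum>l=1..n. \<Sum>b\<in>B. \<kappa> l b * \<Lambda> \<psi> k l b)"
        unfolding inv[OF k] by simp
    qed
    also have "\<dots> = (\<Sum>l=1..n. \<Sum>k=1..n. \<Sum>b\<in>B. theta_coeff n \<tau> q k * (\<kappa> l b * \<Lambda> \<psi> k l b))"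
      unfolding sum_distrib_left by (rule sum.swap)
    also have "\<dots> = (\<Sum>l=1..n. \<Sum>b\<in>B. \<Sum>k=1..n. theta_coeff n \<tau> q k * (\<kappa> l b * \<Lambda> \<psi> k l b))"
      by (intro sum.cong refl sum.swap)
    also have "\<dots> = (\<Sum>l=1..n. \<Sum>b\<in>B. \<kappa> l b * (\<Sum>k=1..n. theta_coeff n \<tau> q k * \<Lambda> \<psi> k l b))"
      by (intro sum.cong refl) (simp add: sum_distrib_left mult_ac)
    also have "\<dots> = 0"
      by (intro sum.neutral ballI) (simp only: \<psi>0 mult_zero_right)
    finally have "\<psi> d = 0" using m(2) by simp
    thus ?thesis by (simp add: \<psi>_def)
  qed
  moreover have "generically n UNIV (\<lambda>q. (q \<in> \<Omega> \<and> move q \<gamma> (omega n i) \<in> \<Omega>) \<and> move q \<gamma> (omega n j) \<in> \<Omega>)"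
    by (intro generically_conj \<Omega> generically_translate[OF \<Omega>(2)] omega_in_hstar ij)
  ultimately show ?thesis by (elim generically_mono) (auto simp: D_def)
qed

text \<open>
  For constant \<open>\<phi>\<close> all rows of the relation can be taken at the same point \<open>q\<close>, where they form an
  invertible matrix.
\<close>

lemma generically_const_intertwiner:
  assumes n: "n \<ge> 1" and \<tau>: "Im \<tau> > 0" and \<phi>: "\<phi> \<in> M_Hom n s s'"
    and const: "generically n UNIV (\<lambda>p. \<phi> p = \<phi>\<^sub>0)"
    and L: "\<And>i j. i \<in> {1..n} \<Longrightarrow> j \<in> {1..n} \<Longrightarrow> Vector_Spaces.linear s s (L z i j)"
    and L': "\<And>i j. i \<in> {1..n} \<Longrightarrow> j \<in> {1..n} \<Longrightarrow> Vector_Spaces.linear s' s' (L' z i j)"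
    and eq: "\<And>F i. \<forall>j\<in>{1..n}. F j \<in> V_hstar n s \<Longrightarrow> i \<in> {1..n} \<Longrightarrow> generically n UNIV
       (\<lambda>p. \<phi> p (H_obj n \<tau> \<gamma> c x s L z F i p) = H_obj n \<tau> \<gamma> c x s' L' z (\<lambda>j q. \<phi> q (F j q)) i p)"
    and z: "theta 0 0 (z - x - of_nat n * ((1 + \<tau>) / 2) + (1 + \<tau>) / 2) \<tau> \<noteq> 0"
      "theta 0 0 (z - x - c - of_nat n * ((1 + \<tau>) / 2) + (1 + \<tau>) / 2) \<tau> \<noteq> 0"
    and kl: "k \<in> {1..n}" "l \<in> {1..n}" and f: "functional s' f"
  shows "f (\<phi>\<^sub>0 (L z k l v)) = f (L' z k l (\<phi>\<^sub>0 v))"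
proof -
  have "generically n UNIV (\<lambda>q. \<phi> (move q (of_real \<gamma>) (omega n j)) = \<phi>\<^sub>0)" if "j \<in> {1..n}" for j
    by (rule generically_translate[OF const omega_in_hstar[OF that]])
  hence "generically n UNIV (\<lambda>q. theta_regular n \<tau> q \<and> \<phi> q = \<phi>\<^sub>0 \<and>
      (\<forall>j\<in>{1..n}. \<phi> (move q (of_real \<gamma>) (omega n j)) = \<phi>\<^sub>0) \<and>
      (\<forall>j\<in>{1..n}. (\<Sum>k=1..n. mat_inv {1..n} (S_mat n \<tau> (z - x - c) q) j k *
            (f (\<phi> (move q (of_real \<gamma>) (omega n j)) (L z k l v)) - f (L' z k l (\<phi> q v)))) = 0))"
    by (intro generically_conj generically_theta_regular[OF \<tau>] const generically_ball_finite finite_atLeastAtMost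
          intertwiner_row[OF n \<tau> \<phi> L L' eq z(1) _ kl(2) f])
  from generically_UNIV_ex[OF this] obtain q where q: "q \<in> hstar n" "theta_regular n \<tau> q" "\<phi> q = \<phi>\<^sub>0"
      "\<And>j. j \<in> {1..n} \<Longrightarrow> \<phi> (move q (of_real \<gamma>) (omega n j)) = \<phi>\<^sub>0"
      "\<And>j. j \<in> {1..n} \<Longrightarrow> (\<Sum>k=1..n. mat_inv {1..n} (S_mat n \<tau> (z - x - c) q) j k *
            (f (\<phi> (move q (of_real \<gamma>) (omega n j)) (L z k l v)) - f (L' z k l (\<phi> q v)))) = 0"
    by auto
  have "f (\<phi>\<^sub>0 (L z k l v)) - f (L' z k l (\<phi>\<^sub>0 v)) = 0"
  proof (rule mat_left_inverse_kernel[OF S_mat_inverse(1)[OF n \<tau> q(1,2) z(2)] _ kl(1)])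
    fix j assume "j \<in> {1..n}"
    from q(5)[OF this] show "(\<Sum>k=1..n. mat_inv {1..n} (S_mat n \<tau> (z - x - c) q) j k *
        (f (\<phi>\<^sub>0 (L z k l v)) - f (L' z k l (\<phi>\<^sub>0 v)))) = 0"
      unfolding q(3) q(4)[OF \<open>j \<in> {1..n}\<close>] .
  qed
  thus ?thesis by simp
qed

lemma const_intertwiner:
  assumes \<phi>: "Vector_Spaces.linear s s' \<phi>"
    and comm: "\<And>i j v. i \<in> {1..n} \<Longrightarrow> j \<in> {1..n} \<Longrightarrow> \<phi> (L z i j v) = L' z i j (\<phi> v)"
  shows "\<phi> (H_obj n \<tau> \<gamma> c x s L z F i p) = H_obj n \<tau> \<gamma> c x s' L' z (\<lambda>j q. \<phi> (F j q)) i p"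
  unfolding H_obj_apply linear_map_sum[OF \<phi>] linear_map_scale[OF \<phi>]
  by (intro sum.cong refl arg_cong2[where f = s'] comm)

text \<open>
  The condition that singles out the representatives of morphisms in \<open>DB_Hom\<close>.
\<close>

definition intertwines ::
    "nat \<Rightarrow> 'v::ab_group_add scaling \<Rightarrow> (complex \<Rightarrow> 'v Dop) \<Rightarrow> (complex \<Rightarrow> 'w::ab_group_add Dop) \<Rightarrow>
     (hvec \<Rightarrow> 'v \<Rightarrow> 'w) \<Rightarrow> bool" where
  "intertwines n s L L' \<phi> \<longleftrightarrow>
     (\<forall>\<^sub>\<approx>z. \<forall>F. (\<forall>j\<in>{1..n}. F j \<in> V_hstar n s) \<longrightarrow>
        (\<forall>i\<in>{1..n}. generically n UNIV
           (\<lambda>p. \<phi> p (L z F i p) = L' z (\<lambda>j q. \<phi> q (F j q)) i p)))"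

lemma DB_Hom_eq:
  "DB_Hom n s L s' L' = {\<phi> \<in> M_Hom n s s'. intertwines n s L L' \<phi>} // mero_rel n s s'"
  by (simp add: DB_Hom_def intertwines_def)

text \<open>
  Fullness of $\mathcal{H}^c_x$. The point $x+c+nh$ with \<open>h = (1 + \<tau>) / 2\<close> is where the rows of
  $S(z-x-c,\lambda)^{-1}$ become proportional.
\<close>

lemma intertwiner_generically_const:
  fixes s :: "'v::ab_group_add scaling" and s' :: "'w::ab_group_add scaling"
  assumes n: "n \<ge> 1" and \<tau>: "Im \<tau> > 0" and \<gamma>: "\<gamma> \<notin> \<rat>"
    and fin: "fin_dim s" "fin_dim s'" and \<phi>: "\<phi> \<in> M_Hom n s s'"
    and L: "mero_Lmat n s L" and L': "mero_Lmat n s' L'"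
    and K: "\<forall>\<^sub>\<approx>z. Lmat_inverse n (L z) (K z)"
    and reg: "regular_at n s L (x + c + of_nat n * ((1 + \<tau>) / 2))"
      "regular_at n s' L' (x + c + of_nat n * ((1 + \<tau>) / 2))"
      "regular_at n s K (x + c + of_nat n * ((1 + \<tau>) / 2))"
    and int: "intertwines n s (H_obj n \<tau> \<gamma> c x s L) (H_obj n \<tau> \<gamma> c x s' L') \<phi>"
  obtains \<phi>\<^sub>0 where "\<phi>\<^sub>0 \<in> CB_Hom n s L s' L'" "generically n UNIV (\<lambda>p. \<phi> p = \<phi>\<^sub>0)"
proof -
  obtain B r where B: "finite B" "\<And>b. functional s (r b)" "\<And>v. (\<Sum>b\<in>B. s (r b v) b) = v"
    using fin_dim_coordinates[OF fin(1)] by metis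
  obtain B' r' where B': "finite B'" "\<And>b. functional s' (r' b)" "\<And>v. (\<Sum>b\<in>B'. s' (r' b v) b) = v"
    using fin_dim_coordinates[OF fin(2)] by metis
  have lin_\<phi>: "Vector_Spaces.linear s s' (\<phi> p)" if "p \<in> hstar n" for p
    using \<phi> that unfolding M_Hom_def by blast
  have lin_L: "Vector_Spaces.linear s s (L z i j)" if "i \<in> {1..n}" "j \<in> {1..n}" for z i j
    using L that unfolding mero_Lmat_def by blast
  have lin_L': "Vector_Spaces.linear s' s' (L' z i j)" if "i \<in> {1..n}" "j \<in> {1..n}" for z i j
    using L' that unfolding mero_Lmat_def by blast
  have M: "(\<lambda>p. r' a (\<phi> p d)) \<in> M_hstar n" for a d
    using \<phi> B'(2) unfolding M_Hom_def V_hstar_def by blast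
  define \<zeta> where "\<zeta> = x + c + of_nat n * ((1 + \<tau>) / 2)"
  have \<zeta>: "z - x - c - of_nat n * ((1 + \<tau>) / 2) = z - \<zeta>" for z by (simp add: \<zeta>_def)
  have nz: "\<forall>\<^sub>\<approx>z. theta 0 0 (z - x - of_nat n * ((1 + \<tau>) / 2) + (1 + \<tau>) / 2) \<tau> \<noteq> 0"
           "\<forall>\<^sub>\<approx>z. theta 0 0 (z - x - c - of_nat n * ((1 + \<tau>) / 2) + (1 + \<tau>) / 2) \<tau> \<noteq> 0"
    using eventually_theta_nonzero[OF \<tau>, of "- x - of_nat n * ((1 + \<tau>) / 2) + (1 + \<tau>) / 2"]
          eventually_theta_nonzero[OF \<tau>, of "- x - c - of_nat n * ((1 + \<tau>) / 2) + (1 + \<tau>) / 2"]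
    by (simp_all only: diff_conv_add_uminus add.assoc)
  have row: "\<forall>\<^sub>\<approx>z. \<forall>j\<in>{1..n}. \<forall>l\<in>{1..n}. \<forall>v f. functional s' f \<longrightarrow>
       generically n UNIV (\<lambda>q. (\<Sum>k=1..n. theta_coeff n \<tau> (move q (z - \<zeta>) (omega n j)) k *
            (f (\<phi> (move q (of_real \<gamma>) (omega n j)) (L z k l v)) - f (L' z k l (\<phi> q v)))) = 0)"
    using int[unfolded intertwines_def] nz
  proof eventually_elim
    case (elim z)
    have eq: "generically n UNIV (\<lambda>p. \<phi> p (H_obj n \<tau> \<gamma> c x s L z F i p) =
          H_obj n \<tau> \<gamma> c x s' L' z (\<lambda>j q. \<phi> q (F j q)) i p)"
      if "\<forall>j\<in>{1..n}. F j \<in> V_hstar n s" "i \<in> {1..n}" for F i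
      using elim(1)[THEN spec, THEN mp, OF that(1), THEN bspec, OF that(2)] .
    show ?case
    proof (intro ballI allI impI)
      fix j l v f assume jl: "j \<in> {1..n}" "l \<in> {1..n}" and f: "functional s' f"
      have "generically n UNIV (\<lambda>q. (\<Sum>k=1..n. mat_inv {1..n} (S_mat n \<tau> (z - x - c) q) j k *
            (f (\<phi> (move q (of_real \<gamma>) (omega n j)) (L z k l v)) - f (L' z k l (\<phi> q v)))) = 0)"
        by (rule intertwiner_row[OF n \<tau> \<phi> lin_L lin_L' eq elim(2) jl f])
      from intertwiner_theta_row[OF n \<tau> jl(1) elim(3) this]
      show "generically n UNIV (\<lambda>q. (\<Sum>k=1..n. theta_coeff n \<tau> (move q (z - \<zeta>) (omega n j)) k *
            (f (\<phi> (move q (of_real \<gamma>) (omega n j)) (L z k l v)) - f (L' z k l (\<phi> q v)))) = 0)"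
        unfolding \<zeta> .
    qed
  qed
  have "\<exists>c. generically n UNIV (\<lambda>p. r' a (\<phi> p d) = c)" for a d
  proof (rule mero_const_of_periods[OF _ n \<gamma>])
    show "mero n (\<lambda>p. r' a (\<phi> p d))" using M[of a d] by (simp add: M_hstar_def)
    fix i assume i: "i \<in> {1..n}"
    show "generically n UNIV (\<lambda>p. r' a (\<phi> (move p (of_nat n) (omega n i)) d) = r' a (\<phi> p d))"
      using M[of a d] i by (simp add: M_hstar_def)
    show "generically n UNIV (\<lambda>p. r' a (\<phi> (move p (of_real \<gamma>) (omega n i)) d) =
                                   r' a (\<phi> (move p (of_real \<gamma>) (omega n 1)) d))"
      by (rule intertwiner_shift_independent[OF n \<tau> fin \<phi> L reg(1)[folded \<zeta>_def] L' reg(2)[folded \<zeta>_def]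
            K reg(3)[folded \<zeta>_def] row B'(2) i]) (use n in simp)
  qed
  then obtain e where e: "\<And>a d. generically n UNIV (\<lambda>p. r' a (\<phi> p d) = e a d)" by metis
  have "generically n UNIV (\<lambda>p. \<forall>a\<in>B'. \<forall>d\<in>B. r' a (\<phi> p d) = e a d)"
    by (intro generically_ball_finite B B' e)
  note gc = this
  from generically_UNIV_ex[OF gc] obtain p0 where p0: "p0 \<in> hstar n" "\<forall>a\<in>B'. \<forall>d\<in>B. r' a (\<phi> p0 d) = e a d"
    by (rule bexE)
  have const: "generically n UNIV (\<lambda>p. \<phi> p = \<phi> p0)"
    using gc
  proof (rule generically_mono)
    fix p assume p: "p \<in> hstar n" "\<forall>a\<in>B'. \<forall>d\<in>B. r' a (\<phi> p d) = e a d"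
    show "\<phi> p = \<phi> p0"
    proof
      fix v
      have on_B: "\<phi> p d = \<phi> p0 d" if "d \<in> B" for d
      proof -
        have "\<phi> p d = (\<Sum>a\<in>B'. s' (r' a (\<phi> p d)) a)" by (rule B'(3)[symmetric])
        also have "\<dots> = (\<Sum>a\<in>B'. s' (r' a (\<phi> p0 d)) a)"
          by (intro sum.cong refl) (use p p0 that in simp)
        also have "\<dots> = \<phi> p0 d" by (rule B'(3))
        finally show ?thesis .
      qed
      have "\<phi> p v = (\<Sum>d\<in>B. s' (r d v) (\<phi> p d))"
        by (rule linear_map_coordinates[where r = r, OF lin_\<phi>[OF p(1)] B(3)])
      also have "\<dots> = (\<Sum>d\<in>B. s' (r d v) (\<phi> p0 d))" by (intro sum.cong refl) (simp add: on_B)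
      also have "\<dots> = \<phi> p0 v"
        by (rule linear_map_coordinates[where r = r, OF lin_\<phi>[OF p0(1)] B(3), symmetric])
      finally show "\<phi> p v = \<phi> p0 v" .
    qed
  qed
  have "\<forall>\<^sub>\<approx>z. \<forall>i\<in>{1..n}. \<forall>j\<in>{1..n}. \<forall>v. \<phi> p0 (L z i j v) = L' z i j (\<phi> p0 v)"
    using int[unfolded intertwines_def] nz
  proof eventually_elim
    case (elim z)
    have eq: "generically n UNIV (\<lambda>p. \<phi> p (H_obj n \<tau> \<gamma> c x s L z F i p) =
          H_obj n \<tau> \<gamma> c x s' L' z (\<lambda>j q. \<phi> q (F j q)) i p)"
      if "\<forall>j\<in>{1..n}. F j \<in> V_hstar n s" "i \<in> {1..n}" for F i
      using elim(1)[THEN spec, THEN mp, OF that(1), THEN bspec, OF that(2)] .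
    show ?case
    proof (intro ballI allI)
      fix k l v assume kl: "k \<in> {1..n}" "l \<in> {1..n}"
      have coords: "r' a (\<phi> p0 (L z k l v)) = r' a (L' z k l (\<phi> p0 v))" for a
        by (rule generically_const_intertwiner[OF n \<tau> \<phi> const lin_L lin_L' eq elim(2,3) kl B'(2)])
      have "\<phi> p0 (L z k l v) = (\<Sum>a\<in>B'. s' (r' a (\<phi> p0 (L z k l v))) a)" by (rule B'(3)[symmetric])
      also have "\<dots> = L' z k l (\<phi> p0 v)" unfolding coords by (rule B'(3))
      finally show "\<phi> p0 (L z k l v) = L' z k l (\<phi> p0 v)" .
    qed
  qed
  hence "\<phi> p0 \<in> CB_Hom n s L s' L'" using lin_\<phi>[OF p0(1)] by (simp add: CB_Hom_def)
  thus ?thesis using const by (rule that)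
qed

section \<open>The isomorphism of morphism spaces\<close>

lemma const_in_M_Hom:
  assumes "Vector_Spaces.linear s s' \<phi>"
  shows "(\<lambda>_. \<phi>) \<in> M_Hom n s s'"
  by (rule M_Hom_generically_const[where \<phi>\<^sub>0 = \<phi>]) (auto intro: assms generically_always)

lemma mero_rel_sym: "(\<phi>, \<psi>) \<in> mero_rel n s s' \<Longrightarrow> (\<psi>, \<phi>) \<in> mero_rel n s s'"
  unfolding mero_rel_def by (auto elim: generically_mono)

lemma mero_rel_trans:
  assumes "(\<phi>, \<psi>) \<in> mero_rel n s s'" "(\<psi>, \<omega>) \<in> mero_rel n s s'"
  shows "(\<phi>, \<omega>) \<in> mero_rel n s s'"
proof -
  have "generically n UNIV (\<lambda>p. \<phi> p = \<psi> p \<and> \<psi> p = \<omega> p)"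
    using assms by (intro generically_conj) (auto simp: mero_rel_def)
  hence "generically n UNIV (\<lambda>p. \<phi> p = \<omega> p)" by (rule generically_mono) simp
  thus ?thesis using assms by (auto simp: mero_rel_def)
qed

lemma mero_rel_class_eq:
  "(\<phi>, \<psi>) \<in> mero_rel n s s' \<Longrightarrow> mero_rel n s s' `` {\<phi>} = mero_rel n s s' `` {\<psi>}"
  by (auto intro: mero_rel_trans mero_rel_sym)

lemma linear_map_combination:
  assumes "Vector_Spaces.linear s s' \<phi>" "Vector_Spaces.linear s s' \<psi>"
  shows "Vector_Spaces.linear s s' (\<lambda>v. s' a (\<phi> v) + s' b (\<psi> v))"
proof -
  interpret vector_space s' using assms(1) by (simp add: Vector_Spaces.linear_iff)
  show ?thesis
    using assms unfolding Vector_Spaces.linear_iff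
    by (auto simp: scale_right_distrib mult.commute)
qed

theorem proposition2:
  fixes n :: nat and \<tau> c :: complex and \<gamma> :: real
    and R :: "complex \<Rightarrow> (nat \<times> nat) cmat"
    and s :: "'v::ab_group_add scaling" and L :: "complex \<Rightarrow> 'v Lmat"
    and s' :: "'w::ab_group_add scaling" and L' :: "complex \<Rightarrow> 'w Lmat"
  assumes "n \<ge> 2" and "Im \<tau> > 0" and "\<gamma> \<notin> \<rat>"
    and "belavin_R n \<tau> \<gamma> R"
    and "CB_object n \<tau> R s L" and "CB_object n \<tau> R s' L'"
  shows "\<exists>X. finite X \<and>
    (\<forall>x. (\<forall>y\<in>X. x - y \<notin> lattice \<tau>) \<longrightarrow>
       hom_iso s' (H_mor n s s') (CB_Hom n s L s' L')
         (DB_Hom n s (H_obj n \<tau> \<gamma> c x s L) s' (H_obj n \<tau> \<gamma> c x s' L')))"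
proof -
  have n: "n \<ge> 1" using assms(1) by simp
  have fin: "fin_dim s" "fin_dim s'" and mero: "mero_Lmat n s L" "mero_Lmat n s' L'"
    using assms(5,6) unfolding CB_object_def by auto
  obtain K P where K: "mero_Lmat n s K" "\<forall>\<^sub>\<approx>z. Lmat_inverse n (L z) (K z)" and P: "finite P"
    "\<forall>\<zeta>. (\<forall>p\<in>P. \<zeta> - p \<notin> lattice \<tau>) \<longrightarrow> regular_at n s L \<zeta> \<and> regular_at n s K \<zeta>"
    by (rule CB_object_regular[OF n assms(2,5)]) (rule that)
  obtain K' P' where "mero_Lmat n s' K'" "\<forall>\<^sub>\<approx>z. Lmat_inverse n (L' z) (K' z)" and P': "finite P'"
    "\<forall>\<zeta>. (\<forall>p\<in>P'. \<zeta> - p \<notin> lattice \<tau>) \<longrightarrow> regular_at n s' L' \<zeta> \<and> regular_at n s' K' \<zeta>"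
    by (rule CB_object_regular[OF n assms(2,6)]) (rule that)
  (* The rows of S^(-1) become proportional at z = x + w, which must avoid the singularities. *)
  define w where "w = c + of_nat n * ((1 + \<tau>) / 2)"
  define X where "X = (\<lambda>p. p - w) ` (P \<union> P')"
  let ?h = "H_mor n s s'" and ?rel = "mero_rel n s s'"
  have lin: "Vector_Spaces.linear s s' \<phi>" if "\<phi> \<in> CB_Hom n s L s' L'" for \<phi>
    using that by (simp add: CB_Hom_def)
  have h_iff: "F \<in> ?h \<phi> \<longleftrightarrow> F \<in> M_Hom n s s' \<and> generically n UNIV (\<lambda>p. \<phi> = F p)"
    if "\<phi> \<in> CB_Hom n s L s' L'" for \<phi> F
    using const_in_M_Hom[OF lin[OF that]] by (auto simp: H_mor_def mero_rel_def)
  have "hom_iso s' ?h (CB_Hom n s L s' L')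
          (DB_Hom n s (H_obj n \<tau> \<gamma> c x s L) s' (H_obj n \<tau> \<gamma> c x s' L'))"
    if x: "\<forall>y\<in>X. x - y \<notin> lattice \<tau>" for x
    unfolding hom_iso_def
  proof (intro conjI ballI allI)
    let ?L = "H_obj n \<tau> \<gamma> c x s L" and ?L' = "H_obj n \<tau> \<gamma> c x s' L'"
    have avoid: "x + w - p \<notin> lattice \<tau>" if "p \<in> P \<union> P'" for p
      using x that unfolding X_def by (auto simp: algebra_simps)
    have reg: "regular_at n s L (x + w)" "regular_at n s K (x + w)" "regular_at n s' L' (x + w)"
      using P(2) P'(2) avoid by auto
    have int: "intertwines n s ?L ?L' (\<lambda>_. \<phi>)" if "\<phi> \<in> CB_Hom n s L s' L'" for \<phi>
    proof -
      have "\<forall>\<^sub>\<approx>z. \<forall>i\<in>{1..n}. \<forall>j\<in>{1..n}. \<forall>v. \<phi> (L z i j v) = L' z i j (\<phi> v)"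
        using that by (simp add: CB_Hom_def)
      thus ?thesis
        unfolding intertwines_def
      proof (rule eventually_mono)
        fix z assume "\<forall>i\<in>{1..n}. \<forall>j\<in>{1..n}. \<forall>v. \<phi> (L z i j v) = L' z i j (\<phi> v)"
        hence "\<phi> (?L z F i p) = ?L' z (\<lambda>j q. \<phi> (F j q)) i p" for F i p
          by (intro const_intertwiner[OF lin[OF that]]) blast
        thus "\<forall>F. (\<forall>j\<in>{1..n}. F j \<in> V_hstar n s) \<longrightarrow> (\<forall>i\<in>{1..n}.
                generically n UNIV (\<lambda>p. \<phi> (?L z F i p) = ?L' z (\<lambda>j q. \<phi> (F j q)) i p))"
          by (auto intro: generically_always)
      qed
    qed
    show "bij_betw ?h (CB_Hom n s L s' L') (DB_Hom n s ?L s' ?L')"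
    proof (rule bij_betw_imageI)
      show "inj_on ?h (CB_Hom n s L s' L')"
      proof (rule inj_onI)
        fix \<phi> \<psi> assume \<phi>\<psi>: "\<phi> \<in> CB_Hom n s L s' L'" "\<psi> \<in> CB_Hom n s L s' L'" "?h \<phi> = ?h \<psi>"
        have "(\<lambda>_. \<psi>) \<in> ?h \<psi>"
          using h_iff[OF \<phi>\<psi>(2)] const_in_M_Hom[OF lin[OF \<phi>\<psi>(2)]] by (auto intro: generically_always)
        hence gen: "generically n UNIV (\<lambda>p. \<phi> = \<psi>)" using h_iff[OF \<phi>\<psi>(1)] \<phi>\<psi>(3) by simp
        from generically_UNIV_ex[OF gen] show "\<phi> = \<psi>" by blast
      qed
      show "?h ` CB_Hom n s L s' L' = DB_Hom n s ?L s' ?L'"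
      proof (intro equalityI subsetI)
        fix C assume "C \<in> ?h ` CB_Hom n s L s' L'"
        then obtain \<phi> where \<phi>: "\<phi> \<in> CB_Hom n s L s' L'" "C = ?rel `` {\<lambda>_. \<phi>}"
          by (auto simp: H_mor_def)
        have "(\<lambda>_. \<phi>) \<in> {\<phi> \<in> M_Hom n s s'. intertwines n s ?L ?L' \<phi>}"
          using const_in_M_Hom[OF lin[OF \<phi>(1)]] int[OF \<phi>(1)] by simp
        thus "C \<in> DB_Hom n s ?L s' ?L'" unfolding DB_Hom_eq \<phi>(2) by (rule quotientI)
      next
        fix C assume "C \<in> DB_Hom n s ?L s' ?L'"
        then obtain \<phi> where \<phi>: "\<phi> \<in> M_Hom n s s'" "intertwines n s ?L ?L' \<phi>" "C = ?rel `` {\<phi>}"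
          unfolding DB_Hom_eq by (auto elim: quotientE)
        obtain \<phi>\<^sub>0 where \<phi>\<^sub>0: "\<phi>\<^sub>0 \<in> CB_Hom n s L s' L'" "generically n UNIV (\<lambda>p. \<phi> p = \<phi>\<^sub>0)"
          by (rule intertwiner_generically_const[OF n assms(2,3) fin \<phi>(1) mero K(2) _ _ _ \<phi>(2)])
             (use reg in \<open>simp_all add: w_def add.assoc\<close>)
        have "(\<phi>, \<lambda>_. \<phi>\<^sub>0) \<in> ?rel"
          using \<phi>(1) \<phi>\<^sub>0(2) const_in_M_Hom[OF lin[OF \<phi>\<^sub>0(1)]] by (simp add: mero_rel_def)
        hence "C = ?h \<phi>\<^sub>0" unfolding \<phi>(3) H_mor_def by (rule mero_rel_class_eq)
        thus "C \<in> ?h ` CB_Hom n s L s' L'" using \<phi>\<^sub>0(1) by blast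
      qed
    qed
  next
    fix \<phi> \<psi> a b F G
    assume \<phi>: "\<phi> \<in> CB_Hom n s L s' L'" and \<psi>: "\<psi> \<in> CB_Hom n s L s' L'" and F: "F \<in> ?h \<phi>" and G: "G \<in> ?h \<psi>"
    let ?\<eta> = "\<lambda>v. s' a (\<phi> v) + s' b (\<psi> v)" and ?H = "\<lambda>p v. s' a (F p v) + s' b (G p v)"
    have "generically n UNIV (\<lambda>p. \<phi> = F p \<and> \<psi> = G p)"
      using F G h_iff[OF \<phi>] h_iff[OF \<psi>] by (intro generically_conj) auto
    hence gen: "generically n UNIV (\<lambda>p. ?H p = ?\<eta>)" by (rule generically_mono) simp
    have "?H \<in> M_Hom n s s'"
    proof (rule M_Hom_generically_const[OF _ gen])
      fix p assume "p \<in> hstar n"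
      thus "Vector_Spaces.linear s s' (?H p)"
        using F G h_iff[OF \<phi>] h_iff[OF \<psi>] by (intro linear_map_combination) (auto simp: M_Hom_def)
    qed
    moreover have "(\<lambda>_. ?\<eta>) \<in> M_Hom n s s'"
      by (rule const_in_M_Hom[OF linear_map_combination[OF lin[OF \<phi>] lin[OF \<psi>]]])
    ultimately show "?H \<in> ?h ?\<eta>"
      using gen by (auto simp: H_mor_def mero_rel_def elim: generically_mono)
  qed
  thus ?thesis using P(1) P'(1) by (intro exI[of _ X]) (auto simp: X_def)
qed

end
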